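(* Let $T=(K,L,R)$ with $L=(1,-1)$, $R=(1)$ and $\deg K=3$, and let $(b_T(n))_{n\in\mathbb N_0}$ be any sequence associated with $T$. Then for every integer $h$ with $2\le h\le 62$ and $h\notin\{36,42,45,48,54,56,60\}$, there exist infinitely many $n$ such that $h\mid b_T(n)$.
   Context: Let $K=(k_n)_{n\in\mathbb N_0}$ be a strictly increasing sequence of non-negative integers with $k_0=0$; set $k_{-n}=-n$ for $n\in\mathbb N$. With $L=(1,-1)$ and $R=(1)$, a sequence of integers $(b_T(n))_{n\in\mathbb N_0}$ (extended by $b_T(q)=0$ for $q<0$) is associated with $T=(K,L,R)$ if for every $n\in\mathbb N_0$: $b_T(k_n)=b_T(k_n+1)=\dots=b_T(k_{n+1}-1)$ and $b_T(k_n)-b_T(k_{n-1})=b_T(n)$ (initial values are otherwise arbitrary). The upper degree is $\overline{\deg}\,K=\sup\{d:\ k_n-k_{n-1}\ge d\text{ for infinitely many }n\}$, the lower degree is $\underline{\deg}\,K=\inf\{d:\ k_n-k_{n-1}=d\text{ for infinitely many }n\}$, and $\deg K$ denotes their common value when they are equal. *)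

theory Defs
  imports Main "HOL-Library.Extended_Nat" "HOL-Library.Infinite_Set"
begin

definition index_seq :: "(nat \<Rightarrow> nat) \<Rightarrow> bool" where
  "index_seq K \<longleftrightarrow> strict_mono K \<and> K 0 = 0"

text \<open>The extension of the sequence to negative indices: \<open>k\<close> at \<open>-n\<close> is \<open>-n\<close>.\<close>

definition kext :: "(nat \<Rightarrow> nat) \<Rightarrow> int \<Rightarrow> int" where
  "kext K i = (if i < 0 then i else int (K (nat i)))"

definition bext :: "(nat \<Rightarrow> int) \<Rightarrow> int \<Rightarrow> int" where
  "bext b q = (if q < 0 then 0 else b (nat q))"

text \<open>Being associated with \<open>T = (K, L, R)\<close> in the case \<open>L = (1, -1)\<close>, \<open>R = (1)\<close>.\<close>

definition associated :: "(nat \<Rightarrow> nat) \<Rightarrow> (nat \<Rightarrow> int) \<Rightarrow> bool" where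
  "associated K b \<longleftrightarrow>
     (\<forall>n::nat.
        (\<forall>m \<in> {kext K (int n)..kext K (int n + 1) - 1}. bext b m = bext b (kext K (int n))) \<and>
        bext b (kext K (int n)) - bext b (kext K (int n - 1)) = bext b (int n))"

text \<open>The degrees are valued in \<^typ>\<open>enat\<close>, so that the supremum of an unbounded set and the
  infimum of the empty set are infinite rather than arbitrary natural numbers.\<close>

definition upper_deg :: "(nat \<Rightarrow> nat) \<Rightarrow> enat" where
  "upper_deg K =
     Sup {enat d | d. \<exists>\<^sub>\<infinity>n::nat. kext K (int n) - kext K (int n - 1) \<ge> int d}"

definition lower_deg :: "(nat \<Rightarrow> nat) \<Rightarrow> enat" where
  "lower_deg K =
     Inf {enat d | d. \<exists>\<^sub>\<infinity>n::nat. kext K (int n) - kext K (int n - 1) = int d}"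

definition has_deg :: "(nat \<Rightarrow> nat) \<Rightarrow> enat \<Rightarrow> bool" where
  "has_deg K d \<longleftrightarrow> upper_deg K = d \<and> lower_deg K = d"

end

theory Submission imports Defs "HOL-Number_Theory.Cong" begin

text \<open>
  From some index on, \<open>K\<close> advances in steps of 3, so the sequence \<open>a n = b (K n)\<close> reproduces its own
  windows: if \<open>w1, ..., wl\<close> are consecutive values of \<open>a\<close>, then so are, further on and for some \<open>x\<close>, the
  values \<open>x, x + w1, x + 2 w1, x + 3 w1, x + 3 w1 + w2, ...\<close>, in which every \<open>wi\<close> is added three times.
  Call a window dead modulo \<open>h\<close> if it contains a multiple of \<open>h\<close> or if all its expansions, over all \<open>x\<close>,
  are dead. A dead window forces a later multiple of \<open>h\<close>.

  Deadness depends only on residues, passes to longer windows, and is invariant under reversal and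
  under multiplication by units modulo \<open>h\<close>. Let \<open>g\<close> be 1 if \<open>h\<close> is prime and \<open>h / q\<close> for a prime \<open>q\<close>
  otherwise. By induction on \<open>h\<close>, multiples of \<open>g\<close> recur in \<open>a\<close>, and modulo \<open>h\<close> such a value is 0 or, up to
  a unit, \<open>g\<close>; so it is enough that the window \<open>[g]\<close> is dead. This is a finite tree search, which becomes
  feasible by proving progressions \<open>x, x + v, x + 2 v, x + 3 v\<close> (the expansions of \<open>[v]\<close>) dead one after
  the other: a progression known to be dead, together with its images under units and reversal,
  prunes the later searches.
\<close>

section \<open>Expansions and dead windows\<close>

text \<open>With \<open>K\<close> advancing by 3, an index \<open>K n + i\<close> with
  \<open>i < 3\<close> lies in the block of \<open>n\<close>, where \<open>b\<close> takes the value
  \<open>b (K n)\<close>; hence \<open>a\<close> grows by \<open>a n\<close> at each of the three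
  indices \<open>K n\<close>, \<open>K n + 1\<close>, \<open>K n + 2\<close>. Only the entry
  \<open>a (K n - 1)\<close>, from which this growth starts, is uncontrolled. This is why deadness
  quantifies over every \<open>x\<close>, and how arbitrary initial values of \<open>b\<close> are
  covered. A longer window leaves fewer admissible \<open>x\<close>, since every partial sum has to
  avoid 0 modulo \<open>h\<close>; this is what lets branches die. The obstacle is the width of the
  tree: early windows are so short that most residues survive. Progressions are the natural unit for
  sharing work, because every expansion is a chain of them, one for each entry of the window. The
  quotient \<open>h / g\<close> is always prime (for prime \<open>h\<close> it is \<open>h\<close>
  itself). Units modulo \<open>h\<close> map onto the nonzero residues modulo that prime, so the
  nonzero multiples of \<open>g\<close> form a single orbit under units.\<close>

fun expand :: "int \<Rightarrow> int list \<Rightarrow> int list" where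
  "expand x [] = [x]"
| "expand x (v # w) = x # (x + v) # (x + 2 * v) # expand (x + 3 * v) w"

text \<open>A derivation is a well-founded tree that branches over all integers \<open>x\<close>, so
  no depth bound and no reduction modulo \<open>h\<close> enters the definition. Induction over this
  tree drives every transfer result below.\<close>

inductive dead :: "int \<Rightarrow> int list \<Rightarrow> bool" for h :: int where
  hit: "v \<in> set w \<Longrightarrow> h dvd v \<Longrightarrow> dead h w"
| branch: "(\<And>x. dead h (expand x w)) \<Longrightarrow> dead h w"

text \<open>The last entry of the expansion of \<open>u\<close> is
  \<open>x + 3 * sum_list u\<close>, which is also the first entry of the expansion of
  \<open>w\<close>; \<open>butlast\<close> removes the duplicate.\<close>

lemma expand_append:
  "expand x (u @ w) = butlast (expand x u) @ expand (x + 3 * sum_list u) w"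
proof (induction u arbitrary: x)
  case (Cons a u)
  have "expand y u \<noteq> []" for y
    by (cases u) auto
  with Cons show ?case
    by (simp add: algebra_simps)
qed simp

lemma expand_prefix: "\<exists>z. expand x (u @ w) = expand x u @ z"
proof (induction u arbitrary: x)
  case Nil
  then show ?case by (cases w) auto
next
  case (Cons a u)
  then show ?case by auto
qed

lemma dead_append_right: "dead h w \<Longrightarrow> dead h (w @ z)"
proof (induction arbitrary: z rule: dead.induct)
  case (hit v w)
  then show ?case by (auto intro: dead.hit)
next
  case (branch w)
  show ?case
  proof (rule dead.branch)
    fix x
    obtain y where "expand x (w @ z) = expand x w @ y"
      using expand_prefix by blast
    then show "dead h (expand x (w @ z))"
      using branch by simp
  qed
qed

text \<open>An expansion of \<open>z @ w\<close> ends in an expansion of \<open>w\<close> from a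
  shifted start, and \<open>branch\<close> provides deadness for every start.\<close>

lemma dead_append_left: "dead h w \<Longrightarrow> dead h (z @ w)"
proof (induction arbitrary: z rule: dead.induct)
  case (hit v w)
  then show ?case by (auto intro: dead.hit)
next
  case (branch w)
  show ?case
    by (rule dead.branch) (simp only: expand_append branch)
qed

abbreviation congs :: "int \<Rightarrow> int list \<Rightarrow> int list \<Rightarrow> bool" where
  "congs h \<equiv> list_all2 (\<lambda>a b. [a = b] (mod h))"

lemma congs_expand:
  "congs h w w' \<Longrightarrow> [x = x'] (mod h) \<Longrightarrow> congs h (expand x w) (expand x' w')"
proof (induction w w' arbitrary: x x' rule: list_all2_induct)
  case (Cons a w b w')
  then show ?case
    by (auto intro!: Cons.IH cong_add cong_mult)
qed simp

text \<open>This licenses the replacement of integers by residues, which leaves only finitely many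
  starts to search.\<close>

lemma dead_cong: "dead h w \<Longrightarrow> congs h w w' \<Longrightarrow> dead h w'"
proof (induction arbitrary: w' rule: dead.induct)
  case (hit v w)
  then obtain v' where "v' \<in> set w'" "[v = v'] (mod h)"
    by (metis in_set_conv_nth list_all2_conv_all_nth)
  with hit show ?case
    by (auto intro: dead.hit simp: cong_dvd_iff)
next
  case (branch w)
  show ?case
    by (rule dead.branch) (rule branch.IH[OF congs_expand[OF branch.prems cong_refl]])
qed

lemma map_expand: "map ((*) u) (expand x w) = expand (u * x) (map ((*) u) w)"
  by (induction x w rule: expand.induct) (auto simp: algebra_simps)

lemma congs_refl: "congs h w w"
  by (rule list_all2_refl) simp

text \<open>Modulo \<open>h\<close>, the expansion of the scaled window from \<open>x\<close> is the
  scaled expansion of \<open>w\<close> from \<open>u' * x\<close>, so scaling merely permutes the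
  branches.\<close>

lemma dead_scale:
  assumes "dead h w" and unit: "[u * u' = 1] (mod h)"
  shows "dead h (map ((*) u) w)"
  using assms(1)
proof (induction rule: dead.induct)
  case (hit v w)
  then have "u * v \<in> set (map ((*) u) w)" "h dvd u * v"
    by auto
  then show ?case by (rule dead.hit)
next
  case (branch w)
  show ?case
  proof (rule dead.branch)
    fix x
    have "[u * (u' * x) = x] (mod h)"
      using cong_scalar_right[OF unit, of x] by (simp add: mult.assoc)
    then have "congs h (expand (u * (u' * x)) (map ((*) u) w)) (expand x (map ((*) u) w))"
      by (intro congs_expand congs_refl)
    with branch.IH[of "u' * x"] show "dead h (expand x (map ((*) u) w))"
      by (metis dead_cong map_expand)
  qed
qed

text \<open>Read backwards, an expansion runs from its last entry through the same increments in
  opposite order and with opposite sign.\<close>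

lemma rev_expand:
  "rev (expand x w) = expand (x + 3 * sum_list w) (map uminus (rev w))"
proof (induction w arbitrary: x)
  case (Cons v w)
  have "rev (expand x (v # w)) = rev (expand (x + 3 * v) w) @ [x + 2 * v, x + v, x]"
    by simp
  also have "\<dots> = expand (x + 3 * sum_list (v # w)) (map uminus (rev w)) @ [x + 2 * v, x + v, x]"
    by (simp add: Cons.IH algebra_simps)
  also have "\<dots> = expand (x + 3 * sum_list (v # w)) (map uminus (rev w) @ [- v])"
  proof -
    \<comment> \<open>The recursion of \<open>expand\<close> seen from the right end: one more
      letter contributes three more entries.\<close>
    have *: "expand y (u @ [a]) = expand y u @ [y + 3 * sum_list u + a,
        y + 3 * sum_list u + 2 * a, y + 3 * sum_list u + 3 * a]" for y a :: int and u
      by (induction u arbitrary: y) (auto simp: algebra_simps)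
    have "sum_list (map uminus (rev w)) = - sum_list w"
      by (induction w) auto
    then show ?thesis
      by (simp add: * algebra_simps)
  qed
  finally show ?case by simp
qed simp

lemma dead_rev: "dead h w \<Longrightarrow> dead h (rev w)"
proof (induction rule: dead.induct)
  case (hit v w)
  then show ?case by (auto intro: dead.hit)
next
  case (branch w)
  show ?case
  proof (rule dead.branch)
    fix x
    \<comment> \<open>Chosen so that the reversed and negated expansion from \<open>y\<close> starts
      at \<open>- (y + 3 * sum_list w) = x\<close>.\<close>
    define y where "y = - x - 3 * sum_list w"
    have "dead h (map ((*) (- 1)) (rev (expand y w)))"
      by (rule dead_scale[where u' = "- 1"]) (use branch.IH in auto)
    also have "map ((*) (- 1)) (rev (expand y w)) = expand x (rev w)"
      by (simp only: rev_expand map_expand) (simp add: y_def o_def)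
    finally show "dead h (expand x (rev w))" .
  qed
qed

section \<open>Four-term progressions and their symmetries\<close>

definition ap :: "int \<Rightarrow> int \<Rightarrow> int list" where
  "ap x v = [x, x + v, x + 2 * v, x + 3 * v]"

lemma expand_singleton: "expand x [v] = ap x v"
  by (simp add: ap_def)

lemma dead_ap_scale:
  assumes "dead h (ap x v)" "coprime u h"
  shows "dead h (ap (u * x) (u * v))"
proof -
  obtain u' where "[u * u' = 1] (mod h)"
    using cong_solve_coprime_int[OF assms(2)] by blast
  then have "dead h (map ((*) u) (ap x v))"
    using assms(1) dead_scale by blast
  then show ?thesis
    by (simp add: ap_def algebra_simps)
qed

text \<open>Reversal and negation each change the sign of the difference; together they preserve it,
  so the reflected progression belongs to the same lookup board.\<close>

lemma dead_ap_reflect: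
  assumes "dead h (ap x v)"
  shows "dead h (ap (- x - 3 * v) v)"
proof -
  have "dead h (map ((*) (- 1)) (rev (ap x v)))"
    by (rule dead_scale[where u' = "- 1"]) (use assms dead_rev in auto)
  then show ?thesis
    by (simp add: ap_def algebra_simps)
qed

lemma congs_ap: "[x = x'] (mod h) \<Longrightarrow> [v = v'] (mod h) \<Longrightarrow> congs h (ap x v) (ap x' v')"
  unfolding expand_singleton[symmetric] by (rule congs_expand) auto

section \<open>Sequences reproducing their windows\<close>

text \<open>The inequality \<open>n < K n\<close> serves twice: it makes \<open>K n - 1\<close> a
  genuine predecessor, and it keeps the next window, which starts at \<open>K n - 1\<close>, from
  lying before \<open>n\<close>.\<close>

definition tripling :: "(nat \<Rightarrow> int) \<Rightarrow> bool" where
  "tripling a \<longleftrightarrow> (\<exists>K N. \<forall>n\<ge>N. n < K n \<and> K (Suc n) = K n + 3 \<and>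
     (\<forall>i<3. a (K n + i) = a (K n + i - 1) + a n))"

definition inevitable :: "int \<Rightarrow> bool" where
  "inevitable h \<longleftrightarrow> (\<forall>a. tripling a \<longrightarrow> (\<exists>\<^sub>\<infinity>n. h dvd a n))"

text \<open>Induction over the derivation with the position \<open>n\<close> generalised:
  \<open>branch\<close> is instantiated with the value \<open>a (K n - 1)\<close> that actually
  occurs, and positions never decrease, so a leaf yields its multiple of \<open>h\<close> beyond
  \<open>N'\<close>.\<close>

lemma dead_hits:
  assumes K: "\<And>n. n \<ge> N \<Longrightarrow> n < K n \<and> K (Suc n) = K n + 3 \<and>
      (\<forall>i<3. a (K n + i) = a (K n + i - 1) + a n)"
    and "dead h w" "n \<ge> N" "n \<ge> N'" "map a [n..<n + length w] = w"
  shows "\<exists>m\<ge>N'. h dvd a m"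
  using assms(2-)
proof (induction arbitrary: n rule: dead.induct)
  case (hit v w)
  have "v \<in> set (map a [n..<n + length w])"
    using hit by simp
  then obtain m where "m \<ge> n" "v = a m"
    by auto
  with hit.hyps hit.prems(2) show ?case
    by (meson le_trans)
next
  case (branch w)
  have K_add: "K (n + L) = K n + 3 * L" for L
    by (induction L) (use K branch.prems(1) in auto)
  \<comment> \<open>The image begins one place before \<open>K n\<close>, because the increment at
    \<open>K n\<close> is measured from \<open>a (K n - 1)\<close>; this accounts for
    \<open>3 * L + 1\<close> entries.\<close>
  have window: "expand (a (K n - 1)) (map a [n..<n + L]) = map a [K n - 1..<K n + 3 * L]" for L
    using branch.prems(1)
  proof (induction L arbitrary: n)
    case 0
    with K[of n] show ?case by (auto simp: upt_conv_Cons)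
  next
    case (Suc L)
    note Kn = K[of n] 
    have step: "a (K n) = a (K n - 1) + a n" "a (K n + 1) = a (K n) + a n" 
        "a (K n + 2) = a (K n + 1) + a n" "0 < K n" "K (Suc n) = K n + 3"
      using Kn Suc.prems by (force simp: numeral_3_eq_3)+
    have "[K n - 1..<K n + 3 * Suc L] =
        (K n - 1) # K n # (K n + 1) # [K (Suc n) - 1..<K (Suc n) + 3 * L]"
      using step(4,5) by (simp del: upt_Suc add: upt_conv_Cons add.assoc)
    moreover have "[n..<n + Suc L] = n # [Suc n..<Suc n + L]"
      by (simp del: upt_Suc add: upt_conv_Cons)
    moreover have "a (K (Suc n) - 1) = a (K n - 1) + 3 * a n"
      using step by (simp add: eval_nat_numeral)
    moreover note Suc.IH[of "Suc n"]
    ultimately show ?case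
      using Suc.prems step by (simp del: upt_Suc)
  qed
  have len: "length (expand x w) = 3 * length w + 1" for x
    by (induction x w rule: expand.induct) auto
  have Kn: "n < K n"
    using K branch.prems by blast
  have "expand (a (K n - 1)) w = map a [K n - 1..<K n + 3 * length w]"
    using window[of "length w"] branch.prems by simp
  also have "K n + 3 * length w = K n - 1 + length (expand (a (K n - 1)) w)"
    using Kn by (simp add: len)
  finally show ?case
    using branch.IH[of "K n - 1" "a (K n - 1)"] branch.prems(1,2) Kn by simp
qed

lemma inevitable_1: "inevitable 1"
  by (simp add: inevitable_def INFM_nat)

lemma inevitable_dvd: "inevitable h \<Longrightarrow> d dvd h \<Longrightarrow> inevitable d"
  unfolding inevitable_def INFM_nat by (meson dvd_trans)

text \<open>A single value is a window of length one, so the recurring multiples of \<open>g\<close>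
  can be fed to \<open>dead_hits\<close> directly. The hypothesis \<open>units\<close> says that all
  nonzero residues divisible by \<open>g\<close> are alike up to units.\<close>

lemma inevitable_step:
  assumes g: "inevitable g" and "dead h [g]" "h > 0"
    and units: "\<And>v. g dvd v \<Longrightarrow> 0 < v \<Longrightarrow> v < h \<Longrightarrow> \<exists>u. coprime u h \<and> [u * v = g] (mod h)"
    and "g dvd h"
  shows "inevitable h"
  unfolding inevitable_def
proof (intro allI impI)
  fix a assume a: "tripling a"
  then obtain K N where K: "\<And>n. n \<ge> N \<Longrightarrow> n < K n \<and> K (Suc n) = K n + 3 \<and>
      (\<forall>i<3. a (K n + i) = a (K n + i - 1) + a n)"
    unfolding tripling_def by blast
  have "\<exists>m\<ge>N'. h dvd a m" for N'
  proof -
    obtain n where n: "n \<ge> max N N'" "g dvd a n"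
      using g a unfolding inevitable_def INFM_nat_le by blast
    define v where "v = a n mod h"
    have v: "0 \<le> v" "v < h" "g dvd v" "[v = a n] (mod h)"
      using \<open>h > 0\<close> n \<open>g dvd h\<close> by (auto simp: v_def dvd_mod)
    have "dead h [v]"
    proof (cases "v = 0")
      case True
      then show ?thesis by (auto intro: dead.hit)
    next
      case False
      then obtain u where u: "coprime u h" "[u * v = g] (mod h)"
        using units v by force
      \<comment> \<open>As \<open>u\<close> carries \<open>v\<close> to \<open>g\<close>, its
        inverse carries the dead window \<open>[g]\<close> to \<open>[v]\<close>.\<close>
      then obtain u' where u': "[u * u' = 1] (mod h)"
        using cong_solve_coprime_int by blast
      then have "dead h (map ((*) u') [g])"
        by (intro dead_scale[where u' = u]) (use assms in \<open>auto simp: mult.commute\<close>)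
      moreover have "[u' * g = v] (mod h)"
      proof -
        have "[u' * g = u' * (u * v)] (mod h)"
          using u(2) by (intro cong_mult cong_refl) (simp add: cong_sym)
        also have "u' * (u * v) = u * u' * v"
          by simp
        also have "[u * u' * v = 1 * v] (mod h)"
          using u' by (rule cong_scalar_right)
        finally show ?thesis by simp
      qed
      ultimately show ?thesis
        by (auto intro: dead_cong)
    qed
    then have "dead h [a n]"
      using v(4) by (auto intro: dead_cong)
    then show ?thesis
      using dead_hits[OF K, of "N" h "[a n]" n N'] n by simp
  qed
  then show "\<exists>\<^sub>\<infinity>n. h dvd a n"
    by (simp add: INFM_nat_le)
qed

section \<open>Sequences of degree 3\<close>

lemma eventually_step_eq_3:
  assumes K: "index_seq K" and deg: "has_deg K 3"
  shows "\<exists>N. \<forall>n\<ge>N. K (Suc n) = K n + 3"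
proof -
  let ?d = "\<lambda>n. kext K (int n) - kext K (int n - 1)"
  have d: "?d (Suc n) = int (K (Suc n)) - int (K n)" for n
    by (simp add: kext_def nat_add_distrib)
  have pos: "K n < K (Suc n)" for n
    using K by (simp add: index_seq_def strict_mono_Suc_iff)
  have "\<not> (\<exists>\<^sub>\<infinity>n. ?d n \<ge> int 4)"
  proof
    assume "\<exists>\<^sub>\<infinity>n. ?d n \<ge> int 4"
    then have "enat 4 \<le> upper_deg K"
      unfolding upper_deg_def by (intro Sup_upper) blast
    with deg show False
      by (simp add: has_deg_def numeral_eq_enat)
  qed
  note ge4 = this
  have ne: "\<not> (\<exists>\<^sub>\<infinity>n. ?d n = int e)" if "e < 3" for e
  proof
    assume "\<exists>\<^sub>\<infinity>n. ?d n = int e"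
    then have "lower_deg K \<le> enat e"
      unfolding lower_deg_def by (intro Inf_lower) blast
    with deg that show False
      by (simp add: has_deg_def numeral_eq_enat)
  qed
  \<comment> \<open>Large steps die out because of the supremum, small ones because of the infimum;
    a step of 0 is excluded by \<open>pos\<close>, so 3 is all that remains.\<close>
  from ge4 ne[of 1] ne[of 2]
  have "\<forall>\<^sub>\<infinity>n. \<not> ?d n \<ge> int 4 \<and> ?d n \<noteq> int 1 \<and> ?d n \<noteq> int 2"
    by (simp only: MOST_conj_distrib not_INFM)
  then obtain N where N: "\<And>n. n > N \<Longrightarrow> \<not> ?d n \<ge> int 4 \<and> ?d n \<noteq> int 1 \<and> ?d n \<noteq> int 2"
    unfolding MOST_nat by blast
  have "K (Suc n) = K n + 3" if "n \<ge> N" for n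
  proof -
    have "Suc n > N" using that by simp
    from N[OF this, unfolded d] show ?thesis
      using pos[of n] by linarith
  qed
  then show ?thesis by blast
qed

lemma associated_tripling:
  assumes K: "index_seq K" and "has_deg K 3" and b: "associated K b"
  shows "tripling (\<lambda>n. b (K n))"
proof -
  obtain N where N: "\<And>n. n \<ge> N \<Longrightarrow> K (Suc n) = K n + 3"
    using eventually_step_eq_3 assms by blast
  have mono: "strict_mono K"
    using K by (simp add: index_seq_def)
  have ge: "n \<le> K n" for n
    using mono by (rule strict_mono_imp_increasing)
  \<comment> \<open>The general bound \<open>n \<le> K n\<close> becomes strict after one step of 3
    and stays so.\<close>
  have gt: "n < K n" if "n \<ge> Suc N" for n
  proof -
    have "K (Suc N + j) \<ge> Suc N + 2 + j" for j
    proof (induction j)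
      case 0
      then show ?case using ge[of N] N[of N] by simp
    next
      case (Suc j)
      then show ?case using N[of "Suc N + j"] by simp
    qed
    from this[of "n - Suc N"] show ?thesis using that by simp
  qed
  have const: "b m = b (K n)" if "K n \<le> m" "m < K (Suc n)" for n m
  proof -
    have "\<forall>m \<in> {kext K (int n)..kext K (int n + 1) - 1}. bext b m = bext b (kext K (int n))"
      using b unfolding associated_def by blast
    moreover have "kext K (int n) = int (K n)" "kext K (int n + 1) = int (K (Suc n))"
      by (simp_all add: kext_def nat_add_distrib)
    moreover have "int m \<in> {int (K n)..int (K (Suc n)) - 1}"
      using that by simp
    ultimately have "bext b (int m) = bext b (int (K n))"
      by metis
    then show ?thesis by (simp add: bext_def)
  qed
  have diff: "b (K (Suc n)) = b (K n) + b (Suc n)" for n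
  proof -
    have "bext b (kext K (int (Suc n))) - bext b (kext K (int (Suc n) - 1)) = bext b (int (Suc n))"
      using b unfolding associated_def by blast
    then show ?thesis by (simp add: kext_def bext_def nat_add_distrib)
  qed
  have "b (K (K n + i)) = b (K (K n + i - 1)) + b (K n)" if "n \<ge> Suc N" "i < 3" for n i
  proof -
    have "n < K n"
      using that by (intro gt)
    \<comment> \<open>\<open>diff\<close> speaks of the step into a successor, so
      \<open>K n + i\<close> must be positive.\<close>
    then obtain j where j: "K n + i = Suc j"
      by (cases "K n + i") auto
    have "b (K n + i) = b (K n)"
      using const[of n "K n + i"] N[of n] that by simp
    then show ?thesis
      using diff[of j] j by simp
  qed
  note rec = this
  show ?thesis
    unfolding tripling_def
  proof (intro exI[of _ K] exI[of _ "Suc N"] allI impI conjI)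
    show "n < K n" "K (Suc n) = K n + 3" if "n \<ge> Suc N" for n
      using that gt N by simp_all
  qed (rule rec)
qed

text \<open>A multiple of \<open>h\<close> at position \<open>n\<close> of the subsequence is one at
  position \<open>K n\<close> of \<open>b\<close>, and \<open>n \<le> K n\<close> keeps these
  positions unbounded.\<close>

lemma inevitable_INFM:
  assumes "inevitable h" "index_seq K" "has_deg K 3" "associated K b"
  shows "\<exists>\<^sub>\<infinity>n. h dvd b n"
proof -
  have inf: "\<exists>\<^sub>\<infinity>n. h dvd b (K n)"
    using assms associated_tripling unfolding inevitable_def by blast
  have "n \<le> K n" for n
    using assms(2) by (auto simp: index_seq_def intro: strict_mono_imp_increasing)
  then have "\<exists>m\<ge>N. h dvd b m" for N
    using inf unfolding INFM_nat_le by (meson le_trans)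
  then show ?thesis
    unfolding INFM_nat_le by blast
qed

section \<open>The tree search\<close>

datatype window = E | C nat window

text \<open>A board is a set of numbers below 64, stored as eight bytes.\<close>

datatype board = N nat nat nat nat nat nat nat nat

text \<open>
  Progressions known to be dead: bit \<open>x\<close> of the first board stands for \<open>ap x 1\<close>, bit \<open>x\<close> of the second
  one for \<open>ap x g\<close>. With \<open>NT\<close> nothing is looked up.
\<close>

datatype known = NT | TT board board

text \<open>
  The initial board consists of 0 and of the numbers from the modulus on. Entry \<open>v\<close> of \<open>ratios\<close> tells how
  \<open>ap p v\<close> is looked up: for \<open>0 < u < 64\<close> the unit \<open>u\<close> satisfies \<open>u * v = 1\<close> and carries it to \<open>ap (p * u) 1\<close>;
  for \<open>u > 64\<close> the unit \<open>u - 64\<close> satisfies \<open>(u - 64) * v = g\<close> and carries it to \<open>ap (p * (u - 64)) g\<close>; for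
  \<open>u = 0\<close> it is not looked up.
\<close>

datatype cfg = M (modulus: nat) (initial: board) (ratios: "nat list")

primrec ints :: "window \<Rightarrow> int list" where
  "ints E = []"
| "ints (C v w) = int v # ints w"

primrec elems :: "window \<Rightarrow> nat set" where
  "elems E = {}"
| "elems (C v w) = insert v (elems w)"

section \<open>Sets of residues as bytes\<close>

definition insert_bit :: "nat \<Rightarrow> nat \<Rightarrow> nat" where
  "insert_bit k b = (if odd (b div 2 ^ k) then b else b + 2 ^ k)"

definition test_bit :: "nat \<Rightarrow> nat \<Rightarrow> bool" where
  "test_bit k b = odd (b div 2 ^ k)"

lemma test_insert_bit: "test_bit j (insert_bit k b) \<longleftrightarrow> j = k \<or> test_bit j b"
proof -
  have "insert_bit k b = set_bit k b"
    by (auto simp: insert_bit_def set_bit_eq bit_iff_odd)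
  then show ?thesis
    by (auto simp: test_bit_def bit_iff_odd[symmetric] bit_set_bit_iff)
qed

fun mark :: "nat \<Rightarrow> board \<Rightarrow> board" where
  "mark x (N b0 b1 b2 b3 b4 b5 b6 b7) =
    (let k = x mod 8; j = x div 8 in
     if j = 0 then N (insert_bit k b0) b1 b2 b3 b4 b5 b6 b7
     else if j = 1 then N b0 (insert_bit k b1) b2 b3 b4 b5 b6 b7
     else if j = 2 then N b0 b1 (insert_bit k b2) b3 b4 b5 b6 b7
     else if j = 3 then N b0 b1 b2 (insert_bit k b3) b4 b5 b6 b7
     else if j = 4 then N b0 b1 b2 b3 (insert_bit k b4) b5 b6 b7
     else if j = 5 then N b0 b1 b2 b3 b4 (insert_bit k b5) b6 b7
     else if j = 6 then N b0 b1 b2 b3 b4 b5 (insert_bit k b6) b7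
     else if j = 7 then N b0 b1 b2 b3 b4 b5 b6 (insert_bit k b7)
     else N b0 b1 b2 b3 b4 b5 b6 b7)"

fun marked :: "nat \<Rightarrow> board \<Rightarrow> bool" where
  "marked x (N b0 b1 b2 b3 b4 b5 b6 b7) =
    (let k = x mod 8; j = x div 8 in
     if j = 0 then test_bit k b0 else if j = 1 then test_bit k b1 else if j = 2 then test_bit k b2
     else if j = 3 then test_bit k b3 else if j = 4 then test_bit k b4 else if j = 5 then test_bit k b5
     else if j = 6 then test_bit k b6 else if j = 7 then test_bit k b7 else False)"

text \<open>A number is determined by its byte and its bit within the byte. From 64 on there is no
  byte, so marking does nothing, whence the side condition.\<close>

lemma marked_mark: "marked y (mark x B) \<longleftrightarrow> y = x \<and> x < 64 \<or> marked y B"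
proof (cases B)
  case (N b0 b1 b2 b3 b4 b5 b6 b7)
  have eq: "y = x \<longleftrightarrow> y div 8 = x div 8 \<and> y mod 8 = x mod 8"
    by (metis div_mult_mod_eq)
  have lt: "x < 64 \<longleftrightarrow> x div 8 < 8"
    by (simp add: div_less_iff_less_mult)
  consider "x div 8 = 0" | "x div 8 = 1" | "x div 8 = 2" | "x div 8 = 3" | "x div 8 = 4"
    | "x div 8 = 5" | "x div 8 = 6" | "x div 8 = 7" | "8 \<le> x div 8"
    by linarith
  then show ?thesis
    unfolding eq lt N by cases (auto simp: Let_def test_insert_bit)
qed

primrec scan_byte :: "nat \<Rightarrow> window \<Rightarrow> window \<Rightarrow> window" where
  "scan_byte j E r = r"
| "scan_byte j (C i w) r = C (8 * j + i) (scan_byte j w r)"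

text \<open>Taken byte by byte, so that a table of 256 rows is enough to read off any board.\<close>

definition zeros :: "nat \<Rightarrow> window" where
  "zeros b = foldr C (filter (\<lambda>i. \<not> test_bit i b) [0..<8]) E"

fun unmarked :: "board \<Rightarrow> window" where
  "unmarked (N b0 b1 b2 b3 b4 b5 b6 b7) =
     scan_byte 0 (zeros b0) (scan_byte 1 (zeros b1) (scan_byte 2 (zeros b2) (scan_byte 3 (zeros b3)
    (scan_byte 4 (zeros b4) (scan_byte 5 (zeros b5) (scan_byte 6 (zeros b6) (scan_byte 7 (zeros b7) E)))))))"

lemma elems_scan_byte:
  "x \<in> elems (scan_byte j (zeros b) r) \<longleftrightarrow> x div 8 = j \<and> \<not> test_bit (x mod 8) b \<or> x \<in> elems r"
proof -
  have "x \<in> elems (scan_byte j w r) \<longleftrightarrow> (\<exists>i\<in>elems w. x = 8 * j + i) \<or> x \<in> elems r" for w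
    by (induction w) auto
  moreover have "elems (foldr C xs E) = set xs" for xs
    by (induction xs) auto
  then have "elems (zeros b) = {i. i < 8 \<and> \<not> test_bit i b}"
    by (auto simp: zeros_def)
  moreover have "(\<exists>i. i < 8 \<and> \<not> test_bit i b \<and> x = 8 * j + i) \<longleftrightarrow> x div 8 = j \<and> \<not> test_bit (x mod 8) b"
    by (auto intro!: exI[of _ "x mod 8"])
  ultimately show ?thesis by auto
qed

text \<open>Soundness rests on this direction: an unmarked residue missing from the list would be a
  branch never searched.\<close>

lemma elems_unmarked: "x < 64 \<Longrightarrow> \<not> marked x B \<Longrightarrow> x \<in> elems (unmarked B)"
proof (cases B)
  case (N b0 b1 b2 b3 b4 b5 b6 b7)
  assume x: "x < 64" "\<not> marked x B"
  have "x div 8 < 8"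
    using x by (simp add: div_less_iff_less_mult)
  then consider "x div 8 = 0" | "x div 8 = 1" | "x div 8 = 2" | "x div 8 = 3" | "x div 8 = 4"
    | "x div 8 = 5" | "x div 8 = 6" | "x div 8 = 7"
    by linarith
  then show ?thesis
    by cases (use x(2) in \<open>simp_all only: N unmarked.simps marked.simps Let_def elems_scan_byte if_True if_False, auto\<close>)
qed

section \<open>Residue arithmetic and the bounded search\<close>

definition msub :: "cfg \<Rightarrow> nat \<Rightarrow> nat \<Rightarrow> nat" where
  "msub m a b = nat ((int a - int b) mod int (modulus m))"

definition mmul :: "cfg \<Rightarrow> nat \<Rightarrow> nat \<Rightarrow> nat" where
  "mmul m a b = a * b mod modulus m"

text \<open>Addition is reduced to subtraction, so that one table of differences determines both
  operations.\<close>

definition madd :: "cfg \<Rightarrow> nat \<Rightarrow> nat \<Rightarrow> nat" where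
  "madd m a b = msub m a (msub m 0 b)"

text \<open>
  \<open>scan m s w B\<close> adds to \<open>B\<close> all \<open>x\<close> for which the tail of \<open>expand (x - s) w\<close> contains a multiple of the
  modulus; \<open>child m p w\<close> is the tail of \<open>expand p w\<close>.
\<close>

primrec scan :: "cfg \<Rightarrow> nat \<Rightarrow> window \<Rightarrow> board \<Rightarrow> board" where
  "scan m s E B = B"
| "scan m s (C d w) B = scan m (msub m (msub m (msub m s d) d) d) w
     (mark (msub m (msub m (msub m s d) d) d) (mark (msub m (msub m s d) d) (mark (msub m s d) B)))"

primrec child :: "cfg \<Rightarrow> nat \<Rightarrow> window \<Rightarrow> window" where
  "child m p E = E"
| "child m p (C v w) = C (madd m p v) (C (madd m (madd m p v) v) (C (madd m (madd m (madd m p v) v) v)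
     (child m (madd m (madd m (madd m p v) v) v) w)))"

definition hit_known :: "cfg \<Rightarrow> nat \<Rightarrow> nat \<Rightarrow> board \<Rightarrow> board \<Rightarrow> bool" where
  "hit_known m v p A B = (let u = ratios m ! v in
     if v \<ge> length (ratios m) \<or> u = 0 then False
     else if u < 64 then marked (mmul m p u) A else marked (mmul m p (u - 64)) B)"

text \<open>The expansion of \<open>w\<close> from \<open>p\<close> is a chain of progressions that
  share end points; a single known one among them kills the whole expansion.\<close>

primrec pruned :: "cfg \<Rightarrow> board \<Rightarrow> board \<Rightarrow> nat \<Rightarrow> window \<Rightarrow> bool" where
  "pruned m A B p E = False"
| "pruned m A B p (C v w) = (hit_known m v p A B \<or> pruned m A B (madd m (madd m (madd m p v) v) v) w)"

definition or_pruned :: "bool \<Rightarrow> cfg \<Rightarrow> board \<Rightarrow> board \<Rightarrow> nat \<Rightarrow> window \<Rightarrow> bool" where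
  "or_pruned b m A B p w = (b \<or> pruned m A B p w)"

primrec pruned_tbl :: "cfg \<Rightarrow> known \<Rightarrow> nat \<Rightarrow> window \<Rightarrow> bool" where
  "pruned_tbl m NT p w = False"
| "pruned_tbl m (TT A B) p w = pruned m A B p w"

primrec all_window :: "(nat \<Rightarrow> bool) \<Rightarrow> window \<Rightarrow> bool" where
  "all_window P E = True"
| "all_window P (C x w) = (P x \<and> all_window P w)"

lemma all_window_iff: "all_window P w \<longleftrightarrow> (\<forall>x\<in>elems w. P x)"
  by (induction w) auto

text \<open>The first argument bounds the depth and fails at 0: a bounded search may miss a death
  but never invents one.\<close>

primrec dies :: "nat \<Rightarrow> cfg \<Rightarrow> known \<Rightarrow> window \<Rightarrow> bool" where
  "dies 0 m T w = False"
| "dies (Suc n) m T w = all_window (\<lambda>x. pruned_tbl m T x w \<or> dies n m T (C x (child m x w))) (unmarked (scan m 0 w (initial m)))"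

definition child_dies :: "bool \<Rightarrow> nat \<Rightarrow> cfg \<Rightarrow> known \<Rightarrow> nat \<Rightarrow> window \<Rightarrow> bool" where
  "child_dies b n m T x w = (b \<or> dies n m T (C x (child m x w)))"

definition children_die :: "nat \<Rightarrow> cfg \<Rightarrow> known \<Rightarrow> window \<Rightarrow> window \<Rightarrow> bool" where
  "children_die n m T w xs = all_window (\<lambda>x. pruned_tbl m T x w \<or> dies n m T (C x (child m x w))) xs"

lemma dies_rules:
  "dies (Suc n) m T w = children_die n m T w (unmarked (scan m 0 w (initial m)))"
  "children_die n m T w E = True"
  "children_die n m T w (C x xs) = (child_dies (pruned_tbl m T x w) n m T x w \<and> children_die n m T w xs)"
  "child_dies True n m T x w = True"
  "child_dies False n m T x w = dies n m T (C x (child m x w))"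
  "or_pruned True m A B p w = True"
  "or_pruned False m A B p w = pruned m A B p w"
  by (simp_all add: children_die_def child_dies_def or_pruned_def)

definition all_range :: "nat \<Rightarrow> nat \<Rightarrow> (nat \<Rightarrow> bool) \<Rightarrow> bool" where
  "all_range a n P = (\<forall>x. a \<le> x \<and> x < a + n \<longrightarrow> P x)"

lemma all_range_I: "(\<And>x. P x) \<Longrightarrow> all_range a n P"
  by (simp add: all_range_def)

lemma all_range_split: "all_range a (m + n) P = (all_range a m P \<and> all_range (a + m) n P)"
proof -
  have "a \<le> x \<and> x < a + (m + n) \<longleftrightarrow> a \<le> x \<and> x < a + m \<or> a + m \<le> x \<and> x < a + m + n" for x
    by linarith
  then show ?thesis
    unfolding all_range_def by blast
qed

text \<open>Splitting along the binary digits of the bound yields conjunctions of logarithmic depth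
  instead of one long chain.\<close>

lemma all_range_numeral:
  "all_range a (numeral Num.One) P = P a"
  "all_range a (numeral (Num.Bit0 n)) P = (all_range a (numeral n) P \<and> all_range (a + numeral n) (numeral n) P)"
  "all_range a (numeral (Num.Bit1 n)) P =
    (all_range a (numeral (Num.Bit0 n)) P \<and> P (a + numeral (Num.Bit0 n)))"
  "all_range a (Suc 0) P = P a"
proof -
  show one: "all_range a (numeral Num.One) P = P a" "all_range a (Suc 0) P = P a" for a
    by (auto simp: all_range_def le_less_Suc_eq)
  show "all_range a (numeral (Num.Bit0 n)) P = (all_range a (numeral n) P \<and> all_range (a + numeral n) (numeral n) P)"
    unfolding numeral_Bit0 by (rule all_range_split)
  have "numeral (Num.Bit1 n) = (numeral (Num.Bit0 n) + numeral Num.One :: nat)"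
    by simp
  then show "all_range a (numeral (Num.Bit1 n)) P =
      (all_range a (numeral (Num.Bit0 n)) P \<and> P (a + numeral (Num.Bit0 n)))"
    by (simp only: all_range_split one)
qed

text \<open>Euclid's algorithm with a step bound; exhausting it gives 0, which is never mistaken for
  coprimality.\<close>

primrec gcd_steps :: "nat \<Rightarrow> nat \<Rightarrow> nat \<Rightarrow> nat" where
  "gcd_steps 0 a b = 0"
| "gcd_steps (Suc n) a b = (if b = 0 then a else gcd_steps n b (a mod b))"

lemma gcd_steps_numeral [simp]:
  "gcd_steps (numeral n) a b = (if b = 0 then a else gcd_steps (pred_numeral n) b (a mod b))"
  by (simp add: numeral_eq_Suc)

text \<open>12 rounds suffice below 64: the slowest case, the Fibonacci numbers 34 and 55, takes
  10.\<close>

definition unit_mod :: "nat \<Rightarrow> nat \<Rightarrow> bool" where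
  "unit_mod u h \<longleftrightarrow> gcd_steps 12 u h = 1"

lemma unit_mod_coprime: "unit_mod u h \<Longrightarrow> coprime u h"
proof -
  have "gcd_steps n a b = 1 \<Longrightarrow> coprime a b" for n a b
  proof (induction n arbitrary: a b)
    case (Suc n)
    then show ?case
      by (cases "b = 0") (auto simp: coprime_iff_gcd_eq_1 gcd_red_nat[of a b] gcd.commute)
  qed simp
  then show "unit_mod u h \<Longrightarrow> coprime u h"
    unfolding unit_mod_def by blast
qed

lemma unit_mod_1 [simp]: "unit_mod (Suc 0) h"
  by (cases "h = 0"; cases "h = 1") (simp_all add: unit_mod_def)

text \<open>Nonzero multiples of \<open>g\<close> are forbidden to have entry 0. The lookup table
  therefore also witnesses the hypothesis \<open>units\<close> of
  \<open>inevitable_step\<close>.\<close>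

definition valid_entry :: "nat \<Rightarrow> nat \<Rightarrow> nat \<Rightarrow> nat \<Rightarrow> bool" where
  "valid_entry h g v u =
    (if u = 0 then v = 0 \<or> v mod g \<noteq> 0
     else if u < 64 then unit_mod u h \<and> u * v mod h = 1 mod h
     else u \<noteq> 64 \<and> unit_mod (u - 64) h \<and> (u - 64) * v mod h = g mod h)"

definition valid :: "cfg \<Rightarrow> nat \<Rightarrow> bool" where
  "valid m g \<longleftrightarrow> 0 < modulus m \<and> modulus m < 64 \<and> length (ratios m) = modulus m \<and> g dvd modulus m \<and>
     all_range 0 (modulus m) (\<lambda>x. x = 0 \<or> \<not> marked x (initial m)) \<and>
     all_range 0 (modulus m) (\<lambda>v. valid_entry (modulus m) g v (ratios m ! v))"

section \<open>Soundness of the search\<close>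

lemma int_msub: "0 < modulus m \<Longrightarrow> [int (msub m a b) = int a - int b] (mod int (modulus m))"
  by (simp add: msub_def)

lemma int_madd: "0 < modulus m \<Longrightarrow> [int (madd m a b) = int a + int b] (mod int (modulus m))"
proof -
  assume m: "0 < modulus m"
  have "[int (madd m a b) = int a - int (msub m 0 b)] (mod int (modulus m))"
    unfolding madd_def using int_msub[OF m] .
  also have "[int a - int (msub m 0 b) = int a - (int 0 - int b)] (mod int (modulus m))"
    by (intro cong_diff cong_refl int_msub m)
  finally show ?thesis by simp
qed

text \<open>While the scan proceeds, \<open>x - s\<close> is the current value of the expansion from
  \<open>x\<close>, so the next entry vanishes when \<open>x\<close> equals the next offset.\<close>

lemma marked_scan:
  assumes "0 < modulus m" "marked x (scan m s w B)" "[y = int x - int s] (mod int (modulus m))"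
  shows "marked x B \<or> (\<exists>v\<in>set (tl (expand y (ints w))). int (modulus m) dvd v)"
  using assms(2-)
proof (induction w arbitrary: s B y)
  case (C d w)
  let ?h = "int (modulus m)"
  define s1 where "s1 = msub m s d"
  define s2 where "s2 = msub m s1 d"
  define s3 where "s3 = msub m s2 d"
  have sub: "[y' + int d = int x - int (msub m t d)] (mod ?h)"
    if "[y' = int x - int t] (mod ?h)" for y' t
  proof -
    have "[int x - int (msub m t d) = int x - (int t - int d)] (mod ?h)"
      by (intro cong_diff cong_refl int_msub assms(1))
    moreover have "[y' + int d = int x - int t + int d] (mod ?h)"
      using that by (intro cong_add cong_refl)
    ultimately show ?thesis
      by (simp add: cong_def algebra_simps)
  qed
  have y1: "[y + int d = int x - int s1] (mod ?h)"
    using sub[OF C.prems(2)] by (simp add: s1_def)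
  have y2: "[y + 2 * int d = int x - int s2] (mod ?h)"
    using sub[OF y1] by (simp add: s2_def algebra_simps)
  have y3: "[y + 3 * int d = int x - int s3] (mod ?h)"
    using sub[OF y2] by (simp add: s3_def algebra_simps)
  have hit: "?h dvd z" if "[z = int x - int t] (mod ?h)" "x = t" for z t
    using that by (simp add: cong_0_iff)
  have "expand z u = z # tl (expand z u)" for z u
    by (cases u) auto
  moreover have "marked x (scan m s3 w (mark s3 (mark s2 (mark s1 B))))"
    using C.prems(1) by (simp add: s1_def s2_def s3_def)
  note C.IH[OF this y3]
  ultimately show ?case
    using hit[OF y1] hit[OF y2] hit[OF y3]
    by (metis (no_types, opaque_lifting) expand.simps(2) marked_mark ints.simps(2) list.sel(3)
        list.set_intros(1) list.set_intros(2))
qed simp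

lemma congs_child:
  assumes "0 < modulus m"
  shows "[y = int p] (mod int (modulus m)) \<Longrightarrow>
    congs (int (modulus m)) (expand y (ints w)) (ints (C p (child m p w)))"
proof (induction w arbitrary: p y)
  case (C v w)
  define p1 where "p1 = madd m p v"
  define p2 where "p2 = madd m p1 v"
  define p3 where "p3 = madd m p2 v"
  have add: "[z + int v = int (madd m t v)] (mod int (modulus m))"
    if "[z = int t] (mod int (modulus m))" for z t
    using cong_add[OF that cong_refl] int_madd[OF assms] by (metis cong_sym cong_trans)
  have "[y + int v = int p1] (mod int (modulus m))"
    using add[OF C.prems] by (simp add: p1_def)
  moreover from add[OF this] have "[y + 2 * int v = int p2] (mod int (modulus m))"
    by (simp add: p2_def algebra_simps)
  moreover from add[OF this] have "[y + 3 * int v = int p3] (mod int (modulus m))"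
    by (simp add: p3_def algebra_simps)
  moreover note C.IH[OF this]
  ultimately show ?case
    using C.prems by (simp add: p1_def p2_def p3_def)
qed simp

definition sound :: "cfg \<Rightarrow> nat \<Rightarrow> board \<Rightarrow> board \<Rightarrow> bool" where
  "sound m g A B \<longleftrightarrow> (\<forall>x. (marked x A \<longrightarrow> dead (int (modulus m)) (ap (int x) 1)) \<and>
     (marked x B \<longrightarrow> dead (int (modulus m)) (ap (int x) (int g))))"

lemma valid_rat:
  assumes "valid m g" "v < modulus m" 
  shows "ratios m ! v = 0 \<and> (v = 0 \<or> \<not> g dvd v) \<or>
     ratios m ! v \<noteq> 0 \<and> ratios m ! v < 64 \<and> coprime (ratios m ! v) (modulus m) \<and> ratios m ! v * v mod modulus m = 1 mod modulus m \<or>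
     ratios m ! v > 64 \<and> coprime (ratios m ! v - 64) (modulus m) \<and> (ratios m ! v - 64) * v mod modulus m = g mod modulus m"
  using assms unfolding valid_def valid_entry_def all_range_def
  by (auto split: if_splits simp: unit_mod_coprime mod_eq_0_iff_dvd)

text \<open>A lookup read backwards: the inverse of \<open>u\<close> returns from the stored
  progression to \<open>ap p v\<close>.\<close>

lemma dead_ap_unit:
  assumes "dead h (ap (p * u) c)" "coprime u h" "[u * v = c] (mod h)"
  shows "dead h (ap p v)"
proof -
  obtain u' where u': "[u * u' = 1] (mod h)"
    using cong_solve_coprime_int[OF assms(2)] by blast
  then have "coprime u' h"
    by (metis coprime_iff_invertible_int mult.commute)
  then have "dead h (ap (u' * (p * u)) (u' * c))"
    using dead_ap_scale assms(1) by blast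
  moreover have "[u' * (p * u) = p] (mod h)"
    using cong_scalar_right[OF u', of p] by (simp add: mult_ac)
  moreover have "[u' * c = v] (mod h)"
  proof -
    have "[u' * c = u' * (u * v)] (mod h)"
      using assms(3) by (intro cong_mult cong_refl) (simp add: cong_sym)
    also have "[u' * (u * v) = v] (mod h)"
      using cong_scalar_right[OF u', of v] by (simp add: mult_ac)
    finally show ?thesis .
  qed
  ultimately show ?thesis
    by (metis congs_ap dead_cong)
qed

lemma cong_int_mod: "a mod h = b mod h \<Longrightarrow> [int a = int b] (mod int h)"
  by (metis cong_def cong_int_iff)

lemma hit_known_dead:
  assumes "valid m g" "sound m g A B" "hit_known m v p A B"
  shows "dead (int (modulus m)) (ap (int p) (int v))"
proof -
  let ?h = "int (modulus m)" and ?u = "ratios m ! v"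
  have v: "v < modulus m" and u: "?u \<noteq> 0"
    using assms by (auto simp: hit_known_def valid_def Let_def split: if_splits)
  have mmul: "[int p * int c = int (mmul m p c)] (mod ?h)" for c
      by (metis cong_int_iff cong_mod_right cong_refl mmul_def of_nat_mult)
    show ?thesis
    proof (cases "?u < 64")
      case True
      then have "coprime ?u (modulus m)" "[int ?u * int v = 1] (mod ?h)" and
        "dead ?h (ap (int (mmul m p ?u)) 1)"
        using valid_rat[OF assms(1) v] u assms(2,3) v cong_int_mod[of "?u * v" "modulus m" 1]
        by (auto simp: hit_known_def sound_def Let_def split: if_splits)
      moreover from this(3) have "dead ?h (ap (int p * int ?u) 1)"
        by (rule dead_cong) (intro congs_ap cong_sym[OF mmul] cong_refl)
      ultimately show ?thesis
        by (intro dead_ap_unit[of ?h "int p" "int ?u" 1]) auto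
    next
      case False
      then have "coprime (?u - 64) (modulus m)" "[int (?u - 64) * int v = int g] (mod ?h)" and
        "dead ?h (ap (int (mmul m p (?u - 64))) (int g))"
        using valid_rat[OF assms(1) v] u assms(2,3) v cong_int_mod[of "(?u - 64) * v" "modulus m" g]
        by (auto simp: hit_known_def sound_def Let_def split: if_splits)
      moreover from this(3) have "dead ?h (ap (int p * int (?u - 64)) (int g))"
        by (rule dead_cong) (intro congs_ap cong_sym[OF mmul] cong_refl)
      ultimately show ?thesis
        by (intro dead_ap_unit[of ?h "int p" "int (?u - 64)" "int g"]) auto
    qed
qed

lemma pruned_dead:
  assumes "valid m g" "sound m g A B"
  shows "pruned m A B p w \<Longrightarrow> [y = int p] (mod int (modulus m)) \<Longrightarrow> dead (int (modulus m)) (expand y (ints w))"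
proof (induction w arbitrary: p y)
  case (C v w)
  have pos: "0 < modulus m"
    using assms by (simp add: valid_def)
  \<comment> \<open>Two overlapping views, because \<open>y + 3 * int v\<close> both closes the
    first progression and opens the rest: a dead progression is a prefix, a dead remainder a
    suffix.\<close>
  have split: "expand y (ints (C v w)) = ap y (int v) @ tl (expand (y + 3 * int v) (ints w))"
      "expand y (ints (C v w)) = [y, y + int v, y + 2 * int v] @ expand (y + 3 * int v) (ints w)"
    by (cases w; simp add: ap_def)+
  from C.prems(1) consider "hit_known m v p A B" | "pruned m A B (madd m (madd m (madd m p v) v) v) w"
    by auto
  then show ?case
  proof cases
    case 1
    then have "dead (int (modulus m)) (ap (int p) (int v))"
      using hit_known_dead assms by blast
    then have "dead (int (modulus m)) (ap y (int v))"
      by (rule dead_cong) (intro congs_ap cong_sym[OF C.prems(2)] cong_refl)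
    then show ?thesis
      unfolding split(1) by (rule dead_append_right)
  next
    case 2
    have add: "[z + int v = int (madd m t v)] (mod int (modulus m))"
      if "[z = int t] (mod int (modulus m))" for z t
      using cong_add[OF that cong_refl] int_madd[OF pos] by (metis cong_sym cong_trans)
    have "[y + int v + int v + int v = int (madd m (madd m (madd m p v) v) v)] (mod int (modulus m))"
      using C.prems(2) by (intro add)
    then have "dead (int (modulus m)) (expand (y + 3 * int v) (ints w))"
      by (intro C.IH[OF 2]) (simp add: algebra_simps)
    then show ?thesis
      unfolding split(2) by (rule dead_append_left)
  qed
qed simp

lemma congs_sym: "congs h w w' \<Longrightarrow> congs h w' w"
  by (simp add: list_all2_conv_all_nth cong_sym_eq)

primrec sound_known :: "cfg \<Rightarrow> nat \<Rightarrow> known \<Rightarrow> bool" where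
  "sound_known m g NT = True"
| "sound_known m g (TT A B) = sound m g A B"

text \<open>Each residue is accounted for: if marked, some entry vanishes; if not, it is listed by
  \<open>unmarked\<close> and was either pruned or searched.\<close>

lemma dies_dead:
  assumes "valid m g" "sound_known m g T"
  shows "dies n m T w \<Longrightarrow> dead (int (modulus m)) (ints w)"
proof (induction n arbitrary: w)
  case (Suc n)
  let ?h = "int (modulus m)"
  have m: "0 < modulus m" "modulus m < 64" "\<And>x. 1 \<le> x \<Longrightarrow> x < modulus m \<Longrightarrow> \<not> marked x (initial m)"
    using assms(1) by (auto simp: valid_def all_range_def)
  show ?case
  proof (rule dead.branch)
    fix y :: int
    define x where "x = nat (y mod ?h)"
    have "int x = y mod ?h"
      using m by (simp add: x_def)
    moreover from this have "int x < ?h"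
      using m(1) by simp
    ultimately have x: "[y = int x] (mod ?h)" "x < modulus m"
      by (simp_all add: cong_def)
    show "dead ?h (expand y (ints w))"
    proof (cases "marked x (scan m 0 w (initial m))")
      case True
      have "expand y (ints w) = y # tl (expand y (ints w))"
        by (cases w) auto
      \<comment> \<open>Below the modulus, only 0 may be marked from the beginning, and it makes the
        first entry vanish.\<close>
      moreover have "marked x (initial m) \<Longrightarrow> ?h dvd y"
        using m(3)[of x] x by (cases "x = 0") (auto simp: cong_0_iff)
      moreover have "marked x (initial m) \<or> (\<exists>v\<in>set (tl (expand y (ints w))). ?h dvd v)"
        using marked_scan[OF m(1) True] x(1) by simp
      ultimately show ?thesis
        by (metis dead.hit list.set_intros)
    next
      case False
      then have "x \<in> elems (unmarked (scan m 0 w (initial m)))"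
        using elems_unmarked x m by simp
      then consider "pruned_tbl m T x w" | "dies n m T (C x (child m x w))"
        using Suc.prems by (auto simp: all_window_iff)
      then show ?thesis
      proof cases
        case 1
        then show ?thesis
          using assms pruned_dead x(1) by (cases T) auto
      next
        case 2
        then have "dead ?h (ints (C x (child m x w)))"
          by (rule Suc.IH)
        then show ?thesis
          using congs_sym[OF congs_child[OF m(1) x(1)]] by (rule dead_cong)
      qed
    qed
  qed
qed simp

text \<open>The nested \<open>msub\<close> is \<open>- r - 3 * c\<close>, the start of the reflected
  progression.\<close>

primrec mark_orbit :: "cfg \<Rightarrow> nat \<Rightarrow> nat \<Rightarrow> window \<Rightarrow> board \<Rightarrow> board" where
  "mark_orbit m c r E B = B"
| "mark_orbit m c r (C u us) B = mark_orbit m c r us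
     (mark (mmul m (msub m (msub m (msub m (msub m 0 r) c) c) c) u) (mark (mmul m r u) B))"

text \<open>
  \<open>F1 r\<close> and \<open>P1 r\<close> prove \<open>ap r 1\<close> dead, \<open>FG r\<close> and \<open>PG r\<close> prove \<open>ap r g\<close> dead; only the \<open>P\<close> variants consult
  what is known so far.
\<close>

datatype phases = PE | F1 nat phases | FG nat phases | P1 nat phases | PG nat phases

definition ap_window :: "cfg \<Rightarrow> nat \<Rightarrow> nat \<Rightarrow> window" where
  "ap_window m r c = C r (child m r (C c E))"

primrec phases_die :: "cfg \<Rightarrow> nat \<Rightarrow> window \<Rightarrow> phases \<Rightarrow> nat \<Rightarrow> board \<Rightarrow> board \<Rightarrow> bool" where
  "phases_die m g us PE n A B = dies n m (TT A B) (C g E)"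
| "phases_die m g us (F1 r ps) n A B =
    (dies n m NT (ap_window m r 1) \<and> phases_die m g us ps n (mark_orbit m 1 r (C 1 E) A) B)"
| "phases_die m g us (FG r ps) n A B =
    (dies n m NT (ap_window m r g) \<and> phases_die m g us ps n A (mark_orbit m g r us B))"
| "phases_die m g us (P1 r ps) n A B =
    (dies n m (TT A B) (ap_window m r 1) \<and> phases_die m g us ps n (mark_orbit m 1 r (C 1 E) A) B)"
| "phases_die m g us (PG r ps) n A B =
    (dies n m (TT A B) (ap_window m r g) \<and> phases_die m g us ps n A (mark_orbit m g r us B))"

text \<open>Units fixing \<open>c\<close> move the start of a progression without changing its
  difference, so the whole orbit is recorded on one board.\<close>

definition stab :: "cfg \<Rightarrow> nat \<Rightarrow> window \<Rightarrow> bool" where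
  "stab m c us \<longleftrightarrow> all_window (\<lambda>u. unit_mod u (modulus m) \<and> u * c mod modulus m = c mod modulus m) us"

lemma dead_mark_orbit:
  assumes "0 < modulus m" "dead (int (modulus m)) (ap (int r) (int c))" "stab m c us" "marked x (mark_orbit m c r us B)"
  shows "marked x B \<or> dead (int (modulus m)) (ap (int x) (int c))"
  using assms(3,4)
proof (induction us arbitrary: B)
  case (C u us)
  let ?h = "int (modulus m)"
  define r' where "r' = msub m (msub m (msub m (msub m 0 r) c) c) c"
  have "[int r' = int 0 - int r - int c - int c - int c] (mod ?h)"
  proof -
    have *: "[int (msub m t c) = z - int c] (mod ?h)" if "[int t = z] (mod ?h)" for t z
      using cong_diff[OF that cong_refl] int_msub[OF assms(1)] by (metis cong_trans)
    show ?thesis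
      unfolding r'_def by (intro * int_msub assms(1))
  qed
  then have r': "[int r' = - int r - 3 * int c] (mod ?h)"
    by (simp add: algebra_simps)
  have "dead ?h (ap (- int r - 3 * int c) (int c))"
    using assms(2) by (rule dead_ap_reflect)
  then have dead_r': "dead ?h (ap (int r') (int c))"
    by (rule dead_cong) (intro congs_ap cong_sym[OF r'] cong_refl)
  have unit: "coprime (int u) ?h" and "u * c mod modulus m = c mod modulus m"
    using C.prems(1) by (auto simp: stab_def unit_mod_coprime)
  then have uc: "[int u * int c = int c] (mod ?h)"
    by (metis cong_def cong_int_iff of_nat_mult)
  have orb: "dead ?h (ap (int (mmul m s u)) (int c))" if "dead ?h (ap (int s) (int c))" for s
  proof -
    have "dead ?h (ap (int u * int s) (int u * int c))"
      using that unit by (rule dead_ap_scale)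
    moreover have "[int u * int s = int (mmul m s u)] (mod ?h)"
      by (metis cong_int_iff cong_mod_right cong_refl mmul_def mult.commute of_nat_mult)
    ultimately show ?thesis
      using uc by (metis congs_ap dead_cong)
  qed
  have "marked x (mark (mmul m r' u) (mark (mmul m r u) B)) \<or> dead ?h (ap (int x) (int c))"
    using C by (simp add: stab_def r'_def)
  then show ?case
    using orb[OF dead_r'] orb[OF assms(2)] by (auto simp: marked_mark)
qed simp

lemma dies_ap_dead:
  assumes "valid m g" "sound_known m g T" "dies n m T (ap_window m r c)"
  shows "dead (int (modulus m)) (ap (int r) (int c))"
proof -
  have "congs (int (modulus m)) (expand (int r) (ints (C c E))) (ints (ap_window m r c))"
    unfolding ap_window_def by (rule congs_child) (use assms(1) in \<open>auto simp: valid_def\<close>)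
  then have "congs (int (modulus m)) (ints (ap_window m r c)) (ap (int r) (int c))"
    by (simp add: ap_def list_all2_conv_all_nth cong_sym_eq)
  then show ?thesis
    using dies_dead[OF assms] dead_cong by blast
qed

text \<open>Soundness of both boards is the invariant: each phase adds the orbit of one more dead
  progression, and the concluding search for \<open>[g]\<close> may use them all.\<close>

lemma phases_dead:
  assumes valid: "valid m g" and us: "stab m g us"
  shows "phases_die m g us ps n A B \<Longrightarrow> sound m g A B \<Longrightarrow> dead (int (modulus m)) [int g]"
proof (induction ps arbitrary: A B)
  case PE
  then show ?case
    using dies_dead[OF valid, of "TT A B" n "C g E"] by simp
next
  case (F1 r ps)
  \<comment> \<open>For difference 1 the only unit used is 1, so the orbit consists of
    \<open>r\<close> and its reflection.\<close>
  have "sound m g (mark_orbit m 1 r (C 1 E) A) B"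
    using F1.prems dead_mark_orbit[of m r 1 "C 1 E" _ A] dies_ap_dead[OF valid, of NT n r 1] valid
    by (auto simp: sound_def valid_def stab_def)
  then show ?case
    using F1.prems(1) by (intro F1.IH) simp_all
next
  case (FG r ps)
  have "sound m g A (mark_orbit m g r us B)"
    using FG.prems dead_mark_orbit[of m r g us _ B] dies_ap_dead[OF valid, of NT n r g] valid us
    by (auto simp: sound_def valid_def)
  then show ?case
    using FG.prems(1) by (intro FG.IH) simp_all
next
  case (P1 r ps)
  have "sound m g (mark_orbit m 1 r (C 1 E) A) B"
    using P1.prems dead_mark_orbit[of m r 1 "C 1 E" _ A] dies_ap_dead[OF valid, of "TT A B" n r 1] valid
    by (auto simp: sound_def valid_def stab_def)
  then show ?case
    using P1.prems(1) by (intro P1.IH) simp_all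
next
  case (PG r ps)
  have "sound m g A (mark_orbit m g r us B)"
    using PG.prems dead_mark_orbit[of m r g us _ B] dies_ap_dead[OF valid, of "TT A B" n r g] valid us
    by (auto simp: sound_def valid_def)
  then show ?case
    using PG.prems(1) by (intro PG.IH) simp_all
qed

lemma sound_empty: "sound m g (N 0 0 0 0 0 0 0 0) (N 0 0 0 0 0 0 0 0)"
  by (simp add: sound_def test_bit_def Let_def)

lemma inevitable_phases:
  assumes "valid m g" "stab m g us" "inevitable (int g)"
    and "phases_die m g us ps n (N 0 0 0 0 0 0 0 0) (N 0 0 0 0 0 0 0 0)"
  shows "inevitable (int (modulus m))"
proof (rule inevitable_step)
  show "dead (int (modulus m)) [int g]"
    using assms sound_empty by (intro phases_dead)
  show "int g dvd int (modulus m)" "int (modulus m) > 0"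
    using assms(1) by (auto simp: valid_def)
  fix v' :: int assume v': "int g dvd v'" "0 < v'" "v' < int (modulus m)"
  define v where "v = nat v'"
  have v: "v' = int v" "g dvd v" "0 < v" "v < modulus m"
    using v' by (auto simp: v_def nat_dvd_iff) (metis int_dvd_int_iff int_nat_eq less_le)
  show "\<exists>u. coprime u (int (modulus m)) \<and> [u * v' = int g] (mod int (modulus m))"
    using valid_rat[OF assms(1) v(4)] v(2,3)
  proof (elim disjE conjE)
    assume *: "ratios m ! v * v mod modulus m = 1 mod modulus m" "coprime (ratios m ! v) (modulus m)"
    \<comment> \<open>An entry of this kind inverts \<open>v\<close>. As \<open>g\<close> divides
      \<open>v\<close> and the modulus, it divides 1, so the inverse does carry \<open>v\<close> to
      \<open>g\<close>.\<close>
    have "g dvd modulus m"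
      using assms(1) by (simp add: valid_def)
    then have "g dvd 1"
      using *(1) v(2) by (metis dvd_mod_iff dvd_mult)
    then show ?thesis
      using * v(1) cong_int_mod[OF *(1)] by (intro exI[of _ "int (ratios m ! v)"]) auto
  next
    assume *: "(ratios m ! v - 64) * v mod modulus m = g mod modulus m" "coprime (ratios m ! v - 64) (modulus m)"
    then show ?thesis
      using v(1) cong_int_mod[OF *(1)] by (intro exI[of _ "int (ratios m ! v - 64)"]) auto
  qed auto
qed (rule assms)

section \<open>Rewrite rules for evaluation by the simplifier\<close>

text \<open>
  The searches take tens of millions of rewrite steps, which are considerably cheaper on atomic constants
  than on binary numerals.
\<close>

definition k0 :: nat where "k0 = 0"
definition k1 :: nat where "k1 = 1"
definition k2 :: nat where "k2 = 2"
definition k3 :: nat where "k3 = 3"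
definition k4 :: nat where "k4 = 4"
definition k5 :: nat where "k5 = 5"
definition k6 :: nat where "k6 = 6"
definition k7 :: nat where "k7 = 7"
definition k8 :: nat where "k8 = 8"
definition k9 :: nat where "k9 = 9"
definition k10 :: nat where "k10 = 10"
definition k11 :: nat where "k11 = 11"
definition k12 :: nat where "k12 = 12"
definition k13 :: nat where "k13 = 13"
definition k14 :: nat where "k14 = 14"
definition k15 :: nat where "k15 = 15"
definition k16 :: nat where "k16 = 16"
definition k17 :: nat where "k17 = 17"
definition k18 :: nat where "k18 = 18"
definition k19 :: nat where "k19 = 19"
definition k20 :: nat where "k20 = 20"
definition k21 :: nat where "k21 = 21"
definition k22 :: nat where "k22 = 22"
definition k23 :: nat where "k23 = 23"
definition k24 :: nat where "k24 = 24"
definition k25 :: nat where "k25 = 25"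
definition k26 :: nat where "k26 = 26"
definition k27 :: nat where "k27 = 27"
definition k28 :: nat where "k28 = 28"
definition k29 :: nat where "k29 = 29"
definition k30 :: nat where "k30 = 30"
definition k31 :: nat where "k31 = 31"
definition k32 :: nat where "k32 = 32"
definition k33 :: nat where "k33 = 33"
definition k34 :: nat where "k34 = 34"
definition k35 :: nat where "k35 = 35"
definition k36 :: nat where "k36 = 36"
definition k37 :: nat where "k37 = 37"
definition k38 :: nat where "k38 = 38"
definition k39 :: nat where "k39 = 39"
definition k40 :: nat where "k40 = 40"
definition k41 :: nat where "k41 = 41"
definition k42 :: nat where "k42 = 42"
definition k43 :: nat where "k43 = 43"
definition k44 :: nat where "k44 = 44"
definition k45 :: nat where "k45 = 45"
definition k46 :: nat where "k46 = 46"
definition k47 :: nat where "k47 = 47"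
definition k48 :: nat where "k48 = 48"
definition k49 :: nat where "k49 = 49"
definition k50 :: nat where "k50 = 50"
definition k51 :: nat where "k51 = 51"
definition k52 :: nat where "k52 = 52"
definition k53 :: nat where "k53 = 53"
definition k54 :: nat where "k54 = 54"
definition k55 :: nat where "k55 = 55"
definition k56 :: nat where "k56 = 56"
definition k57 :: nat where "k57 = 57"
definition k58 :: nat where "k58 = 58"
definition k59 :: nat where "k59 = 59"
definition k60 :: nat where "k60 = 60"
definition k61 :: nat where "k61 = 61"
definition k62 :: nat where "k62 = 62"
definition k63 :: nat where "k63 = 63"
definition k64 :: nat where "k64 = 64"
definition k65 :: nat where "k65 = 65"
definition k66 :: nat where "k66 = 66"
definition k67 :: nat where "k67 = 67"
definition k68 :: nat where "k68 = 68"
definition k69 :: nat where "k69 = 69"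
definition k70 :: nat where "k70 = 70"
definition k71 :: nat where "k71 = 71"
definition k72 :: nat where "k72 = 72"
definition k73 :: nat where "k73 = 73"
definition k74 :: nat where "k74 = 74"
definition k75 :: nat where "k75 = 75"
definition k76 :: nat where "k76 = 76"
definition k77 :: nat where "k77 = 77"
definition k78 :: nat where "k78 = 78"
definition k79 :: nat where "k79 = 79"
definition k80 :: nat where "k80 = 80"
definition k81 :: nat where "k81 = 81"
definition k82 :: nat where "k82 = 82"
definition k83 :: nat where "k83 = 83"
definition k84 :: nat where "k84 = 84"
definition k85 :: nat where "k85 = 85"
definition k86 :: nat where "k86 = 86"
definition k87 :: nat where "k87 = 87"
definition k88 :: nat where "k88 = 88"
definition k89 :: nat where "k89 = 89"
definition k90 :: nat where "k90 = 90"
definition k91 :: nat where "k91 = 91"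
definition k92 :: nat where "k92 = 92"
definition k93 :: nat where "k93 = 93"
definition k94 :: nat where "k94 = 94"
definition k95 :: nat where "k95 = 95"
definition k96 :: nat where "k96 = 96"
definition k97 :: nat where "k97 = 97"
definition k98 :: nat where "k98 = 98"
definition k99 :: nat where "k99 = 99"
definition k100 :: nat where "k100 = 100"
definition k101 :: nat where "k101 = 101"
definition k102 :: nat where "k102 = 102"
definition k103 :: nat where "k103 = 103"
definition k104 :: nat where "k104 = 104"
definition k105 :: nat where "k105 = 105"
definition k106 :: nat where "k106 = 106"
definition k107 :: nat where "k107 = 107"
definition k108 :: nat where "k108 = 108"
definition k109 :: nat where "k109 = 109"
definition k110 :: nat where "k110 = 110"
definition k111 :: nat where "k111 = 111"
definition k112 :: nat where "k112 = 112"
definition k113 :: nat where "k113 = 113"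
definition k114 :: nat where "k114 = 114"
definition k115 :: nat where "k115 = 115"
definition k116 :: nat where "k116 = 116"
definition k117 :: nat where "k117 = 117"
definition k118 :: nat where "k118 = 118"
definition k119 :: nat where "k119 = 119"
definition k120 :: nat where "k120 = 120"
definition k121 :: nat where "k121 = 121"
definition k122 :: nat where "k122 = 122"
definition k123 :: nat where "k123 = 123"
definition k124 :: nat where "k124 = 124"
definition k125 :: nat where "k125 = 125"
definition k126 :: nat where "k126 = 126"
definition k127 :: nat where "k127 = 127"
definition k128 :: nat where "k128 = 128"
definition k129 :: nat where "k129 = 129"
definition k130 :: nat where "k130 = 130"
definition k131 :: nat where "k131 = 131"
definition k132 :: nat where "k132 = 132"
definition k133 :: nat where "k133 = 133"
definition k134 :: nat where "k134 = 134"
definition k135 :: nat where "k135 = 135"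
definition k136 :: nat where "k136 = 136"
definition k137 :: nat where "k137 = 137"
definition k138 :: nat where "k138 = 138"
definition k139 :: nat where "k139 = 139"
definition k140 :: nat where "k140 = 140"
definition k141 :: nat where "k141 = 141"
definition k142 :: nat where "k142 = 142"
definition k143 :: nat where "k143 = 143"
definition k144 :: nat where "k144 = 144"
definition k145 :: nat where "k145 = 145"
definition k146 :: nat where "k146 = 146"
definition k147 :: nat where "k147 = 147"
definition k148 :: nat where "k148 = 148"
definition k149 :: nat where "k149 = 149"
definition k150 :: nat where "k150 = 150"
definition k151 :: nat where "k151 = 151"
definition k152 :: nat where "k152 = 152"
definition k153 :: nat where "k153 = 153"
definition k154 :: nat where "k154 = 154"
definition k155 :: nat where "k155 = 155"
definition k156 :: nat where "k156 = 156"
definition k157 :: nat where "k157 = 157"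
definition k158 :: nat where "k158 = 158"
definition k159 :: nat where "k159 = 159"
definition k160 :: nat where "k160 = 160"
definition k161 :: nat where "k161 = 161"
definition k162 :: nat where "k162 = 162"
definition k163 :: nat where "k163 = 163"
definition k164 :: nat where "k164 = 164"
definition k165 :: nat where "k165 = 165"
definition k166 :: nat where "k166 = 166"
definition k167 :: nat where "k167 = 167"
definition k168 :: nat where "k168 = 168"
definition k169 :: nat where "k169 = 169"
definition k170 :: nat where "k170 = 170"
definition k171 :: nat where "k171 = 171"
definition k172 :: nat where "k172 = 172"
definition k173 :: nat where "k173 = 173"
definition k174 :: nat where "k174 = 174"
definition k175 :: nat where "k175 = 175"
definition k176 :: nat where "k176 = 176"
definition k177 :: nat where "k177 = 177"
definition k178 :: nat where "k178 = 178"
definition k179 :: nat where "k179 = 179"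
definition k180 :: nat where "k180 = 180"
definition k181 :: nat where "k181 = 181"
definition k182 :: nat where "k182 = 182"
definition k183 :: nat where "k183 = 183"
definition k184 :: nat where "k184 = 184"
definition k185 :: nat where "k185 = 185"
definition k186 :: nat where "k186 = 186"
definition k187 :: nat where "k187 = 187"
definition k188 :: nat where "k188 = 188"
definition k189 :: nat where "k189 = 189"
definition k190 :: nat where "k190 = 190"
definition k191 :: nat where "k191 = 191"
definition k192 :: nat where "k192 = 192"
definition k193 :: nat where "k193 = 193"
definition k194 :: nat where "k194 = 194"
definition k195 :: nat where "k195 = 195"
definition k196 :: nat where "k196 = 196"
definition k197 :: nat where "k197 = 197"
definition k198 :: nat where "k198 = 198"
definition k199 :: nat where "k199 = 199"
definition k200 :: nat where "k200 = 200"
definition k201 :: nat where "k201 = 201"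
definition k202 :: nat where "k202 = 202"
definition k203 :: nat where "k203 = 203"
definition k204 :: nat where "k204 = 204"
definition k205 :: nat where "k205 = 205"
definition k206 :: nat where "k206 = 206"
definition k207 :: nat where "k207 = 207"
definition k208 :: nat where "k208 = 208"
definition k209 :: nat where "k209 = 209"
definition k210 :: nat where "k210 = 210"
definition k211 :: nat where "k211 = 211"
definition k212 :: nat where "k212 = 212"
definition k213 :: nat where "k213 = 213"
definition k214 :: nat where "k214 = 214"
definition k215 :: nat where "k215 = 215"
definition k216 :: nat where "k216 = 216"
definition k217 :: nat where "k217 = 217"
definition k218 :: nat where "k218 = 218"
definition k219 :: nat where "k219 = 219"
definition k220 :: nat where "k220 = 220"
definition k221 :: nat where "k221 = 221"
definition k222 :: nat where "k222 = 222"
definition k223 :: nat where "k223 = 223"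
definition k224 :: nat where "k224 = 224"
definition k225 :: nat where "k225 = 225"
definition k226 :: nat where "k226 = 226"
definition k227 :: nat where "k227 = 227"
definition k228 :: nat where "k228 = 228"
definition k229 :: nat where "k229 = 229"
definition k230 :: nat where "k230 = 230"
definition k231 :: nat where "k231 = 231"
definition k232 :: nat where "k232 = 232"
definition k233 :: nat where "k233 = 233"
definition k234 :: nat where "k234 = 234"
definition k235 :: nat where "k235 = 235"
definition k236 :: nat where "k236 = 236"
definition k237 :: nat where "k237 = 237"
definition k238 :: nat where "k238 = 238"
definition k239 :: nat where "k239 = 239"
definition k240 :: nat where "k240 = 240"
definition k241 :: nat where "k241 = 241"
definition k242 :: nat where "k242 = 242"
definition k243 :: nat where "k243 = 243"
definition k244 :: nat where "k244 = 244"
definition k245 :: nat where "k245 = 245"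
definition k246 :: nat where "k246 = 246"
definition k247 :: nat where "k247 = 247"
definition k248 :: nat where "k248 = 248"
definition k249 :: nat where "k249 = 249"
definition k250 :: nat where "k250 = 250"
definition k251 :: nat where "k251 = 251"
definition k252 :: nat where "k252 = 252"
definition k253 :: nat where "k253 = 253"
definition k254 :: nat where "k254 = 254"
definition k255 :: nat where "k255 = 255"

lemmas k_defs =
 k0_def k1_def k2_def k3_def k4_def k5_def k6_def k7_def k8_def k9_def k10_def k11_def k12_def
   k13_def k14_def k15_def k16_def k17_def k18_def k19_def k20_def k21_def k22_def k23_def k24_def
   k25_def k26_def k27_def k28_def k29_def k30_def k31_def k32_def k33_def k34_def k35_def k36_def
   k37_def k38_def k39_def k40_def k41_def k42_def k43_def k44_def k45_def k46_def k47_def k48_def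
   k49_def k50_def k51_def k52_def k53_def k54_def k55_def k56_def k57_def k58_def k59_def k60_def
   k61_def k62_def k63_def k64_def k65_def k66_def k67_def k68_def k69_def k70_def k71_def k72_def
   k73_def k74_def k75_def k76_def k77_def k78_def k79_def k80_def k81_def k82_def k83_def k84_def
   k85_def k86_def k87_def k88_def k89_def k90_def k91_def k92_def k93_def k94_def k95_def k96_def
   k97_def k98_def k99_def k100_def k101_def k102_def k103_def k104_def k105_def k106_def k107_def
   k108_def k109_def k110_def k111_def k112_def k113_def k114_def k115_def k116_def k117_def
   k118_def k119_def k120_def k121_def k122_def k123_def k124_def k125_def k126_def k127_def
   k128_def k129_def k130_def k131_def k132_def k133_def k134_def k135_def k136_def k137_def
   k138_def k139_def k140_def k141_def k142_def k143_def k144_def k145_def k146_def k147_def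
   k148_def k149_def k150_def k151_def k152_def k153_def k154_def k155_def k156_def k157_def
   k158_def k159_def k160_def k161_def k162_def k163_def k164_def k165_def k166_def k167_def
   k168_def k169_def k170_def k171_def k172_def k173_def k174_def k175_def k176_def k177_def
   k178_def k179_def k180_def k181_def k182_def k183_def k184_def k185_def k186_def k187_def
   k188_def k189_def k190_def k191_def k192_def k193_def k194_def k195_def k196_def k197_def
   k198_def k199_def k200_def k201_def k202_def k203_def k204_def k205_def k206_def k207_def
   k208_def k209_def k210_def k211_def k212_def k213_def k214_def k215_def k216_def k217_def
   k218_def k219_def k220_def k221_def k222_def k223_def k224_def k225_def k226_def k227_def
   k228_def k229_def k230_def k231_def k232_def k233_def k234_def k235_def k236_def k237_def
   k238_def k239_def k240_def k241_def k242_def k243_def k244_def k245_def k246_def k247_def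
   k248_def k249_def k250_def k251_def k252_def k253_def k254_def k255_def

lemma Suc_k: "Suc k0 = k1" "Suc k1 = k2" "Suc k2 = k3" "numeral Num.One = k1"
  by (simp_all add: k_defs)

lemmas k_folds = k_defs[symmetric] Suc_k

text \<open>
  Tables are obtained by unfolding a statement \<open>all_range 0 n (\<lambda>i. f i = f' i)\<close>: only the primed copy \<open>f'\<close> of
  a function has rewrite rules at that point, so that the left-hand sides stay as they are.
\<close>

definition all_range' :: "nat \<Rightarrow> nat \<Rightarrow> (nat \<Rightarrow> bool) \<Rightarrow> bool" where
  "all_range' = all_range"

lemmas all_range'_numeral = all_range_numeral[folded all_range'_def]

text \<open>8 bit positions and 256 bytes make \<open>2 ^ 11\<close> equations, hence eleven levels
  of conjunctions to take apart.\<close>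

lemma insert_bit_all:
  "all_range 0 8 (\<lambda>k. all_range 0 256 (\<lambda>b. insert_bit k b = (if odd (b div 2 ^ k) then b else b + 2 ^ k)))"
  by (intro all_range_I) (simp add: insert_bit_def)

lemma test_bit_all: "all_range 0 8 (\<lambda>k. all_range 0 256 (\<lambda>b. test_bit k b = odd (b div 2 ^ k)))"
  by (intro all_range_I) (simp add: test_bit_def)

declare all_range_numeral [simp] conj_assoc [simp del]
text \<open>These conjunctions form complete binary trees; splitting them level by level is much faster than leaving
  it to the simplifier.\<close>

lemmas insert_bit_conj = insert_bit_all[simplified, unfolded k_folds]
lemmas insert_bit_conj_1 = insert_bit_conj[THEN conjunct1] insert_bit_conj[THEN conjunct2]
lemmas insert_bit_conj_2 = insert_bit_conj_1[THEN conjunct1] insert_bit_conj_1[THEN conjunct2]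
lemmas insert_bit_conj_3 = insert_bit_conj_2[THEN conjunct1] insert_bit_conj_2[THEN conjunct2]
lemmas insert_bit_conj_4 = insert_bit_conj_3[THEN conjunct1] insert_bit_conj_3[THEN conjunct2]
lemmas insert_bit_conj_5 = insert_bit_conj_4[THEN conjunct1] insert_bit_conj_4[THEN conjunct2]
lemmas insert_bit_conj_6 = insert_bit_conj_5[THEN conjunct1] insert_bit_conj_5[THEN conjunct2]
lemmas insert_bit_conj_7 = insert_bit_conj_6[THEN conjunct1] insert_bit_conj_6[THEN conjunct2]
lemmas insert_bit_conj_8 = insert_bit_conj_7[THEN conjunct1] insert_bit_conj_7[THEN conjunct2]
lemmas insert_bit_conj_9 = insert_bit_conj_8[THEN conjunct1] insert_bit_conj_8[THEN conjunct2]
lemmas insert_bit_conj_10 = insert_bit_conj_9[THEN conjunct1] insert_bit_conj_9[THEN conjunct2]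
lemmas insert_bit_tab = insert_bit_conj_10[THEN conjunct1] insert_bit_conj_10[THEN conjunct2]
lemmas test_bit_conj = test_bit_all[simplified, unfolded k_folds]
lemmas test_bit_conj_1 = test_bit_conj[THEN conjunct1] test_bit_conj[THEN conjunct2]
lemmas test_bit_conj_2 = test_bit_conj_1[THEN conjunct1] test_bit_conj_1[THEN conjunct2]
lemmas test_bit_conj_3 = test_bit_conj_2[THEN conjunct1] test_bit_conj_2[THEN conjunct2]
lemmas test_bit_conj_4 = test_bit_conj_3[THEN conjunct1] test_bit_conj_3[THEN conjunct2]
lemmas test_bit_conj_5 = test_bit_conj_4[THEN conjunct1] test_bit_conj_4[THEN conjunct2]
lemmas test_bit_conj_6 = test_bit_conj_5[THEN conjunct1] test_bit_conj_5[THEN conjunct2]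
lemmas test_bit_conj_7 = test_bit_conj_6[THEN conjunct1] test_bit_conj_6[THEN conjunct2]
lemmas test_bit_conj_8 = test_bit_conj_7[THEN conjunct1] test_bit_conj_7[THEN conjunct2]
lemmas test_bit_conj_9 = test_bit_conj_8[THEN conjunct1] test_bit_conj_8[THEN conjunct2]
lemmas test_bit_conj_10 = test_bit_conj_9[THEN conjunct1] test_bit_conj_9[THEN conjunct2]
lemmas test_bit_tab = test_bit_conj_10[THEN conjunct1] test_bit_conj_10[THEN conjunct2]

text \<open>Nested plain conditionals would repeat the tail in both branches and grow exponentially
  with the eight bits.\<close>

definition skip :: "bool \<Rightarrow> nat \<Rightarrow> window \<Rightarrow> window" where
  "skip b i w = (if b then w else C i w)"

lemma skip_simps [simp]: "skip True i w = w" "skip False i w = C i w"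
  by (simp_all add: skip_def)

lemma zeros_all: "all_range 0 256 (\<lambda>b. zeros b = skip (odd b) 0 (skip (odd (b div 2)) 1
    (skip (odd (b div 4)) 2 (skip (odd (b div 8)) 3 (skip (odd (b div 16)) 4 (skip (odd (b div 32)) 5
    (skip (odd (b div 64)) 6 (skip (odd (b div 128)) 7 E))))))))"
  by (intro all_range_I) (simp add: zeros_def test_bit_def upt_rec skip_def)

lemmas zeros_conj = zeros_all[simplified, unfolded k_folds]
lemmas zeros_conj_1 = zeros_conj[THEN conjunct1] zeros_conj[THEN conjunct2]
lemmas zeros_conj_2 = zeros_conj_1[THEN conjunct1] zeros_conj_1[THEN conjunct2]
lemmas zeros_conj_3 = zeros_conj_2[THEN conjunct1] zeros_conj_2[THEN conjunct2]
lemmas zeros_conj_4 = zeros_conj_3[THEN conjunct1] zeros_conj_3[THEN conjunct2]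
lemmas zeros_conj_5 = zeros_conj_4[THEN conjunct1] zeros_conj_4[THEN conjunct2]
lemmas zeros_conj_6 = zeros_conj_5[THEN conjunct1] zeros_conj_5[THEN conjunct2]
lemmas zeros_conj_7 = zeros_conj_6[THEN conjunct1] zeros_conj_6[THEN conjunct2]
lemmas zeros_tab = zeros_conj_7[THEN conjunct1] zeros_conj_7[THEN conjunct2]

lemma scan_byte_all: "all_range 0 8 (\<lambda>j. all_range 0 8 (\<lambda>i. scan_byte j (C i w) r = C (8 * j + i) (scan_byte j w r)))"
  by (intro all_range_I) simp

declare scan_byte.simps [simp del] mark.simps [simp del] marked.simps [simp del]
declare scan.simps [simp del] child.simps [simp del] pruned.simps [simp del]

lemmas scan_byte_conj = scan_byte_all[simplified, unfolded k_folds]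
lemmas scan_byte_conj_1 = scan_byte_conj[THEN conjunct1] scan_byte_conj[THEN conjunct2]
lemmas scan_byte_conj_2 = scan_byte_conj_1[THEN conjunct1] scan_byte_conj_1[THEN conjunct2]
lemmas scan_byte_conj_3 = scan_byte_conj_2[THEN conjunct1] scan_byte_conj_2[THEN conjunct2]
lemmas scan_byte_conj_4 = scan_byte_conj_3[THEN conjunct1] scan_byte_conj_3[THEN conjunct2]
lemmas scan_byte_conj_5 = scan_byte_conj_4[THEN conjunct1] scan_byte_conj_4[THEN conjunct2]
lemmas scan_byte_tab = scan_byte_conj_5[THEN conjunct1] scan_byte_conj_5[THEN conjunct2]

definition mark' :: "nat \<Rightarrow> board \<Rightarrow> board" where
  "mark' = mark"

definition marked' :: "nat \<Rightarrow> board \<Rightarrow> bool" where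
  "marked' = marked"

lemmas mark'_simps [simp] = mark.simps[folded mark'_def, unfolded Let_def]
lemmas marked'_simps [simp] = marked.simps[folded marked'_def, unfolded Let_def]

lemma mark_all: "all_range 0 64 (\<lambda>x. mark x (N b0 b1 b2 b3 b4 b5 b6 b7) = mark' x (N b0 b1 b2 b3 b4 b5 b6 b7))"
  by (intro all_range_I) (simp only: mark'_def simp_thms)

lemma marked_all: "all_range 0 64 (\<lambda>x. marked x (N b0 b1 b2 b3 b4 b5 b6 b7) = marked' x (N b0 b1 b2 b3 b4 b5 b6 b7))"
  by (intro all_range_I) (simp only: marked'_def simp_thms)

lemmas mark_conj = mark_all[simplified, unfolded k_folds]
lemmas mark_conj_1 = mark_conj[THEN conjunct1] mark_conj[THEN conjunct2]
lemmas mark_conj_2 = mark_conj_1[THEN conjunct1] mark_conj_1[THEN conjunct2]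
lemmas mark_conj_3 = mark_conj_2[THEN conjunct1] mark_conj_2[THEN conjunct2]
lemmas mark_conj_4 = mark_conj_3[THEN conjunct1] mark_conj_3[THEN conjunct2]
lemmas mark_conj_5 = mark_conj_4[THEN conjunct1] mark_conj_4[THEN conjunct2]
lemmas mark_tab = mark_conj_5[THEN conjunct1] mark_conj_5[THEN conjunct2]
lemmas marked_conj = marked_all[simplified, unfolded k_folds]
lemmas marked_conj_1 = marked_conj[THEN conjunct1] marked_conj[THEN conjunct2]
lemmas marked_conj_2 = marked_conj_1[THEN conjunct1] marked_conj_1[THEN conjunct2]
lemmas marked_conj_3 = marked_conj_2[THEN conjunct1] marked_conj_2[THEN conjunct2]
lemmas marked_conj_4 = marked_conj_3[THEN conjunct1] marked_conj_3[THEN conjunct2]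
lemmas marked_conj_5 = marked_conj_4[THEN conjunct1] marked_conj_4[THEN conjunct2]
lemmas marked_tab = marked_conj_5[THEN conjunct1] marked_conj_5[THEN conjunct2]

lemma insert_bit_full: "test_bit k b \<Longrightarrow> insert_bit k b = b"
  by (simp add: test_bit_def insert_bit_def)

lemma mark_full: "mark x (N 255 255 255 255 255 255 255 255) = N 255 255 255 255 255 255 255 255"
proof -
  have "test_bit (x mod 8) 255"
  proof -
    have "x mod 8 \<in> {0, 1, 2, 3, 4, 5, 6, 7}"
      using mod_less_divisor[of 8 x] by (simp, linarith)
    then show ?thesis
      by (auto simp: test_bit_def)
  qed
  then show ?thesis
    by (simp only: mark.simps Let_def insert_bit_full if_cancel)
qed

text \<open>This rule overlaps with the recursive ones and ends a scan as soon as every residue is marked.\<close>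

lemma scan_full: "scan m s w (N 255 255 255 255 255 255 255 255) = N 255 255 255 255 255 255 255 255"
  by (induction w arbitrary: s) (simp_all add: scan.simps mark_full)

section \<open>Tables for one step of the search\<close>

definition scan' :: "cfg \<Rightarrow> nat \<Rightarrow> nat \<Rightarrow> window \<Rightarrow> board \<Rightarrow> board" where
  "scan' m s d w B = scan m s (C d w) B"

definition child' :: "cfg \<Rightarrow> nat \<Rightarrow> nat \<Rightarrow> window \<Rightarrow> window" where
  "child' m p v w = child m p (C v w)"

definition pruned' :: "cfg \<Rightarrow> board \<Rightarrow> board \<Rightarrow> nat \<Rightarrow> nat \<Rightarrow> window \<Rightarrow> bool" where
  "pruned' m A B p v w = pruned m A B p (C v w)"

lemma scan'_eq: "scan' m s d w B = scan m (msub m (msub m (msub m s d) d) d) w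
     (mark (msub m (msub m (msub m s d) d) d) (mark (msub m (msub m s d) d) (mark (msub m s d) B)))"
  by (simp add: scan'_def scan.simps)

lemma child'_eq: "child' m p v w = C (madd m p v) (C (madd m (madd m p v) v) (C (madd m (madd m (madd m p v) v) v)
     (child m (madd m (madd m (madd m p v) v) v) w)))"
  by (simp add: child'_def child.simps)

lemma pruned'_eq: "pruned' m A B p v w = or_pruned (hit_known m v p A B) m A B (madd m (madd m (madd m p v) v) v) w"
  by (simp add: pruned'_def pruned.simps or_pruned_def)

text \<open>Instantiated at a modulus, these compress a whole step into one rewrite rule for each
  pair of residues, with all its arithmetic done in advance.\<close>

lemma step_all:
  "all_range 0 h (\<lambda>s. all_range 0 h (\<lambda>d. scan m s (C d w) (N b0 b1 b2 b3 b4 b5 b6 b7) = scan' m s d w (N b0 b1 b2 b3 b4 b5 b6 b7)))"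
  "all_range 0 h (\<lambda>p. all_range 0 h (\<lambda>v. child m p (C v w) = child' m p v w))"
  "all_range 0 h (\<lambda>p. all_range 0 h (\<lambda>v. pruned m A B p (C v w) = pruned' m A B p v w))"
  by (intro all_range_I; simp add: scan'_def child'_def pruned'_def)+

text \<open>Unfolding only the primed side at a concrete modulus gives a rule that expands
  \<open>all_range\<close> over the atomic constants.\<close>

lemma all_range_refl: "all_range 0 h P = all_range' 0 h P"
  by (simp add: all_range'_def)

definition hit_known' :: "cfg \<Rightarrow> nat \<Rightarrow> nat \<Rightarrow> board \<Rightarrow> board \<Rightarrow> bool" where
  "hit_known' m u p A B = (if u = 0 then False
     else if u < 64 then marked (mmul m p u) A else marked (mmul m p (u - 64)) B)"

definition mpred :: "cfg \<Rightarrow> nat \<Rightarrow> nat" where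
  "mpred m a = (if a = 0 then modulus m - 1 else a - 1)"

definition msub' :: "cfg \<Rightarrow> nat \<Rightarrow> nat \<Rightarrow> nat" where
  "msub' m a b = (mpred m ^^ b) a"

definition mmul' :: "cfg \<Rightarrow> nat \<Rightarrow> nat \<Rightarrow> nat" where
  "mmul' = mmul"

text \<open>Iterated predecessors avoid numeral arithmetic: each difference is obtained from the
  previous one by one lookup in the table of \<open>mpred\<close>.\<close>

lemma msub_pd:
  assumes "0 < modulus m" "a < modulus m"
  shows "msub m a b = msub' m a b"
proof (induction b)
  case 0
  then show ?case using assms by (simp add: msub_def msub'_def)
next
  case (Suc b)
  let ?h = "int (modulus m)"
  have *: "msub m a c < modulus m" for c
    using assms by (simp add: msub_def nat_less_iff)
  have "int (msub m a (Suc b)) = (int a - int b - 1) mod ?h"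
    using assms by (simp add: msub_def algebra_simps)
  also have "\<dots> = (int (msub m a b) - 1) mod ?h"
    using assms by (simp add: msub_def mod_simps)
  also have "\<dots> = int (mpred m (msub m a b))"
    using *[of b] assms by (cases "msub m a b") (auto simp: mpred_def zmod_minus1 of_nat_diff)
  finally show ?case
    using Suc.IH by (simp add: msub'_def)
qed

lemma mpred_all:
  assumes "m = M h i us"
  shows "all_range 0 h (\<lambda>a. mpred m a = (if a = 0 then h - 1 else a - 1))"
  using assms by (auto simp: all_range_def mpred_def)

lemma msub_all:
  assumes "m = M h i us"
  shows "all_range 0 h (\<lambda>a. all_range 0 h (\<lambda>b. msub m a b = msub' m a b))"
  using assms by (auto simp: all_range_def msub_pd)

lemma mmul_all: "all_range 0 h (\<lambda>a. all_range 0 h (\<lambda>b. mmul m a b = mmul' m a b))"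
  by (simp add: mmul'_def all_range_def)

lemma msub'_all: "all_range 0 63 (\<lambda>b. \<forall>m a. msub' m a (b + 1) = mpred m (msub' m a b))"
  by (intro all_range_I) (simp add: msub'_def)

lemma madd_mod:
  assumes "0 < modulus m"
  shows "madd m a b = (a + b) mod modulus m"
proof -
  have "int (madd m a b) mod int (modulus m) = int (a + b) mod int (modulus m)"
    using int_madd[OF assms] by (simp add: cong_def)
  moreover have "madd m a b < modulus m"
    using assms by (simp add: madd_def msub_def nat_less_iff)
  ultimately show ?thesis
    by (metis mod_less of_nat_eq_iff zmod_int)
qed

text \<open>Products are repeated sums, so their table too rests on the table of
  differences.\<close>

lemma mmul'_all:
  assumes "m = M h i us" "0 < h"
  shows "all_range 0 63 (\<lambda>b. \<forall>a. mmul' m a (b + 1) = madd m (mmul' m a b) a)"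
  using assms by (auto simp: all_range_def mmul'_def mmul_def madd_mod mod_simps algebra_simps)

lemma msub'_0: "msub' m a 0 = a" and mmul'_0: "mmul' m a 0 = 0"
  by (simp_all add: msub'_def mmul'_def mmul_def)

lemmas msub'_tab = msub'_all[simplified, unfolded k_folds] msub'_0[unfolded k_folds]

lemma hit_known_all:
  assumes "m = M h i us" "length us = h"
  shows "all_range 0 h (\<lambda>v. hit_known m v p A B = hit_known' m (us ! v) p A B)"
  using assms by (auto simp: all_range_def hit_known_def hit_known'_def Let_def)

declare hit_known'_def [simp]

lemmas madd_k0 = madd_def[unfolded k0_def[symmetric]]
lemmas or_pruned_tab = dies_rules(6,7)

definition scan1 :: "cfg \<Rightarrow> nat \<Rightarrow> nat \<Rightarrow> window \<Rightarrow> board \<Rightarrow> board" where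
  "scan1 m t d w B = scan m (msub m (msub m t d) d) w (mark (msub m (msub m t d) d) (mark (msub m t d) (mark t B)))"

definition scan2 :: "cfg \<Rightarrow> nat \<Rightarrow> nat \<Rightarrow> window \<Rightarrow> board \<Rightarrow> board" where
  "scan2 m t d w B = scan m (msub m t d) w (mark (msub m t d) (mark t B))"

definition scan3 :: "cfg \<Rightarrow> nat \<Rightarrow> window \<Rightarrow> board \<Rightarrow> board" where
  "scan3 m t w B = scan m t w (mark t B)"

text \<open>Each intermediate residue is passed as an argument and thus evaluated before it is
  copied; the equations of \<open>scan\<close> would duplicate nested differences
  unevaluated.\<close>

lemma scan_steps:
  "scan m s (C d w) B = scan1 m (msub m s d) d w B"
  "scan1 m t d w B = scan2 m (msub m t d) d w (mark t B)"
  "scan2 m t d w B = scan3 m (msub m t d) w (mark t B)"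
  "scan3 m t w B = scan m t w (mark t B)"
  by (simp_all add: scan.simps scan1_def scan2_def scan3_def)

definition child1 :: "cfg \<Rightarrow> nat \<Rightarrow> nat \<Rightarrow> window \<Rightarrow> window" where
  "child1 m q v w = C q (C (madd m q v) (C (madd m (madd m q v) v) (child m (madd m (madd m q v) v) w)))"

definition child2 :: "cfg \<Rightarrow> nat \<Rightarrow> nat \<Rightarrow> window \<Rightarrow> window" where
  "child2 m q v w = C q (C (madd m q v) (child m (madd m q v) w))"

definition child3 :: "cfg \<Rightarrow> nat \<Rightarrow> window \<Rightarrow> window" where
  "child3 m q w = C q (child m q w)"

lemma child_steps:
  "child m p (C v w) = child1 m (madd m p v) v w"
  "child1 m q v w = C q (child2 m (madd m q v) v w)"
  "child2 m q v w = C q (child3 m (madd m q v) w)"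
  "child3 m q w = C q (child m q w)"
  by (simp_all add: child.simps child1_def child2_def child3_def)

definition pruned1 :: "bool \<Rightarrow> cfg \<Rightarrow> board \<Rightarrow> board \<Rightarrow> nat \<Rightarrow> nat \<Rightarrow> window \<Rightarrow> bool" where
  "pruned1 b m A B p v w = (b \<or> pruned m A B (madd m (madd m (madd m p v) v) v) w)"

lemma pruned_steps:
  "pruned m A B p (C v w) = pruned1 (hit_known m v p A B) m A B p v w"
  "pruned1 True m A B p v w = True"
  "pruned1 False m A B p v w = pruned m A B (madd m (madd m (madd m p v) v) v) w"
  by (simp_all add: pruned.simps pruned1_def)

lemma madd_all: "all_range 0 h (\<lambda>a. all_range 0 h (\<lambda>b. madd m a b = msub m a (msub m 0 b)))"
  by (simp add: madd_def all_range_def)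

text \<open>A name for the whole computation, so that simplifying the right-hand side of its
  definition leaves an equation with \<open>True\<close>. The depth 6 is in unary to match the
  recursion of \<open>dies\<close>.\<close>

definition phases_die' :: "cfg \<Rightarrow> nat \<Rightarrow> window \<Rightarrow> phases \<Rightarrow> bool" where
  "phases_die' m g us ps = phases_die m g us ps (Suc (Suc (Suc (Suc (Suc (Suc 0))))))
     (N k0 k0 k0 k0 k0 k0 k0 k0) (N k0 k0 k0 k0 k0 k0 k0 k0)"

lemma inevitable_phases':
  assumes "phases_die' m g us ps = True" and "valid m g" "stab m g us" "inevitable (int g)"
  shows "inevitable (int (modulus m))"
  using assms inevitable_phases[of m g us ps] by (simp add: phases_die'_def k0_def)

lemma True_and: "(True \<and> P) = P"
  by simp

text \<open>\<open>simplified\<close> with arguments uses exactly the rules given, hence even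
  \<open>True_and\<close> is listed. There is no equation for \<open>dies 0\<close>: an exhausted
  search gets stuck instead of reducing to \<open>True\<close>.\<close>

lemmas machine =
  dies_rules(1)[unfolded k0_def[symmetric]] dies_rules(2-) pruned_tbl.simps
  unmarked.simps[unfolded k_folds] scan_byte_tab scan_byte.simps(1) zeros_tab insert_bit_tab
    test_bit_tab mark_tab marked_tab
  mark_orbit.simps[unfolded k_folds] phases_die.simps[unfolded k_folds] ap_window_def
  scan_full[unfolded k_folds] scan.simps(1) child.simps(1) pruned.simps(1) scan_steps(2-)
    child_steps(2-) pruned_steps(2-) True_and

lemmas valid_eval =
  valid_entry_def numeral_2_eq_2[symmetric] marked.simps test_bit_def Let_def unit_mod_def

section \<open>The moduli\<close>

text \<open>The scheme of all moduli. \<open>m\<close> remains opaque, and everything about it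
  becomes a rewrite rule. The board, the ratios and the list of units are checked by
  \<open>valid\<close> and \<open>stab\<close>; the choice and order of the phases is justified by
  the search succeeding.\<close>

lemma inevitable_2: "inevitable 2"
proof -
  \<comment> \<open>In 253 only bit 1 is clear: 0 and all numbers from 2 on are marked.\<close>
  define m where "m = M 2 (N 253 255 255 255 255 255 255 255)
    [0,1]"
  have initial: "initial m = (N k253 k255 k255 k255 k255 k255 k255 k255)"
    by (simp add: m_def k_defs)
  note all = all_range_refl[of 2, simplified all_range'_numeral arith_simps, unfolded k_folds]
  note mpred = mpred_all[OF m_def, simplified, unfolded k_folds]
  note msub = msub_all[OF m_def, unfolded k_folds, simplified all msub'_tab mpred]
  note mmul' = mmul'_all[OF m_def, simplified, unfolded k_folds] mmul'_0[of m, unfolded k_folds]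
  note mmul = mmul_all[of 2 m, unfolded k_folds, simplified all mmul' madd_k0 msub]
  note hit_known = hit_known_all[OF m_def, simplified, unfolded k_folds]
  note madd = madd_all[of 2 m, unfolded k_folds, simplified all msub]
  \<comment> \<open>No progressions are prepared: an expansion of \<open>[1]\<close> is a run of
    four consecutive integers, which contains a multiple of 2. For 3 it is the same.\<close>
  note phases_die = phases_die'_def[of m k1 "(C k1 E)"
      "PE",
      simplified machine initial scan_steps(1) child_steps(1) pruned_steps(1) msub madd mmul
        hit_known]
  have "valid m 1"
    unfolding valid_def m_def cfg.sel all_range_numeral
    by (simp add: valid_eval)
  moreover have "stab m k1 (C k1 E)"
    unfolding stab_def all_window.simps m_def
    by (simp add: k_defs unit_mod_def)
  ultimately have "inevitable (int (modulus m))"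
    using inevitable_1 by (intro inevitable_phases'[OF phases_die]) (simp_all add: k1_def)
  then show ?thesis
    by (simp add: m_def)
qed

lemma inevitable_3: "inevitable 3"
proof -
  define m where "m = M 3 (N 249 255 255 255 255 255 255 255)
    [0,1,2]"
  have initial: "initial m = (N k249 k255 k255 k255 k255 k255 k255 k255)"
    by (simp add: m_def k_defs)
  note all = all_range_refl[of 3, simplified all_range'_numeral arith_simps, unfolded k_folds]
  note mpred = mpred_all[OF m_def, simplified, unfolded k_folds]
  note msub = msub_all[OF m_def, unfolded k_folds, simplified all msub'_tab mpred]
  note mmul' = mmul'_all[OF m_def, simplified, unfolded k_folds] mmul'_0[of m, unfolded k_folds]
  note mmul = mmul_all[of 3 m, unfolded k_folds, simplified all mmul' madd_k0 msub]
  note hit_known = hit_known_all[OF m_def, simplified, unfolded k_folds]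
  note madd = madd_all[of 3 m, unfolded k_folds, simplified all msub]
  note phases_die = phases_die'_def[of m k1 "(C k1 E)"
      "PE",
      simplified machine initial scan_steps(1) child_steps(1) pruned_steps(1) msub madd mmul
        hit_known]
  have "valid m 1"
    unfolding valid_def m_def cfg.sel all_range_numeral
    by (simp add: valid_eval)
  moreover have "stab m k1 (C k1 E)"
    unfolding stab_def all_window.simps m_def
    by (simp add: k_defs unit_mod_def)
  ultimately have "inevitable (int (modulus m))"
    using inevitable_1 by (intro inevitable_phases'[OF phases_die]) (simp_all add: k1_def)
  then show ?thesis
    by (simp add: m_def)
qed

lemma inevitable_4: "inevitable 4"
proof -
  \<comment> \<open>Only 2 is looked up: 65 encodes the unit 1, which carries 2 to
    \<open>g = 2\<close>.\<close>
  define m where "m = M 4 (N 241 255 255 255 255 255 255 255)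
    [0,0,65,0]"
  have initial: "initial m = (N k241 k255 k255 k255 k255 k255 k255 k255)"
    by (simp add: m_def k_defs)
  note all = all_range_refl[of 4, simplified all_range'_numeral arith_simps, unfolded k_folds]
  note mpred = mpred_all[OF m_def, simplified, unfolded k_folds]
  note msub = msub_all[OF m_def, unfolded k_folds, simplified all msub'_tab mpred]
  note mmul' = mmul'_all[OF m_def, simplified, unfolded k_folds] mmul'_0[of m, unfolded k_folds]
  note mmul = mmul_all[of 4 m, unfolded k_folds, simplified all mmul' madd_k0 msub]
  note hit_known = hit_known_all[OF m_def, simplified, unfolded k_folds]
  note madd = madd_all[of 4 m, unfolded k_folds, simplified all msub]
  \<comment> \<open>The listed units are those fixing \<open>g\<close>, that is, the units congruent
    to 1 modulo the prime \<open>h / g\<close>, here 2.\<close>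
  note phases_die = phases_die'_def[of m k2 "(C k1 (C k3 E))"
      "(FG k1 PE)",
      simplified machine initial scan_steps(1) child_steps(1) pruned_steps(1) msub madd mmul
        hit_known]
  have "valid m 2"
    unfolding valid_def m_def cfg.sel all_range_numeral
    by (simp add: valid_eval)
  moreover have "stab m k2 (C k1 (C k3 E))"
    unfolding stab_def all_window.simps m_def
    by (simp add: k_defs unit_mod_def)
  ultimately have "inevitable (int (modulus m))"
    using inevitable_2 by (intro inevitable_phases'[OF phases_die]) (simp_all add: k2_def)
  then show ?thesis
    by (simp add: m_def)
qed

lemma inevitable_5: "inevitable 5"
proof -
  define m where "m = M 5 (N 225 255 255 255 255 255 255 255)
    [0,1,3,2,4]"
  have initial: "initial m = (N k225 k255 k255 k255 k255 k255 k255 k255)"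
    by (simp add: m_def k_defs)
  note all = all_range_refl[of 5, simplified all_range'_numeral arith_simps, unfolded k_folds]
  note mpred = mpred_all[OF m_def, simplified, unfolded k_folds]
  note msub = msub_all[OF m_def, unfolded k_folds, simplified all msub'_tab mpred]
  note mmul' = mmul'_all[OF m_def, simplified, unfolded k_folds] mmul'_0[of m, unfolded k_folds]
  note mmul = mmul_all[of 5 m, unfolded k_folds, simplified all mmul' madd_k0 msub]
  note hit_known = hit_known_all[OF m_def, simplified, unfolded k_folds]
  note madd = madd_all[of 5 m, unfolded k_folds, simplified all msub]
  \<comment> \<open>Modulo 5 the only run of four residues avoiding 0 is 1, 2, 3, 4.\<close>
  note phases_die = phases_die'_def[of m k1 "(C k1 E)"
      "(F1 k1 PE)",
      simplified machine initial scan_steps(1) child_steps(1) pruned_steps(1) msub madd mmul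
        hit_known]
  have "valid m 1"
    unfolding valid_def m_def cfg.sel all_range_numeral
    by (simp add: valid_eval)
  moreover have "stab m k1 (C k1 E)"
    unfolding stab_def all_window.simps m_def
    by (simp add: k_defs unit_mod_def)
  ultimately have "inevitable (int (modulus m))"
    using inevitable_1 by (intro inevitable_phases'[OF phases_die]) (simp_all add: k1_def)
  then show ?thesis
    by (simp add: m_def)
qed

lemma inevitable_7: "inevitable 7"
proof -
  define m where "m = M 7 (N 129 255 255 255 255 255 255 255)
    [0,1,4,5,2,3,6]"
  have initial: "initial m = (N k129 k255 k255 k255 k255 k255 k255 k255)"
    by (simp add: m_def k_defs)
  note all = all_range_refl[of 7, simplified all_range'_numeral arith_simps, unfolded k_folds]
  note mpred = mpred_all[OF m_def, simplified, unfolded k_folds]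
  note msub = msub_all[OF m_def, unfolded k_folds, simplified all msub'_tab mpred]
  note mmul' = mmul'_all[OF m_def, simplified, unfolded k_folds] mmul'_0[of m, unfolded k_folds]
  note mmul = mmul_all[of 7 m, unfolded k_folds, simplified all mmul' madd_k0 msub]
  note hit_known = hit_known_all[OF m_def, simplified, unfolded k_folds]
  note madd = madd_all[of 7 m, unfolded k_folds, simplified all msub]
  \<comment> \<open>For prime \<open>h\<close> the runs avoiding 0 start at 1 to
    \<open>h - 4\<close>, and reflection pairs \<open>x\<close> with \<open>h - 3 - x\<close>; one
    start from each pair is treated, here and for the later primes.\<close>
  note phases_die = phases_die'_def[of m k1 "(C k1 E)"
      "(F1 k1 (P1 k2 PE))",
      simplified machine initial scan_steps(1) child_steps(1) pruned_steps(1) msub madd mmul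
        hit_known]
  have "valid m 1"
    unfolding valid_def m_def cfg.sel all_range_numeral
    by (simp add: valid_eval)
  moreover have "stab m k1 (C k1 E)"
    unfolding stab_def all_window.simps m_def
    by (simp add: k_defs unit_mod_def)
  ultimately have "inevitable (int (modulus m))"
    using inevitable_1 by (intro inevitable_phases'[OF phases_die]) (simp_all add: k1_def)
  then show ?thesis
    by (simp add: m_def)
qed

lemma inevitable_8: "inevitable 8"
proof -
  define m where "m = M 8 (N 1 255 255 255 255 255 255 255)
    [0,0,0,0,65,0,0,0]"
  have initial: "initial m = (N k1 k255 k255 k255 k255 k255 k255 k255)"
    by (simp add: m_def k_defs)
  note all = all_range_refl[of 8, simplified all_range'_numeral arith_simps, unfolded k_folds]
  note mpred = mpred_all[OF m_def, simplified, unfolded k_folds]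
  note msub = msub_all[OF m_def, unfolded k_folds, simplified all msub'_tab mpred]
  note mmul' = mmul'_all[OF m_def, simplified, unfolded k_folds] mmul'_0[of m, unfolded k_folds]
  note mmul = mmul_all[of 8 m, unfolded k_folds, simplified all mmul' madd_k0 msub]
  note hit_known = hit_known_all[OF m_def, simplified, unfolded k_folds]
  note madd = madd_all[of 8 m, unfolded k_folds, simplified all msub]
  \<comment> \<open>Every odd number fixes 4 modulo 8, so a start counts only through its power of
    2: 1 or 2.\<close>
  note phases_die = phases_die'_def[of m k4 "(C k1 (C k3 (C k5 (C k7 E))))"
      "(FG k1 (PG k2 PE))",
      simplified machine initial scan_steps(1) child_steps(1) pruned_steps(1) msub madd mmul
        hit_known]
  have "valid m 4"
    unfolding valid_def m_def cfg.sel all_range_numeral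
    by (simp add: valid_eval)
  moreover have "stab m k4 (C k1 (C k3 (C k5 (C k7 E))))"
    unfolding stab_def all_window.simps m_def
    by (simp add: k_defs unit_mod_def)
  ultimately have "inevitable (int (modulus m))"
    using inevitable_4 by (intro inevitable_phases'[OF phases_die]) (simp_all add: k4_def)
  then show ?thesis
    by (simp add: m_def)
qed

lemma inevitable_9: "inevitable 9"
proof -
  define m where "m = M 9 (N 1 254 255 255 255 255 255 255)
    [0,1,5,65,7,2,66,4,8]"
  have initial: "initial m = (N k1 k254 k255 k255 k255 k255 k255 k255)"
    by (simp add: m_def k_defs)
  note all = all_range_refl[of 9, simplified all_range'_numeral arith_simps, unfolded k_folds]
  note mpred = mpred_all[OF m_def, simplified, unfolded k_folds]
  note msub = msub_all[OF m_def, unfolded k_folds, simplified all msub'_tab mpred]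
  note mmul' = mmul'_all[OF m_def, simplified, unfolded k_folds] mmul'_0[of m, unfolded k_folds]
  note mmul = mmul_all[of 9 m, unfolded k_folds, simplified all mmul' madd_k0 msub]
  note hit_known = hit_known_all[OF m_def, simplified, unfolded k_folds]
  note madd = madd_all[of 9 m, unfolded k_folds, simplified all msub]
  note phases_die = phases_die'_def[of m k3 "(C k1 (C k4 (C k7 E)))"
      "(F1 k1 (PG k1 PE))",
      simplified machine initial scan_steps(1) child_steps(1) pruned_steps(1) msub madd mmul
        hit_known]
  have "valid m 3"
    unfolding valid_def m_def cfg.sel all_range_numeral
    by (simp add: valid_eval)
  moreover have "stab m k3 (C k1 (C k4 (C k7 E)))"
    unfolding stab_def all_window.simps m_def
    by (simp add: k_defs unit_mod_def)
  ultimately have "inevitable (int (modulus m))"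
    using inevitable_3 by (intro inevitable_phases'[OF phases_die]) (simp_all add: k3_def)
  then show ?thesis
    by (simp add: m_def)
qed

lemma inevitable_11: "inevitable 11"
proof -
  define m where "m = M 11 (N 1 248 255 255 255 255 255 255)
    [0,1,6,4,3,9,2,8,7,5,10]"
  have initial: "initial m = (N k1 k248 k255 k255 k255 k255 k255 k255)"
    by (simp add: m_def k_defs)
  note all = all_range_refl[of 11, simplified all_range'_numeral arith_simps, unfolded k_folds]
  note mpred = mpred_all[OF m_def, simplified, unfolded k_folds]
  note msub = msub_all[OF m_def, unfolded k_folds, simplified all msub'_tab mpred]
  note mmul' = mmul'_all[OF m_def, simplified, unfolded k_folds] mmul'_0[of m, unfolded k_folds]
  note mmul = mmul_all[of 11 m, unfolded k_folds, simplified all mmul' madd_k0 msub]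
  note hit_known = hit_known_all[OF m_def, simplified, unfolded k_folds]
  note madd = madd_all[of 11 m, unfolded k_folds, simplified all msub]
  note phases_die = phases_die'_def[of m k1 "(C k1 E)"
      "(F1 k2 (P1 k1 (P1 k3 (P1 k4 PE))))",
      simplified machine initial scan_steps(1) child_steps(1) pruned_steps(1) msub madd mmul
        hit_known]
  have "valid m 1"
    unfolding valid_def m_def cfg.sel all_range_numeral
    by (simp add: valid_eval)
  moreover have "stab m k1 (C k1 E)"
    unfolding stab_def all_window.simps m_def
    by (simp add: k_defs unit_mod_def)
  ultimately have "inevitable (int (modulus m))"
    using inevitable_1 by (intro inevitable_phases'[OF phases_die]) (simp_all add: k1_def)
  then show ?thesis
    by (simp add: m_def)
qed

lemma inevitable_15: "inevitable 15"
proof -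
  define m where "m = M 15 (N 1 128 255 255 255 255 255 255)
    [0,1,8,0,4,65,0,13,2,0,66,11,0,7,14]"
  have initial: "initial m = (N k1 k128 k255 k255 k255 k255 k255 k255)"
    by (simp add: m_def k_defs)
  note all = all_range_refl[of 15, simplified all_range'_numeral arith_simps, unfolded k_folds]
  note mpred = mpred_all[OF m_def, simplified, unfolded k_folds]
  note msub = msub_all[OF m_def, unfolded k_folds, simplified all msub'_tab mpred]
  note mmul' = mmul'_all[OF m_def, simplified, unfolded k_folds] mmul'_0[of m, unfolded k_folds]
  note mmul = mmul_all[of 15 m, unfolded k_folds, simplified all mmul' madd_k0 msub]
  note hit_known = hit_known_all[OF m_def, simplified, unfolded k_folds]
  note madd = madd_all[of 15 m, unfolded k_folds, simplified all msub]
  \<comment> \<open>Here the first board serves as an aid: starts 1 to 11 of difference 1 pair up as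
    \<open>x\<close> and \<open>12 - x\<close>, and all six pairs are settled before difference
    5.\<close>
  note phases_die = phases_die'_def[of m k5 "(C k1 (C k4 (C k7 (C k13 E))))"
      "(F1 k4 (P1 k3 (P1 k6 (P1 k2 (P1 k1 (P1 k5 (PG k1 (PG k3 PE))))))))",
      simplified machine initial scan_steps(1) child_steps(1) pruned_steps(1) msub madd mmul
        hit_known]
  have "valid m 5"
    unfolding valid_def m_def cfg.sel all_range_numeral
    by (simp add: valid_eval)
  moreover have "stab m k5 (C k1 (C k4 (C k7 (C k13 E))))"
    unfolding stab_def all_window.simps m_def
    by (simp add: k_defs unit_mod_def)
  ultimately have "inevitable (int (modulus m))"
    using inevitable_5 by (intro inevitable_phases'[OF phases_die]) (simp_all add: k5_def)
  then show ?thesis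
    by (simp add: m_def)
qed

lemma inevitable_16: "inevitable 16"
proof -
  define m where "m = M 16 (N 1 0 255 255 255 255 255 255)
    [0,1,0,11,0,13,0,7,65,9,0,3,0,5,0,15]"
  have initial: "initial m = (N k1 k0 k255 k255 k255 k255 k255 k255)"
    by (simp add: m_def k_defs)
  note all = all_range_refl[of 16, simplified all_range'_numeral arith_simps, unfolded k_folds]
  note mpred = mpred_all[OF m_def, simplified, unfolded k_folds]
  note msub = msub_all[OF m_def, unfolded k_folds, simplified all msub'_tab mpred]
  note mmul' = mmul'_all[OF m_def, simplified, unfolded k_folds] mmul'_0[of m, unfolded k_folds]
  note mmul = mmul_all[of 16 m, unfolded k_folds, simplified all mmul' madd_k0 msub]
  note hit_known = hit_known_all[OF m_def, simplified, unfolded k_folds]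
  note madd = madd_all[of 16 m, unfolded k_folds, simplified all msub]
  note phases_die = phases_die'_def[of m k8 "(C k1 (C k3 (C k5 (C k7 (C k9 (C k11 (C k13 (C k15
    E))))))))"
      "(F1 k1 (P1 k6 (P1 k2 (P1 k3 (P1 k4 (P1 k5 (PG k1 (PG k2 (PG k4 PE)))))))))",
      simplified machine initial scan_steps(1) child_steps(1) pruned_steps(1) msub madd mmul
        hit_known]
  have "valid m 8"
    unfolding valid_def m_def cfg.sel all_range_numeral
    by (simp add: valid_eval)
  moreover have "stab m k8 (C k1 (C k3 (C k5 (C k7 (C k9 (C k11 (C k13 (C k15 E))))))))"
    unfolding stab_def all_window.simps m_def
    by (simp add: k_defs unit_mod_def)
  ultimately have "inevitable (int (modulus m))"
    using inevitable_8 by (intro inevitable_phases'[OF phases_die]) (simp_all add: k8_def)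
  then show ?thesis
    by (simp add: m_def)
qed

lemma inevitable_17: "inevitable 17"
proof -
  define m where "m = M 17 (N 1 0 254 255 255 255 255 255)
    [0,1,9,6,13,7,3,5,15,2,12,14,10,4,11,8,16]"
  have initial: "initial m = (N k1 k0 k254 k255 k255 k255 k255 k255)"
    by (simp add: m_def k_defs)
  note all = all_range_refl[of 17, simplified all_range'_numeral arith_simps, unfolded k_folds]
  note mpred = mpred_all[OF m_def, simplified, unfolded k_folds]
  note msub = msub_all[OF m_def, unfolded k_folds, simplified all msub'_tab mpred]
  note mmul' = mmul'_all[OF m_def, simplified, unfolded k_folds] mmul'_0[of m, unfolded k_folds]
  note mmul = mmul_all[of 17 m, unfolded k_folds, simplified all mmul' madd_k0 msub]
  note hit_known = hit_known_all[OF m_def, simplified, unfolded k_folds]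
  note madd = madd_all[of 17 m, unfolded k_folds, simplified all msub]
  note phases_die = phases_die'_def[of m k1 "(C k1 E)"
      "(F1 k5 (P1 k4 (P1 k1 (P1 k2 (P1 k3 (P1 k6 (P1 k7 PE)))))))",
      simplified machine initial scan_steps(1) child_steps(1) pruned_steps(1) msub madd mmul
        hit_known]
  have "valid m 1"
    unfolding valid_def m_def cfg.sel all_range_numeral
    by (simp add: valid_eval)
  moreover have "stab m k1 (C k1 E)"
    unfolding stab_def all_window.simps m_def
    by (simp add: k_defs unit_mod_def)
  ultimately have "inevitable (int (modulus m))"
    using inevitable_1 by (intro inevitable_phases'[OF phases_die]) (simp_all add: k1_def)
  then show ?thesis
    by (simp add: m_def)
qed

lemma inevitable_18: "inevitable 18"
proof -
  define m where "m = M 18 (N 1 0 252 255 255 255 255 255)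
    [0,1,0,0,0,11,0,13,0,65,0,5,0,7,0,0,0,17]"
  have initial: "initial m = (N k1 k0 k252 k255 k255 k255 k255 k255)"
    by (simp add: m_def k_defs)
  note all = all_range_refl[of 18, simplified all_range'_numeral arith_simps, unfolded k_folds]
  note mpred = mpred_all[OF m_def, simplified, unfolded k_folds]
  note msub = msub_all[OF m_def, unfolded k_folds, simplified all msub'_tab mpred]
  note mmul' = mmul'_all[OF m_def, simplified, unfolded k_folds] mmul'_0[of m, unfolded k_folds]
  note mmul = mmul_all[of 18 m, unfolded k_folds, simplified all mmul' madd_k0 msub]
  note hit_known = hit_known_all[OF m_def, simplified, unfolded k_folds]
  note madd = madd_all[of 18 m, unfolded k_folds, simplified all msub]
  note phases_die = phases_die'_def[of m k9 "(C k1 (C k5 (C k7 (C k11 (C k13 (C k17 E))))))"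
      "(F1 k5 (P1 k1 (P1 k2 (PG k1 (PG k3 PE)))))",
      simplified machine initial scan_steps(1) child_steps(1) pruned_steps(1) msub madd mmul
        hit_known]
  have "valid m 9"
    unfolding valid_def m_def cfg.sel all_range_numeral
    by (simp add: valid_eval)
  moreover have "stab m k9 (C k1 (C k5 (C k7 (C k11 (C k13 (C k17 E))))))"
    unfolding stab_def all_window.simps m_def
    by (simp add: k_defs unit_mod_def)
  ultimately have "inevitable (int (modulus m))"
    using inevitable_9 by (intro inevitable_phases'[OF phases_die]) (simp_all add: k9_def)
  then show ?thesis
    by (simp add: m_def)
qed

lemma inevitable_19: "inevitable 19"
proof -
  define m where "m = M 19 (N 1 0 248 255 255 255 255 255)
    [0,1,10,13,5,4,16,11,12,17,2,7,8,3,15,14,6,9,18]"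
  have initial: "initial m = (N k1 k0 k248 k255 k255 k255 k255 k255)"
    by (simp add: m_def k_defs)
  note all = all_range_refl[of 19, simplified all_range'_numeral arith_simps, unfolded k_folds]
  note mpred = mpred_all[OF m_def, simplified, unfolded k_folds]
  note msub = msub_all[OF m_def, unfolded k_folds, simplified all msub'_tab mpred]
  note mmul' = mmul'_all[OF m_def, simplified, unfolded k_folds] mmul'_0[of m, unfolded k_folds]
  note mmul = mmul_all[of 19 m, unfolded k_folds, simplified all mmul' madd_k0 msub]
  note hit_known = hit_known_all[OF m_def, simplified, unfolded k_folds]
  note madd = madd_all[of 19 m, unfolded k_folds, simplified all msub]
  note phases_die = phases_die'_def[of m k1 "(C k1 E)"
      "(F1 k1 (P1 k6 (P1 k2 (P1 k3 (P1 k4 (P1 k5 (P1 k7 (P1 k8 PE))))))))",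
      simplified machine initial scan_steps(1) child_steps(1) pruned_steps(1) msub madd mmul
        hit_known]
  have "valid m 1"
    unfolding valid_def m_def cfg.sel all_range_numeral
    by (simp add: valid_eval)
  moreover have "stab m k1 (C k1 E)"
    unfolding stab_def all_window.simps m_def
    by (simp add: k_defs unit_mod_def)
  ultimately have "inevitable (int (modulus m))"
    using inevitable_1 by (intro inevitable_phases'[OF phases_die]) (simp_all add: k1_def)
  then show ?thesis
    by (simp add: m_def)
qed

lemma inevitable_21: "inevitable 21"
proof -
  define m where "m = M 21 (N 1 0 224 255 255 255 255 255)
    [0,1,11,0,16,17,0,65,8,0,19,2,0,13,66,0,4,5,0,10,20]"
  have initial: "initial m = (N k1 k0 k224 k255 k255 k255 k255 k255)"
    by (simp add: m_def k_defs)
  note all = all_range_refl[of 21, simplified all_range'_numeral arith_simps, unfolded k_folds]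
  note mpred = mpred_all[OF m_def, simplified, unfolded k_folds]
  note msub = msub_all[OF m_def, unfolded k_folds, simplified all msub'_tab mpred]
  note mmul' = mmul'_all[OF m_def, simplified, unfolded k_folds] mmul'_0[of m, unfolded k_folds]
  note mmul = mmul_all[of 21 m, unfolded k_folds, simplified all mmul' madd_k0 msub]
  note hit_known = hit_known_all[OF m_def, simplified, unfolded k_folds]
  note madd = madd_all[of 21 m, unfolded k_folds, simplified all msub]
  note phases_die = phases_die'_def[of m k7 "(C k1 (C k4 (C k10 (C k13 (C k16 (C k19 E))))))"
      "(F1 k4 (P1 k7 (P1 k1 (PG k1 (PG k3 PE)))))",
      simplified machine initial scan_steps(1) child_steps(1) pruned_steps(1) msub madd mmul
        hit_known]
  have "valid m 7"
    unfolding valid_def m_def cfg.sel all_range_numeral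
    by (simp add: valid_eval)
  moreover have "stab m k7 (C k1 (C k4 (C k10 (C k13 (C k16 (C k19 E))))))"
    unfolding stab_def all_window.simps m_def
    by (simp add: k_defs unit_mod_def)
  ultimately have "inevitable (int (modulus m))"
    using inevitable_7 by (intro inevitable_phases'[OF phases_die]) (simp_all add: k7_def)
  then show ?thesis
    by (simp add: m_def)
qed

lemma inevitable_23: "inevitable 23"
proof -
  define m where "m = M 23 (N 1 0 128 255 255 255 255 255)
    [0,1,12,8,6,14,4,10,3,18,7,21,2,16,5,20,13,19,9,17,15,11,22]"
  have initial: "initial m = (N k1 k0 k128 k255 k255 k255 k255 k255)"
    by (simp add: m_def k_defs)
  note all = all_range_refl[of 23, simplified all_range'_numeral arith_simps, unfolded k_folds]
  note mpred = mpred_all[OF m_def, simplified, unfolded k_folds]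
  note msub = msub_all[OF m_def, unfolded k_folds, simplified all msub'_tab mpred]
  note mmul' = mmul'_all[OF m_def, simplified, unfolded k_folds] mmul'_0[of m, unfolded k_folds]
  note mmul = mmul_all[of 23 m, unfolded k_folds, simplified all mmul' madd_k0 msub]
  note hit_known = hit_known_all[OF m_def, simplified, unfolded k_folds]
  note madd = madd_all[of 23 m, unfolded k_folds, simplified all msub]
  note phases_die = phases_die'_def[of m k1 "(C k1 E)"
      "(F1 k4 (P1 k3 (P1 k6 (P1 k5 (P1 k1 (P1 k2 (P1 k7 (P1 k8 (P1 k9 (P1 k10 PE))))))))))",
      simplified machine initial scan_steps(1) child_steps(1) pruned_steps(1) msub madd mmul
        hit_known]
  have "valid m 1"
    unfolding valid_def m_def cfg.sel all_range_numeral
    by (simp add: valid_eval)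
  moreover have "stab m k1 (C k1 E)"
    unfolding stab_def all_window.simps m_def
    by (simp add: k_defs unit_mod_def)
  ultimately have "inevitable (int (modulus m))"
    using inevitable_1 by (intro inevitable_phases'[OF phases_die]) (simp_all add: k1_def)
  then show ?thesis
    by (simp add: m_def)
qed

lemma inevitable_24: "inevitable 24"
proof -
  define m where "m = M 24 (N 1 0 0 255 255 255 255 255)
    [0,1,0,0,0,5,0,7,65,0,0,11,0,13,0,0,69,17,0,19,0,0,0,23]"
  have initial: "initial m = (N k1 k0 k0 k255 k255 k255 k255 k255)"
    by (simp add: m_def k_defs)
  note all = all_range_refl[of 24, simplified all_range'_numeral arith_simps, unfolded k_folds]
  note mpred = mpred_all[OF m_def, simplified, unfolded k_folds]
  note msub = msub_all[OF m_def, unfolded k_folds, simplified all msub'_tab mpred]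
  note mmul' = mmul'_all[OF m_def, simplified, unfolded k_folds] mmul'_0[of m, unfolded k_folds]
  note mmul = mmul_all[of 24 m, unfolded k_folds, simplified all mmul' madd_k0 msub]
  note hit_known = hit_known_all[OF m_def, simplified, unfolded k_folds]
  note madd = madd_all[of 24 m, unfolded k_folds, simplified all msub]
  note phases_die = phases_die'_def[of m k8 "(C k1 (C k7 (C k13 (C k19 E))))"
      "(F1 k1 (P1 k2 (P1 k10 (P1 k5 (P1 k4 (P1 k8 (P1 k6 (P1 k3 (PG k1 (PG k3 (PG k2 (PG k6 (PG k4
        (PG k12 PE))))))))))))))",
      simplified machine initial scan_steps(1) child_steps(1) pruned_steps(1) msub madd mmul
        hit_known]
  have "valid m 8"
    unfolding valid_def m_def cfg.sel all_range_numeral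
    by (simp add: valid_eval)
  moreover have "stab m k8 (C k1 (C k7 (C k13 (C k19 E))))"
    unfolding stab_def all_window.simps m_def
    by (simp add: k_defs unit_mod_def)
  ultimately have "inevitable (int (modulus m))"
    using inevitable_8 by (intro inevitable_phases'[OF phases_die]) (simp_all add: k8_def)
  then show ?thesis
    by (simp add: m_def)
qed

lemma inevitable_25: "inevitable 25"
proof -
  define m where "m = M 25 (N 1 0 0 254 255 255 255 255)
    [0,1,13,17,19,65,21,18,22,14,67,16,23,2,9,66,11,3,7,4,68,6,8,12,24]"
  have initial: "initial m = (N k1 k0 k0 k254 k255 k255 k255 k255)"
    by (simp add: m_def k_defs)
  note all = all_range_refl[of 25, simplified all_range'_numeral arith_simps, unfolded k_folds]
  note mpred = mpred_all[OF m_def, simplified, unfolded k_folds]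
  note msub = msub_all[OF m_def, unfolded k_folds, simplified all msub'_tab mpred]
  note mmul' = mmul'_all[OF m_def, simplified, unfolded k_folds] mmul'_0[of m, unfolded k_folds]
  note mmul = mmul_all[of 25 m, unfolded k_folds, simplified all mmul' madd_k0 msub]
  note hit_known = hit_known_all[OF m_def, simplified, unfolded k_folds]
  note madd = madd_all[of 25 m, unfolded k_folds, simplified all msub]
  note phases_die = phases_die'_def[of m k5 "(C k1 (C k6 (C k11 (C k16 (C k21 E)))))"
      "(F1 k7 (PG k1 (PG k5 (PG k2 PE))))",
      simplified machine initial scan_steps(1) child_steps(1) pruned_steps(1) msub madd mmul
        hit_known]
  have "valid m 5"
    unfolding valid_def m_def cfg.sel all_range_numeral
    by (simp add: valid_eval)
  moreover have "stab m k5 (C k1 (C k6 (C k11 (C k16 (C k21 E)))))"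
    unfolding stab_def all_window.simps m_def
    by (simp add: k_defs unit_mod_def)
  ultimately have "inevitable (int (modulus m))"
    using inevitable_5 by (intro inevitable_phases'[OF phases_die]) (simp_all add: k5_def)
  then show ?thesis
    by (simp add: m_def)
qed

lemma inevitable_27: "inevitable 27"
proof -
  define m where "m = M 27 (N 1 0 0 248 255 255 255 255)
    [0,0,0,0,0,0,0,0,0,65,0,0,0,0,0,0,0,0,66,0,0,0,0,0,0,0,0]"
  have initial: "initial m = (N k1 k0 k0 k248 k255 k255 k255 k255)"
    by (simp add: m_def k_defs)
  note all = all_range_refl[of 27, simplified all_range'_numeral arith_simps, unfolded k_folds]
  note mpred = mpred_all[OF m_def, simplified, unfolded k_folds]
  note msub = msub_all[OF m_def, unfolded k_folds, simplified all msub'_tab mpred]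
  note mmul' = mmul'_all[OF m_def, simplified, unfolded k_folds] mmul'_0[of m, unfolded k_folds]
  note mmul = mmul_all[of 27 m, unfolded k_folds, simplified all mmul' madd_k0 msub]
  note hit_known = hit_known_all[OF m_def, simplified, unfolded k_folds]
  note madd = madd_all[of 27 m, unfolded k_folds, simplified all msub]
  \<comment> \<open>The units congruent to 1 modulo 3, together with reflection, leave two orbits of
    starts: those prime to 3, and those divisible by 3 but not by 9.\<close>
  note phases_die = phases_die'_def[of m k9 "(C k1 (C k4 (C k7 (C k10 (C k13 (C k16 (C k19 (C k22
    (C k25 E)))))))))"
      "(FG k1 (PG k3 PE))",
      simplified machine initial scan_steps(1) child_steps(1) pruned_steps(1) msub madd mmul
        hit_known]
  have "valid m 9"
    unfolding valid_def m_def cfg.sel all_range_numeral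
    by (simp add: valid_eval)
  moreover have "stab m k9 (C k1 (C k4 (C k7 (C k10 (C k13 (C k16 (C k19 (C k22 (C k25 E)))))))))"
    unfolding stab_def all_window.simps m_def
    by (simp add: k_defs unit_mod_def)
  ultimately have "inevitable (int (modulus m))"
    using inevitable_9 by (intro inevitable_phases'[OF phases_die]) (simp_all add: k9_def)
  then show ?thesis
    by (simp add: m_def)
qed

lemma inevitable_28: "inevitable 28"
proof -
  define m where "m = M 28 (N 1 0 0 240 255 255 255 255)
    [0,1,0,19,65,17,0,0,75,25,0,23,69,13,0,15,73,5,0,3,67,0,0,11,77,9,0,27]"
  have initial: "initial m = (N k1 k0 k0 k240 k255 k255 k255 k255)"
    by (simp add: m_def k_defs)
  note all = all_range_refl[of 28, simplified all_range'_numeral arith_simps, unfolded k_folds]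
  note mpred = mpred_all[OF m_def, simplified, unfolded k_folds]
  note msub = msub_all[OF m_def, unfolded k_folds, simplified all msub'_tab mpred]
  note mmul' = mmul'_all[OF m_def, simplified, unfolded k_folds] mmul'_0[of m, unfolded k_folds]
  note mmul = mmul_all[of 28 m, unfolded k_folds, simplified all mmul' madd_k0 msub]
  note hit_known = hit_known_all[OF m_def, simplified, unfolded k_folds]
  note madd = madd_all[of 28 m, unfolded k_folds, simplified all msub]
  \<comment> \<open>As \<open>28 / 4 = 7\<close>, only 1 and 15 fix 4. The stabiliser is small, so
    many starts of difference 4 have to be treated separately.\<close>
  note phases_die = phases_die'_def[of m k4 "(C k1 (C k15 E))"
      "(F1 k1 (P1 k12 (P1 k11 (P1 k3 (P1 k8 (P1 k10 (P1 k2 (P1 k9 (PG k3 (PG k1 (PG k5 (PG k7 (PG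
        k2 (PG k6 (PG k18 (PG k4 (PG k8 (PG k22 PE))))))))))))))))))",
      simplified machine initial scan_steps(1) child_steps(1) pruned_steps(1) msub madd mmul
        hit_known]
  have "valid m 4"
    unfolding valid_def m_def cfg.sel all_range_numeral
    by (simp add: valid_eval)
  moreover have "stab m k4 (C k1 (C k15 E))"
    unfolding stab_def all_window.simps m_def
    by (simp add: k_defs unit_mod_def)
  ultimately have "inevitable (int (modulus m))"
    using inevitable_4 by (intro inevitable_phases'[OF phases_die]) (simp_all add: k4_def)
  then show ?thesis
    by (simp add: m_def)
qed

lemma inevitable_29: "inevitable 29"
proof -
  define m where "m = M 29 (N 1 0 0 224 255 255 255 255)
    [0,1,15,10,22,6,5,25,11,13,3,8,17,9,27,2,20,12,21,26,16,18,4,24,23,7,19,14,28]"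
  have initial: "initial m = (N k1 k0 k0 k224 k255 k255 k255 k255)"
    by (simp add: m_def k_defs)
  note all = all_range_refl[of 29, simplified all_range'_numeral arith_simps, unfolded k_folds]
  note mpred = mpred_all[OF m_def, simplified, unfolded k_folds]
  note msub = msub_all[OF m_def, unfolded k_folds, simplified all msub'_tab mpred]
  note mmul' = mmul'_all[OF m_def, simplified, unfolded k_folds] mmul'_0[of m, unfolded k_folds]
  note mmul = mmul_all[of 29 m, unfolded k_folds, simplified all mmul' madd_k0 msub]
  note hit_known = hit_known_all[OF m_def, simplified, unfolded k_folds]
  note madd = madd_all[of 29 m, unfolded k_folds, simplified all msub]
  note phases_die = phases_die'_def[of m k1 "(C k1 E)"
      "(F1 k2 (P1 k1 (P1 k9 (P1 k4 (P1 k5 (P1 k10 (P1 k3 (P1 k6 (P1 k7 (P1 k8 (P1 k11 (P1 k12 (P1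
        k13 PE)))))))))))))",
      simplified machine initial scan_steps(1) child_steps(1) pruned_steps(1) msub madd mmul
        hit_known]
  have "valid m 1"
    unfolding valid_def m_def cfg.sel all_range_numeral
    by (simp add: valid_eval)
  moreover have "stab m k1 (C k1 E)"
    unfolding stab_def all_window.simps m_def
    by (simp add: k_defs unit_mod_def)
  ultimately have "inevitable (int (modulus m))"
    using inevitable_1 by (intro inevitable_phases'[OF phases_die]) (simp_all add: k1_def)
  then show ?thesis
    by (simp add: m_def)
qed

lemma inevitable_30: "inevitable 30"
proof -
  define m where "m = M 30 (N 1 0 0 192 255 255 255 255)
    [0,1,0,0,0,0,0,13,0,0,0,11,0,7,0,65,0,23,0,19,0,0,0,17,0,0,0,0,0,29]"
  have initial: "initial m = (N k1 k0 k0 k192 k255 k255 k255 k255)"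
    by (simp add: m_def k_defs)
  note all = all_range_refl[of 30, simplified all_range'_numeral arith_simps, unfolded k_folds]
  note mpred = mpred_all[OF m_def, simplified, unfolded k_folds]
  note msub = msub_all[OF m_def, unfolded k_folds, simplified all msub'_tab mpred]
  note mmul' = mmul'_all[OF m_def, simplified, unfolded k_folds] mmul'_0[of m, unfolded k_folds]
  note mmul = mmul_all[of 30 m, unfolded k_folds, simplified all mmul' madd_k0 msub]
  note hit_known = hit_known_all[OF m_def, simplified, unfolded k_folds]
  \<comment> \<open>The variant with tabulated steps: more rules, but fewer rewrites for each entry
    of a window.\<close>
  note scan = step_all(1)[of 30 m, unfolded k_folds, simplified all scan'_eq msub mark_tab]
  note child = step_all(2)[of 30 m, unfolded k_folds, simplified all child'_eq madd_k0 msub]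
  note pruned = step_all(3)[of 30 m, unfolded k_folds, simplified all pruned'_eq madd_k0 msub mmul
    hit_known or_pruned_tab]
  note phases_die = phases_die'_def[of m k15 "(C k1 (C k7 (C k11 (C k13 (C k17 (C k19 (C k23 (C k29
    E))))))))"
      "(F1 k6 (P1 k11 (P1 k5 (P1 k4 (P1 k10 (P1 k7 (P1 k13 (P1 k1 (PG k1 (PG k5 (PG k3
        PE)))))))))))",
      simplified machine initial scan child pruned msub mmul]
  have "valid m 15"
    unfolding valid_def m_def cfg.sel all_range_numeral
    by (simp add: valid_eval)
  moreover have "stab m k15 (C k1 (C k7 (C k11 (C k13 (C k17 (C k19 (C k23 (C k29 E))))))))"
    unfolding stab_def all_window.simps m_def
    by (simp add: k_defs unit_mod_def)
  ultimately have "inevitable (int (modulus m))"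
    using inevitable_15 by (intro inevitable_phases'[OF phases_die]) (simp_all add: k15_def)
  then show ?thesis
    by (simp add: m_def)
qed

lemma inevitable_31: "inevitable 31"
proof -
  define m where "m = M 31 (N 1 0 0 128 255 255 255 255)
    [0,1,16,21,8,25,26,9,4,7,28,17,13,12,20,29,2,11,19,18,14,3,24,27,22,5,6,23,10,15,30]"
  have initial: "initial m = (N k1 k0 k0 k128 k255 k255 k255 k255)"
    by (simp add: m_def k_defs)
  note all = all_range_refl[of 31, simplified all_range'_numeral arith_simps, unfolded k_folds]
  note mpred = mpred_all[OF m_def, simplified, unfolded k_folds]
  note msub = msub_all[OF m_def, unfolded k_folds, simplified all msub'_tab mpred]
  note mmul' = mmul'_all[OF m_def, simplified, unfolded k_folds] mmul'_0[of m, unfolded k_folds]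
  note mmul = mmul_all[of 31 m, unfolded k_folds, simplified all mmul' madd_k0 msub]
  note hit_known = hit_known_all[OF m_def, simplified, unfolded k_folds]
  note madd = madd_all[of 31 m, unfolded k_folds, simplified all msub]
  note phases_die = phases_die'_def[of m k1 "(C k1 E)"
      "(F1 k3 (P1 k2 (P1 k6 (P1 k9 (P1 k4 (P1 k5 (P1 k1 (P1 k7 (P1 k8 (P1 k10 (P1 k11 (P1 k12 (P1
        k13 (P1 k14 PE))))))))))))))",
      simplified machine initial scan_steps(1) child_steps(1) pruned_steps(1) msub madd mmul
        hit_known]
  have "valid m 1"
    unfolding valid_def m_def cfg.sel all_range_numeral
    by (simp add: valid_eval)
  moreover have "stab m k1 (C k1 E)"
    unfolding stab_def all_window.simps m_def
    by (simp add: k_defs unit_mod_def)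
  ultimately have "inevitable (int (modulus m))"
    using inevitable_1 by (intro inevitable_phases'[OF phases_die]) (simp_all add: k1_def)
  then show ?thesis
    by (simp add: m_def)
qed

lemma inevitable_57: "inevitable 57"
proof -
  define m where "m = M 57 (N 1 0 0 0 0 0 0 254)
    [0,1,29,0,43,23,0,49,50,0,40,26,0,22,53,0,25,47,0,65,20,0,13,5,0,16,11,0,55,2,0,46,41,0,52,44,
      0,37,66,0,10,32,0,4,35,0,31,17,0,7,8,0,34,14,0,28,56]"
  have initial: "initial m = (N k1 k0 k0 k0 k0 k0 k0 k254)"
    by (simp add: m_def k_defs)
  note all = all_range_refl[of 57, simplified all_range'_numeral arith_simps, unfolded k_folds]
  note mpred = mpred_all[OF m_def, simplified, unfolded k_folds]
  note msub = msub_all[OF m_def, unfolded k_folds, simplified all msub'_tab mpred]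
  note mmul' = mmul'_all[OF m_def, simplified, unfolded k_folds] mmul'_0[of m, unfolded k_folds]
  note mmul = mmul_all[of 57 m, unfolded k_folds, simplified all mmul' madd_k0 msub]
  note hit_known = hit_known_all[OF m_def, simplified, unfolded k_folds]
  note scan = step_all(1)[of 57 m, unfolded k_folds, simplified all scan'_eq msub mark_tab]
  note child = step_all(2)[of 57 m, unfolded k_folds, simplified all child'_eq madd_k0 msub]
  note pruned = step_all(3)[of 57 m, unfolded k_folds, simplified all pruned'_eq madd_k0 msub mmul
    hit_known or_pruned_tab]
  \<comment> \<open>Starts prime to 19 matter only modulo 3, and reflection exchanges 1 and 2; hence
    the two representatives 1 and 3.\<close>
  note phases_die = phases_die'_def[of m k19 "(C k1 (C k4 (C k7 (C k10 (C k13 (C k16 (C k22 (C k25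
    (C k28 (C k31 (C k34 (C k37 (C k40 (C k43 (C k46 (C k49 (C k52 (C k55 E))))))))))))))))))"
      "(F1 k25 (PG k1 (PG k3 PE)))",
      simplified machine initial scan child pruned msub mmul]
  have "valid m 19"
    unfolding valid_def m_def cfg.sel all_range_numeral
    by (simp add: valid_eval)
  moreover have "stab m k19 (C k1 (C k4 (C k7 (C k10 (C k13 (C k16 (C k22 (C k25 (C k28 (C k31 (C
    k34 (C k37 (C k40 (C k43 (C k46 (C k49 (C k52 (C k55 E))))))))))))))))))"
    unfolding stab_def all_window.simps m_def
    by (simp add: k_defs unit_mod_def)
  ultimately have "inevitable (int (modulus m))"
    using inevitable_19 by (intro inevitable_phases'[OF phases_die]) (simp_all add: k19_def)
  then show ?thesis
    by (simp add: m_def)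
qed

lemma inevitable_62: "inevitable 62"
proof -
  define m where "m = M 62 (N 1 0 0 0 0 0 0 192)
    [0,0,0,0,0,0,0,0,0,0,0,0,0,0,0,0,0,0,0,0,0,0,0,0,0,0,0,0,0,0,0,65,0,0,0,0,0,0,0,0,0,0,0,0,0,0,
      0,0,0,0,0,0,0,0,0,0,0,0,0,0,0,0]"
  have initial: "initial m = (N k1 k0 k0 k0 k0 k0 k0 k192)"
    by (simp add: m_def k_defs)
  note all = all_range_refl[of 62, simplified all_range'_numeral arith_simps, unfolded k_folds]
  note mpred = mpred_all[OF m_def, simplified, unfolded k_folds]
  note msub = msub_all[OF m_def, unfolded k_folds, simplified all msub'_tab mpred]
  note mmul' = mmul'_all[OF m_def, simplified, unfolded k_folds] mmul'_0[of m, unfolded k_folds]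
  note mmul = mmul_all[of 62 m, unfolded k_folds, simplified all mmul' madd_k0 msub]
  note hit_known = hit_known_all[OF m_def, simplified, unfolded k_folds]
  note scan = step_all(1)[of 62 m, unfolded k_folds, simplified all scan'_eq msub mark_tab]
  note child = step_all(2)[of 62 m, unfolded k_folds, simplified all child'_eq madd_k0 msub]
  note pruned = step_all(3)[of 62 m, unfolded k_folds, simplified all pruned'_eq madd_k0 msub mmul
    hit_known or_pruned_tab]
  \<comment> \<open>For \<open>h = 2 * g\<close> with an odd prime \<open>g\<close>, odd units and
    the parity-changing reflection act transitively on the starts prime to \<open>g\<close>. One
    unaided search suffices, as also for 58, 46, 38 and 34.\<close>
  note phases_die = phases_die'_def[of m k31 "(C k1 (C k3 (C k5 (C k7 (C k9 (C k11 (C k13 (C k15 (C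
    k17 (C k19 (C k21 (C k23 (C k25 (C k27 (C k29 (C k33 (C k35 (C k37 (C k39 (C k41 (C k43 (C k45
    (C k47 (C k49 (C k51 (C k53 (C k55 (C k57 (C k59 (C k61 E))))))))))))))))))))))))))))))"
      "(FG k1 PE)",
      simplified machine initial scan child pruned msub mmul]
  have "valid m 31"
    unfolding valid_def m_def cfg.sel all_range_numeral
    by (simp add: valid_eval)
  moreover have "stab m k31 (C k1 (C k3 (C k5 (C k7 (C k9 (C k11 (C k13 (C k15 (C k17 (C k19 (C k21
    (C k23 (C k25 (C k27 (C k29 (C k33 (C k35 (C k37 (C k39 (C k41 (C k43 (C k45 (C k47 (C k49 (C
    k51 (C k53 (C k55 (C k57 (C k59 (C k61 E))))))))))))))))))))))))))))))"
    unfolding stab_def all_window.simps m_def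
    by (simp add: k_defs unit_mod_def)
  ultimately have "inevitable (int (modulus m))"
    using inevitable_31 by (intro inevitable_phases'[OF phases_die]) (simp_all add: k31_def)
  then show ?thesis
    by (simp add: m_def)
qed

lemma inevitable_61: "inevitable 61"
proof -
  define m where "m = M 61 (N 1 0 0 0 0 0 0 224)
    [0,1,31,41,46,49,51,35,23,34,55,50,56,47,48,57,42,18,17,45,58,32,25,8,28,22,54,52,24,40,59,2,
      21,37,9,7,39,33,53,36,29,3,16,44,43,19,4,13,14,5,11,6,27,38,26,10,12,15,20,30,60]"
  have initial: "initial m = (N k1 k0 k0 k0 k0 k0 k0 k224)"
    by (simp add: m_def k_defs)
  note all = all_range_refl[of 61, simplified all_range'_numeral arith_simps, unfolded k_folds]
  note mpred = mpred_all[OF m_def, simplified, unfolded k_folds]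
  note msub = msub_all[OF m_def, unfolded k_folds, simplified all msub'_tab mpred]
  note mmul' = mmul'_all[OF m_def, simplified, unfolded k_folds] mmul'_0[of m, unfolded k_folds]
  note mmul = mmul_all[of 61 m, unfolded k_folds, simplified all mmul' madd_k0 msub]
  note hit_known = hit_known_all[OF m_def, simplified, unfolded k_folds]
  note scan = step_all(1)[of 61 m, unfolded k_folds, simplified all scan'_eq msub mark_tab]
  note child = step_all(2)[of 61 m, unfolded k_folds, simplified all child'_eq madd_k0 msub]
  note pruned = step_all(3)[of 61 m, unfolded k_folds, simplified all pruned'_eq madd_k0 msub mmul
    hit_known or_pruned_tab]
  \<comment> \<open>All 29 pairs \<open>x\<close>, \<open>58 - x\<close>, ordered so that each
    search succeeds with the help of the previous ones.\<close>
  note phases_die = phases_die'_def[of m k1 "(C k1 E)"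
      "(F1 k10 (P1 k17 (P1 k19 (P1 k9 (P1 k15 (P1 k20 (P1 k3 (P1 k23 (P1 k8 (P1 k13 (P1 k24 (P1 k25
        (P1 k7 (P1 k1 (P1 k12 (P1 k5 (P1 k6 (P1 k11 (P1 k4 (P1 k14 (P1 k18 (P1 k21 (P1 k2 (P1 k16
        (P1 k22 (P1 k26 (P1 k27 (P1 k28 (P1 k29 PE)))))))))))))))))))))))))))))",
      simplified machine initial scan child pruned msub mmul]
  have "valid m 1"
    unfolding valid_def m_def cfg.sel all_range_numeral
    by (simp add: valid_eval)
  moreover have "stab m k1 (C k1 E)"
    unfolding stab_def all_window.simps m_def
    by (simp add: k_defs unit_mod_def)
  ultimately have "inevitable (int (modulus m))"
    using inevitable_1 by (intro inevitable_phases'[OF phases_die]) (simp_all add: k1_def)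
  then show ?thesis
    by (simp add: m_def)
qed

lemma inevitable_59: "inevitable 59"
proof -
  define m where "m = M 59 (N 1 0 0 0 0 0 0 248)
    [0,1,30,20,15,12,10,17,37,46,6,43,5,50,38,4,48,7,23,28,3,45,51,18,32,26,25,35,19,57,2,40,24,34,
      33,27,41,8,14,56,31,36,52,11,55,21,9,54,16,53,13,22,42,49,47,44,39,29,58]"
  have initial: "initial m = (N k1 k0 k0 k0 k0 k0 k0 k248)"
    by (simp add: m_def k_defs)
  note all = all_range_refl[of 59, simplified all_range'_numeral arith_simps, unfolded k_folds]
  note mpred = mpred_all[OF m_def, simplified, unfolded k_folds]
  note msub = msub_all[OF m_def, unfolded k_folds, simplified all msub'_tab mpred]
  note mmul' = mmul'_all[OF m_def, simplified, unfolded k_folds] mmul'_0[of m, unfolded k_folds]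
  note mmul = mmul_all[of 59 m, unfolded k_folds, simplified all mmul' madd_k0 msub]
  note hit_known = hit_known_all[OF m_def, simplified, unfolded k_folds]
  note scan = step_all(1)[of 59 m, unfolded k_folds, simplified all scan'_eq msub mark_tab]
  note child = step_all(2)[of 59 m, unfolded k_folds, simplified all child'_eq madd_k0 msub]
  note pruned = step_all(3)[of 59 m, unfolded k_folds, simplified all pruned'_eq madd_k0 msub mmul
    hit_known or_pruned_tab]
  note phases_die = phases_die'_def[of m k1 "(C k1 E)"
      "(F1 k7 (P1 k1 (P1 k25 (P1 k11 (P1 k13 (P1 k14 (P1 k9 (P1 k12 (P1 k24 (P1 k4 (P1 k19 (P1 k22
        (P1 k3 (P1 k5 (P1 k10 (P1 k15 (P1 k8 (P1 k6 (P1 k16 (P1 k2 (P1 k17 (P1 k18 (P1 k20 (P1 k21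
        (P1 k23 (P1 k26 (P1 k27 (P1 k28 PE))))))))))))))))))))))))))))",
      simplified machine initial scan child pruned msub mmul]
  have "valid m 1"
    unfolding valid_def m_def cfg.sel all_range_numeral
    by (simp add: valid_eval)
  moreover have "stab m k1 (C k1 E)"
    unfolding stab_def all_window.simps m_def
    by (simp add: k_defs unit_mod_def)
  ultimately have "inevitable (int (modulus m))"
    using inevitable_1 by (intro inevitable_phases'[OF phases_die]) (simp_all add: k1_def)
  then show ?thesis
    by (simp add: m_def)
qed

lemma inevitable_51: "inevitable 51"
proof -
  define m where "m = M 51 (N 1 0 0 0 0 0 248 255)
    [0,1,26,65,13,41,90,22,32,87,46,14,77,4,11,71,16,0,84,43,23,69,7,20,96,49,2,66,31,44,93,28,8,
      78,0,35,74,40,47,68,37,5,75,19,29,72,10,38,80,25,50]"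
  have initial: "initial m = (N k1 k0 k0 k0 k0 k0 k248 k255)"
    by (simp add: m_def k_defs)
  note all = all_range_refl[of 51, simplified all_range'_numeral arith_simps, unfolded k_folds]
  note mpred = mpred_all[OF m_def, simplified, unfolded k_folds]
  note msub = msub_all[OF m_def, unfolded k_folds, simplified all msub'_tab mpred]
  note mmul' = mmul'_all[OF m_def, simplified, unfolded k_folds] mmul'_0[of m, unfolded k_folds]
  note mmul = mmul_all[of 51 m, unfolded k_folds, simplified all mmul' madd_k0 msub]
  note hit_known = hit_known_all[OF m_def, simplified, unfolded k_folds]
  note scan = step_all(1)[of 51 m, unfolded k_folds, simplified all scan'_eq msub mark_tab]
  note child = step_all(2)[of 51 m, unfolded k_folds, simplified all child'_eq madd_k0 msub]
  note pruned = step_all(3)[of 51 m, unfolded k_folds, simplified all pruned'_eq madd_k0 msub mmul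
    hit_known or_pruned_tab]
  \<comment> \<open>Starts divisible by 3 reproduce the situation modulo 17: 3, 6, ..., 21 are three
    times its seven representatives.\<close>
  note phases_die = phases_die'_def[of m k3 "(C k1 (C k35 E))"
      "(F1 k22 (P1 k8 (P1 k11 (PG k1 (PG k2 (PG k3 (PG k8 (PG k15 (PG k5 (PG k18 (PG k9 (PG k10 (PG
        k12 (PG k16 (PG k11 (PG k6 (PG k4 (PG k13 (PG k21 PE)))))))))))))))))))",
      simplified machine initial scan child pruned msub mmul]
  have "valid m 3"
    unfolding valid_def m_def cfg.sel all_range_numeral
    by (simp add: valid_eval)
  moreover have "stab m k3 (C k1 (C k35 E))"
    unfolding stab_def all_window.simps m_def
    by (simp add: k_defs unit_mod_def)
  ultimately have "inevitable (int (modulus m))"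
    using inevitable_3 by (intro inevitable_phases'[OF phases_die]) (simp_all add: k3_def)
  then show ?thesis
    by (simp add: m_def)
qed

lemma inevitable_52: "inevitable 52"
proof -
  define m where "m = M 52 (N 1 0 0 0 0 0 240 255)
    [0,1,0,35,65,21,0,15,71,29,0,19,73,0,0,7,87,49,0,11,85,5,0,43,75,25,0,27,79,9,0,47,69,41,0,3,
      67,45,0,0,81,33,0,23,83,37,0,31,89,17,0,51]"
  have initial: "initial m = (N k1 k0 k0 k0 k0 k0 k240 k255)"
    by (simp add: m_def k_defs)
  note all = all_range_refl[of 52, simplified all_range'_numeral arith_simps, unfolded k_folds]
  note mpred = mpred_all[OF m_def, simplified, unfolded k_folds]
  note msub = msub_all[OF m_def, unfolded k_folds, simplified all msub'_tab mpred]
  note mmul' = mmul'_all[OF m_def, simplified, unfolded k_folds] mmul'_0[of m, unfolded k_folds]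
  note mmul = mmul_all[of 52 m, unfolded k_folds, simplified all mmul' madd_k0 msub]
  note hit_known = hit_known_all[OF m_def, simplified, unfolded k_folds]
  note scan = step_all(1)[of 52 m, unfolded k_folds, simplified all scan'_eq msub mark_tab]
  note child = step_all(2)[of 52 m, unfolded k_folds, simplified all child'_eq madd_k0 msub]
  note pruned = step_all(3)[of 52 m, unfolded k_folds, simplified all pruned'_eq madd_k0 msub mmul
    hit_known or_pruned_tab]
  note phases_die = phases_die'_def[of m k4 "(C k1 (C k27 E))"
      "(F1 k14 (P1 k7 (P1 k15 (P1 k22 (P1 k19 (P1 k23 (P1 k16 (P1 k21 (PG k17 (PG k19 (PG k5 (PG
        k15 (PG k1 (PG k3 (PG k7 (PG k18 (PG k14 (PG k6 (PG k12 (PG k8 (PG k46 (PG k4 (PG k16 (PG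
        k10 (PG k20 (PG k2 (PG k42 PE)))))))))))))))))))))))))))",
      simplified machine initial scan child pruned msub mmul]
  have "valid m 4"
    unfolding valid_def m_def cfg.sel all_range_numeral
    by (simp add: valid_eval)
  moreover have "stab m k4 (C k1 (C k27 E))"
    unfolding stab_def all_window.simps m_def
    by (simp add: k_defs unit_mod_def)
  ultimately have "inevitable (int (modulus m))"
    using inevitable_4 by (intro inevitable_phases'[OF phases_die]) (simp_all add: k4_def)
  then show ?thesis
    by (simp add: m_def)
qed

lemma inevitable_55: "inevitable 55"
proof -
  define m where "m = M 55 (N 1 0 0 0 0 0 128 255)
    [0,1,28,37,14,0,46,8,7,49,0,65,23,17,4,0,31,13,52,29,0,21,67,12,39,0,36,53,2,19,0,16,43,66,34,
      0,26,3,42,24,0,51,38,32,68,0,6,48,47,9,0,41,18,27,54]"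
  have initial: "initial m = (N k1 k0 k0 k0 k0 k0 k128 k255)"
    by (simp add: m_def k_defs)
  note all = all_range_refl[of 55, simplified all_range'_numeral arith_simps, unfolded k_folds]
  note mpred = mpred_all[OF m_def, simplified, unfolded k_folds]
  note msub = msub_all[OF m_def, unfolded k_folds, simplified all msub'_tab mpred]
  note mmul' = mmul'_all[OF m_def, simplified, unfolded k_folds] mmul'_0[of m, unfolded k_folds]
  note mmul = mmul_all[of 55 m, unfolded k_folds, simplified all mmul' madd_k0 msub]
  note hit_known = hit_known_all[OF m_def, simplified, unfolded k_folds]
  note scan = step_all(1)[of 55 m, unfolded k_folds, simplified all scan'_eq msub mark_tab]
  note child = step_all(2)[of 55 m, unfolded k_folds, simplified all child'_eq madd_k0 msub]
  note pruned = step_all(3)[of 55 m, unfolded k_folds, simplified all pruned'_eq madd_k0 msub mmul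
    hit_known or_pruned_tab]
  \<comment> \<open>A start prime to 11 matters only through its residue \<open>c\<close> modulo 5,
    and reflection sends \<open>c\<close> to \<open>2 - c\<close>, leaving 1, 2, 3; the start 11
    handles the multiples of 11.\<close>
  note phases_die = phases_die'_def[of m k11 "(C k1 (C k6 (C k16 (C k21 (C k26 (C k31 (C k36 (C k41
    (C k46 (C k51 E))))))))))"
      "(F1 k1 (P1 k6 (P1 k18 (P1 k16 (P1 k24 (P1 k12 (P1 k11 (P1 k3 (PG k1 (PG k2 (PG k3 (PG k11
        PE))))))))))))",
      simplified machine initial scan child pruned msub mmul]
  have "valid m 11"
    unfolding valid_def m_def cfg.sel all_range_numeral
    by (simp add: valid_eval)
  moreover have "stab m k11 (C k1 (C k6 (C k16 (C k21 (C k26 (C k31 (C k36 (C k41 (C k46 (C k51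
    E))))))))))"
    unfolding stab_def all_window.simps m_def
    by (simp add: k_defs unit_mod_def)
  ultimately have "inevitable (int (modulus m))"
    using inevitable_11 by (intro inevitable_phases'[OF phases_die]) (simp_all add: k11_def)
  then show ?thesis
    by (simp add: m_def)
qed

lemma inevitable_58: "inevitable 58"
proof -
  define m where "m = M 58 (N 1 0 0 0 0 0 0 252)
    [0,0,0,0,0,0,0,0,0,0,0,0,0,0,0,0,0,0,0,0,0,0,0,0,0,0,0,0,0,65,0,0,0,0,0,0,0,0,0,0,0,0,0,0,0,0,
      0,0,0,0,0,0,0,0,0,0,0,0]"
  have initial: "initial m = (N k1 k0 k0 k0 k0 k0 k0 k252)"
    by (simp add: m_def k_defs)
  note all = all_range_refl[of 58, simplified all_range'_numeral arith_simps, unfolded k_folds]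
  note mpred = mpred_all[OF m_def, simplified, unfolded k_folds]
  note msub = msub_all[OF m_def, unfolded k_folds, simplified all msub'_tab mpred]
  note mmul' = mmul'_all[OF m_def, simplified, unfolded k_folds] mmul'_0[of m, unfolded k_folds]
  note mmul = mmul_all[of 58 m, unfolded k_folds, simplified all mmul' madd_k0 msub]
  note hit_known = hit_known_all[OF m_def, simplified, unfolded k_folds]
  note scan = step_all(1)[of 58 m, unfolded k_folds, simplified all scan'_eq msub mark_tab]
  note child = step_all(2)[of 58 m, unfolded k_folds, simplified all child'_eq madd_k0 msub]
  note pruned = step_all(3)[of 58 m, unfolded k_folds, simplified all pruned'_eq madd_k0 msub mmul
    hit_known or_pruned_tab]
  note phases_die = phases_die'_def[of m k29 "(C k1 (C k3 (C k5 (C k7 (C k9 (C k11 (C k13 (C k15 (C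
    k17 (C k19 (C k21 (C k23 (C k25 (C k27 (C k31 (C k33 (C k35 (C k37 (C k39 (C k41 (C k43 (C k45
    (C k47 (C k49 (C k51 (C k53 (C k55 (C k57 E))))))))))))))))))))))))))))"
      "(FG k1 PE)",
      simplified machine initial scan child pruned msub mmul]
  have "valid m 29"
    unfolding valid_def m_def cfg.sel all_range_numeral
    by (simp add: valid_eval)
  moreover have "stab m k29 (C k1 (C k3 (C k5 (C k7 (C k9 (C k11 (C k13 (C k15 (C k17 (C k19 (C k21
    (C k23 (C k25 (C k27 (C k31 (C k33 (C k35 (C k37 (C k39 (C k41 (C k43 (C k45 (C k47 (C k49 (C
    k51 (C k53 (C k55 (C k57 E))))))))))))))))))))))))))))"
    unfolding stab_def all_window.simps m_def
    by (simp add: k_defs unit_mod_def)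
  ultimately have "inevitable (int (modulus m))"
    using inevitable_29 by (intro inevitable_phases'[OF phases_die]) (simp_all add: k29_def)
  then show ?thesis
    by (simp add: m_def)
qed

lemma inevitable_50: "inevitable 50"
proof -
  define m where "m = M 50 (N 1 0 0 0 0 0 252 255)
    [0,1,0,17,0,0,0,43,0,39,0,41,0,27,0,0,0,3,0,29,0,31,0,37,0,65,0,13,0,19,0,21,0,47,0,0,0,23,0,9,
      0,11,0,7,0,0,0,33,0,49]"
  have initial: "initial m = (N k1 k0 k0 k0 k0 k0 k252 k255)"
    by (simp add: m_def k_defs)
  note all = all_range_refl[of 50, simplified all_range'_numeral arith_simps, unfolded k_folds]
  note mpred = mpred_all[OF m_def, simplified, unfolded k_folds]
  note msub = msub_all[OF m_def, unfolded k_folds, simplified all msub'_tab mpred]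
  note mmul' = mmul'_all[OF m_def, simplified, unfolded k_folds] mmul'_0[of m, unfolded k_folds]
  note mmul = mmul_all[of 50 m, unfolded k_folds, simplified all mmul' madd_k0 msub]
  note hit_known = hit_known_all[OF m_def, simplified, unfolded k_folds]
  note scan = step_all(1)[of 50 m, unfolded k_folds, simplified all scan'_eq msub mark_tab]
  note child = step_all(2)[of 50 m, unfolded k_folds, simplified all child'_eq madd_k0 msub]
  note pruned = step_all(3)[of 50 m, unfolded k_folds, simplified all pruned'_eq madd_k0 msub mmul
    hit_known or_pruned_tab]
  \<comment> \<open>Reflection changes parity, so the starts of difference 25 are distinguished only
    by divisibility by 5.\<close>
  note phases_die = phases_die'_def[of m k25 "(C k1 (C k3 (C k7 (C k9 (C k11 (C k13 (C k17 (C k19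
    (C k21 (C k23 (C k27 (C k29 (C k31 (C k33 (C k37 (C k39 (C k41 (C k43 (C k47 (C k49
    E))))))))))))))))))))"
      "(F1 k6 (PG k1 (PG k5 PE)))",
      simplified machine initial scan child pruned msub mmul]
  have "valid m 25"
    unfolding valid_def m_def cfg.sel all_range_numeral
    by (simp add: valid_eval)
  moreover have "stab m k25 (C k1 (C k3 (C k7 (C k9 (C k11 (C k13 (C k17 (C k19 (C k21 (C k23 (C
    k27 (C k29 (C k31 (C k33 (C k37 (C k39 (C k41 (C k43 (C k47 (C k49 E))))))))))))))))))))"
    unfolding stab_def all_window.simps m_def
    by (simp add: k_defs unit_mod_def)
  ultimately have "inevitable (int (modulus m))"
    using inevitable_25 by (intro inevitable_phases'[OF phases_die]) (simp_all add: k25_def)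
  then show ?thesis
    by (simp add: m_def)
qed

lemma inevitable_53: "inevitable 53"
proof -
  define m where "m = M 53 (N 1 0 0 0 0 0 224 255)
    [0,1,27,18,40,32,9,38,20,6,16,29,31,49,19,46,10,25,3,14,8,48,41,30,42,17,51,2,36,11,23,12,5,45,
      39,50,28,43,7,34,4,22,24,37,47,33,15,44,21,13,35,26,52]"
  have initial: "initial m = (N k1 k0 k0 k0 k0 k0 k224 k255)"
    by (simp add: m_def k_defs)
  note all = all_range_refl[of 53, simplified all_range'_numeral arith_simps, unfolded k_folds]
  note mpred = mpred_all[OF m_def, simplified, unfolded k_folds]
  note msub = msub_all[OF m_def, unfolded k_folds, simplified all msub'_tab mpred]
  note mmul' = mmul'_all[OF m_def, simplified, unfolded k_folds] mmul'_0[of m, unfolded k_folds]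
  note mmul = mmul_all[of 53 m, unfolded k_folds, simplified all mmul' madd_k0 msub]
  note hit_known = hit_known_all[OF m_def, simplified, unfolded k_folds]
  note scan = step_all(1)[of 53 m, unfolded k_folds, simplified all scan'_eq msub mark_tab]
  note child = step_all(2)[of 53 m, unfolded k_folds, simplified all child'_eq madd_k0 msub]
  note pruned = step_all(3)[of 53 m, unfolded k_folds, simplified all pruned'_eq madd_k0 msub mmul
    hit_known or_pruned_tab]
  note phases_die = phases_die'_def[of m k1 "(C k1 E)"
      "(F1 k6 (P1 k7 (P1 k5 (P1 k4 (P1 k8 (P1 k3 (P1 k21 (P1 k10 (P1 k11 (P1 k20 (P1 k1 (P1 k19 (P1
        k9 (P1 k12 (P1 k13 (P1 k14 (P1 k2 (P1 k15 (P1 k16 (P1 k17 (P1 k18 (P1 k22 (P1 k23 (P1 k24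
        (P1 k25 PE)))))))))))))))))))))))))",
      simplified machine initial scan child pruned msub mmul]
  have "valid m 1"
    unfolding valid_def m_def cfg.sel all_range_numeral
    by (simp add: valid_eval)
  moreover have "stab m k1 (C k1 E)"
    unfolding stab_def all_window.simps m_def
    by (simp add: k_defs unit_mod_def)
  ultimately have "inevitable (int (modulus m))"
    using inevitable_1 by (intro inevitable_phases'[OF phases_die]) (simp_all add: k1_def)
  then show ?thesis
    by (simp add: m_def)
qed

lemma inevitable_49: "inevitable 49"
proof -
  define m where "m = M 49 (N 1 0 0 0 0 0 254 255)
    [0,1,25,33,37,10,41,65,43,11,5,9,45,34,68,36,46,26,30,31,27,69,29,32,47,2,17,20,66,22,18,19,23,
      3,13,67,15,4,40,44,38,6,70,8,39,12,16,24,48]"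
  have initial: "initial m = (N k1 k0 k0 k0 k0 k0 k254 k255)"
    by (simp add: m_def k_defs)
  note all = all_range_refl[of 49, simplified all_range'_numeral arith_simps, unfolded k_folds]
  note mpred = mpred_all[OF m_def, simplified, unfolded k_folds]
  note msub = msub_all[OF m_def, unfolded k_folds, simplified all msub'_tab mpred]
  note mmul' = mmul'_all[OF m_def, simplified, unfolded k_folds] mmul'_0[of m, unfolded k_folds]
  note mmul = mmul_all[of 49 m, unfolded k_folds, simplified all mmul' madd_k0 msub]
  note hit_known = hit_known_all[OF m_def, simplified, unfolded k_folds]
  note scan = step_all(1)[of 49 m, unfolded k_folds, simplified all scan'_eq msub mark_tab]
  note child = step_all(2)[of 49 m, unfolded k_folds, simplified all child'_eq madd_k0 msub]
  note pruned = step_all(3)[of 49 m, unfolded k_folds, simplified all pruned'_eq madd_k0 msub mmul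
    hit_known or_pruned_tab]
  \<comment> \<open>Starts prime to 7 matter modulo 7 up to sign: 1, 2, 3. The starts 7 and 14
    repeat the two classes of the modulus 7.\<close>
  note phases_die = phases_die'_def[of m k7 "(C k1 (C k8 (C k15 (C k22 (C k29 (C k36 (C k43
    E)))))))"
      "(F1 k3 (P1 k9 (P1 k17 (P1 k8 (P1 k21 (P1 k1 (P1 k18 (P1 k10 (PG k1 (PG k7 (PG k3 (PG k14 (PG
        k2 PE)))))))))))))",
      simplified machine initial scan child pruned msub mmul]
  have "valid m 7"
    unfolding valid_def m_def cfg.sel all_range_numeral
    by (simp add: valid_eval)
  moreover have "stab m k7 (C k1 (C k8 (C k15 (C k22 (C k29 (C k36 (C k43 E)))))))"
    unfolding stab_def all_window.simps m_def
    by (simp add: k_defs unit_mod_def)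
  ultimately have "inevitable (int (modulus m))"
    using inevitable_7 by (intro inevitable_phases'[OF phases_die]) (simp_all add: k7_def)
  then show ?thesis
    by (simp add: m_def)
qed

lemma inevitable_44: "inevitable 44"
proof -
  define m where "m = M 44 (N 1 0 0 0 0 240 255 255)
    [0,1,0,15,65,9,0,19,81,5,0,0,79,17,0,3,67,13,0,7,73,21,0,23,77,37,0,31,83,41,0,27,71,0,0,39,69,
      25,0,35,85,29,0,43]"
  have initial: "initial m = (N k1 k0 k0 k0 k0 k240 k255 k255)"
    by (simp add: m_def k_defs)
  note all = all_range_refl[of 44, simplified all_range'_numeral arith_simps, unfolded k_folds]
  note mpred = mpred_all[OF m_def, simplified, unfolded k_folds]
  note msub = msub_all[OF m_def, unfolded k_folds, simplified all msub'_tab mpred]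
  note mmul' = mmul'_all[OF m_def, simplified, unfolded k_folds] mmul'_0[of m, unfolded k_folds]
  note mmul = mmul_all[of 44 m, unfolded k_folds, simplified all mmul' madd_k0 msub]
  note hit_known = hit_known_all[OF m_def, simplified, unfolded k_folds]
  note scan = step_all(1)[of 44 m, unfolded k_folds, simplified all scan'_eq msub mark_tab]
  note child = step_all(2)[of 44 m, unfolded k_folds, simplified all child'_eq madd_k0 msub]
  note pruned = step_all(3)[of 44 m, unfolded k_folds, simplified all pruned'_eq madd_k0 msub mmul
    hit_known or_pruned_tab]
  note phases_die = phases_die'_def[of m k4 "(C k1 (C k23 E))"
      "(F1 k18 (P1 k5 (P1 k17 (P1 k15 (P1 k1 (P1 k3 (P1 k19 (P1 k14 (PG k3 (PG k13 (PG k5 (PG k15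
        (PG k11 (PG k1 (PG k14 (PG k2 (PG k6 (PG k38 (PG k4 (PG k8 (PG k12 (PG k34 (PG k10 (PG k16
        PE))))))))))))))))))))))))",
      simplified machine initial scan child pruned msub mmul]
  have "valid m 4"
    unfolding valid_def m_def cfg.sel all_range_numeral
    by (simp add: valid_eval)
  moreover have "stab m k4 (C k1 (C k23 E))"
    unfolding stab_def all_window.simps m_def
    by (simp add: k_defs unit_mod_def)
  ultimately have "inevitable (int (modulus m))"
    using inevitable_4 by (intro inevitable_phases'[OF phases_die]) (simp_all add: k4_def)
  then show ?thesis
    by (simp add: m_def)
qed

lemma inevitable_47: "inevitable 47"
proof -
  define m where "m = M 47 (N 1 0 0 0 0 128 255 255)
    [0,1,24,16,12,19,8,27,6,21,33,30,4,29,37,22,3,36,34,5,40,9,15,45,2,32,38,7,42,13,11,44,25,10,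
      18,43,17,14,26,41,20,39,28,35,31,23,46]"
  have initial: "initial m = (N k1 k0 k0 k0 k0 k128 k255 k255)"
    by (simp add: m_def k_defs)
  note all = all_range_refl[of 47, simplified all_range'_numeral arith_simps, unfolded k_folds]
  note mpred = mpred_all[OF m_def, simplified, unfolded k_folds]
  note msub = msub_all[OF m_def, unfolded k_folds, simplified all msub'_tab mpred]
  note mmul' = mmul'_all[OF m_def, simplified, unfolded k_folds] mmul'_0[of m, unfolded k_folds]
  note mmul = mmul_all[of 47 m, unfolded k_folds, simplified all mmul' madd_k0 msub]
  note hit_known = hit_known_all[OF m_def, simplified, unfolded k_folds]
  note scan = step_all(1)[of 47 m, unfolded k_folds, simplified all scan'_eq msub mark_tab]
  note child = step_all(2)[of 47 m, unfolded k_folds, simplified all child'_eq madd_k0 msub]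
  note pruned = step_all(3)[of 47 m, unfolded k_folds, simplified all pruned'_eq madd_k0 msub mmul
    hit_known or_pruned_tab]
  note phases_die = phases_die'_def[of m k1 "(C k1 E)"
      "(F1 k3 (P1 k12 (P1 k6 (P1 k18 (P1 k19 (P1 k16 (P1 k9 (P1 k14 (P1 k5 (P1 k8 (P1 k10 (P1 k13
        (P1 k2 (P1 k4 (P1 k1 (P1 k7 (P1 k11 (P1 k15 (P1 k17 (P1 k20 (P1 k21 (P1 k22
        PE))))))))))))))))))))))",
      simplified machine initial scan child pruned msub mmul]
  have "valid m 1"
    unfolding valid_def m_def cfg.sel all_range_numeral
    by (simp add: valid_eval)
  moreover have "stab m k1 (C k1 E)"
    unfolding stab_def all_window.simps m_def
    by (simp add: k_defs unit_mod_def)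
  ultimately have "inevitable (int (modulus m))"
    using inevitable_1 by (intro inevitable_phases'[OF phases_die]) (simp_all add: k1_def)
  then show ?thesis
    by (simp add: m_def)
qed

lemma inevitable_40: "inevitable 40"
proof -
  define m where "m = M 40 (N 1 0 0 0 0 255 255 255)
    [0,1,0,27,0,0,0,23,65,9,0,11,0,37,0,0,67,33,0,19,0,21,0,7,71,0,0,3,0,29,0,31,73,17,0,0,0,13,0,
      39]"
  have initial: "initial m = (N k1 k0 k0 k0 k0 k255 k255 k255)"
    by (simp add: m_def k_defs)
  note all = all_range_refl[of 40, simplified all_range'_numeral arith_simps, unfolded k_folds]
  note mpred = mpred_all[OF m_def, simplified, unfolded k_folds]
  note msub = msub_all[OF m_def, unfolded k_folds, simplified all msub'_tab mpred]
  note mmul' = mmul'_all[OF m_def, simplified, unfolded k_folds] mmul'_0[of m, unfolded k_folds]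
  note mmul = mmul_all[of 40 m, unfolded k_folds, simplified all mmul' madd_k0 msub]
  note hit_known = hit_known_all[OF m_def, simplified, unfolded k_folds]
  note scan = step_all(1)[of 40 m, unfolded k_folds, simplified all scan'_eq msub mark_tab]
  note child = step_all(2)[of 40 m, unfolded k_folds, simplified all child'_eq madd_k0 msub]
  note pruned = step_all(3)[of 40 m, unfolded k_folds, simplified all pruned'_eq madd_k0 msub mmul
    hit_known or_pruned_tab]
  note phases_die = phases_die'_def[of m k8 "(C k1 (C k11 (C k21 (C k31 E))))"
      "(F1 k11 (P1 k1 (P1 k7 (P1 k16 (P1 k10 (P1 k6 (P1 k17 (P1 k5 (PG k3 (PG k1 (PG k7 (PG k6 (PG
        k2 (PG k18 (PG k20 (PG k28 (PG k4 (PG k8 PE))))))))))))))))))",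
      simplified machine initial scan child pruned msub mmul]
  have "valid m 8"
    unfolding valid_def m_def cfg.sel all_range_numeral
    by (simp add: valid_eval)
  moreover have "stab m k8 (C k1 (C k11 (C k21 (C k31 E))))"
    unfolding stab_def all_window.simps m_def
    by (simp add: k_defs unit_mod_def)
  ultimately have "inevitable (int (modulus m))"
    using inevitable_8 by (intro inevitable_phases'[OF phases_die]) (simp_all add: k8_def)
  then show ?thesis
    by (simp add: m_def)
qed

lemma inevitable_32: "inevitable 32"
proof -
  define m where "m = M 32 (N 1 0 0 0 255 255 255 255)
    [0,1,0,11,0,13,0,23,0,25,0,3,0,5,0,15,65,17,0,27,0,29,0,7,0,9,0,19,0,21,0,31]"
  have initial: "initial m = (N k1 k0 k0 k0 k255 k255 k255 k255)"
    by (simp add: m_def k_defs)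
  note all = all_range_refl[of 32, simplified all_range'_numeral arith_simps, unfolded k_folds]
  note mpred = mpred_all[OF m_def, simplified, unfolded k_folds]
  note msub = msub_all[OF m_def, unfolded k_folds, simplified all msub'_tab mpred]
  note mmul' = mmul'_all[OF m_def, simplified, unfolded k_folds] mmul'_0[of m, unfolded k_folds]
  note mmul = mmul_all[of 32 m, unfolded k_folds, simplified all mmul' madd_k0 msub]
  note hit_known = hit_known_all[OF m_def, simplified, unfolded k_folds]
  note scan = step_all(1)[of 32 m, unfolded k_folds, simplified all scan'_eq msub mark_tab]
  note child = step_all(2)[of 32 m, unfolded k_folds, simplified all child'_eq madd_k0 msub]
  note pruned = step_all(3)[of 32 m, unfolded k_folds, simplified all pruned'_eq madd_k0 msub mmul
    hit_known or_pruned_tab]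
  \<comment> \<open>Difference 16 has one orbit of starts for each of the powers 1, 2, 4, 8, as all
    odd numbers fix 16.\<close>
  note phases_die = phases_die'_def[of m k16 "(C k1 (C k3 (C k5 (C k7 (C k9 (C k11 (C k13 (C k15 (C
    k17 (C k19 (C k21 (C k23 (C k25 (C k27 (C k29 (C k31 E))))))))))))))))"
      "(F1 k1 (P1 k6 (P1 k5 (P1 k3 (P1 k7 (P1 k14 (P1 k2 (P1 k4 (PG k1 (PG k2 (PG k4 (PG k8
        PE))))))))))))",
      simplified machine initial scan child pruned msub mmul]
  have "valid m 16"
    unfolding valid_def m_def cfg.sel all_range_numeral
    by (simp add: valid_eval)
  moreover have "stab m k16 (C k1 (C k3 (C k5 (C k7 (C k9 (C k11 (C k13 (C k15 (C k17 (C k19 (C k21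
    (C k23 (C k25 (C k27 (C k29 (C k31 E))))))))))))))))"
    unfolding stab_def all_window.simps m_def
    by (simp add: k_defs unit_mod_def)
  ultimately have "inevitable (int (modulus m))"
    using inevitable_16 by (intro inevitable_phases'[OF phases_die]) (simp_all add: k16_def)
  then show ?thesis
    by (simp add: m_def)
qed

lemma inevitable_46: "inevitable 46"
proof -
  define m where "m = M 46 (N 1 0 0 0 0 192 255 255)
    [0,0,0,0,0,0,0,0,0,0,0,0,0,0,0,0,0,0,0,0,0,0,0,65,0,0,0,0,0,0,0,0,0,0,0,0,0,0,0,0,0,0,0,0,0,0]"
  have initial: "initial m = (N k1 k0 k0 k0 k0 k192 k255 k255)"
    by (simp add: m_def k_defs)
  note all = all_range_refl[of 46, simplified all_range'_numeral arith_simps, unfolded k_folds]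
  note mpred = mpred_all[OF m_def, simplified, unfolded k_folds]
  note msub = msub_all[OF m_def, unfolded k_folds, simplified all msub'_tab mpred]
  note mmul' = mmul'_all[OF m_def, simplified, unfolded k_folds] mmul'_0[of m, unfolded k_folds]
  note mmul = mmul_all[of 46 m, unfolded k_folds, simplified all mmul' madd_k0 msub]
  note hit_known = hit_known_all[OF m_def, simplified, unfolded k_folds]
  note scan = step_all(1)[of 46 m, unfolded k_folds, simplified all scan'_eq msub mark_tab]
  note child = step_all(2)[of 46 m, unfolded k_folds, simplified all child'_eq madd_k0 msub]
  note pruned = step_all(3)[of 46 m, unfolded k_folds, simplified all pruned'_eq madd_k0 msub mmul
    hit_known or_pruned_tab]
  note phases_die = phases_die'_def[of m k23 "(C k1 (C k3 (C k5 (C k7 (C k9 (C k11 (C k13 (C k15 (C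
    k17 (C k19 (C k21 (C k25 (C k27 (C k29 (C k31 (C k33 (C k35 (C k37 (C k39 (C k41 (C k43 (C k45
    E))))))))))))))))))))))"
      "(FG k1 PE)",
      simplified machine initial scan child pruned msub mmul]
  have "valid m 23"
    unfolding valid_def m_def cfg.sel all_range_numeral
    by (simp add: valid_eval)
  moreover have "stab m k23 (C k1 (C k3 (C k5 (C k7 (C k9 (C k11 (C k13 (C k15 (C k17 (C k19 (C k21
    (C k25 (C k27 (C k29 (C k31 (C k33 (C k35 (C k37 (C k39 (C k41 (C k43 (C k45
    E))))))))))))))))))))))"
    unfolding stab_def all_window.simps m_def
    by (simp add: k_defs unit_mod_def)
  ultimately have "inevitable (int (modulus m))"
    using inevitable_23 by (intro inevitable_phases'[OF phases_die]) (simp_all add: k23_def)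
  then show ?thesis
    by (simp add: m_def)
qed

lemma inevitable_39: "inevitable 39"
proof -
  define m where "m = M 39 (N 1 0 0 0 128 255 255 255)
    [0,1,20,65,10,8,71,28,5,86,4,32,74,0,14,72,22,23,75,37,2,66,16,17,69,25,0,80,7,35,68,34,11,83,
      31,29,89,19,38]"
  have initial: "initial m = (N k1 k0 k0 k0 k128 k255 k255 k255)"
    by (simp add: m_def k_defs)
  note all = all_range_refl[of 39, simplified all_range'_numeral arith_simps, unfolded k_folds]
  note mpred = mpred_all[OF m_def, simplified, unfolded k_folds]
  note msub = msub_all[OF m_def, unfolded k_folds, simplified all msub'_tab mpred]
  note mmul' = mmul'_all[OF m_def, simplified, unfolded k_folds] mmul'_0[of m, unfolded k_folds]
  note mmul = mmul_all[of 39 m, unfolded k_folds, simplified all mmul' madd_k0 msub]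
  note hit_known = hit_known_all[OF m_def, simplified, unfolded k_folds]
  note scan = step_all(1)[of 39 m, unfolded k_folds, simplified all scan'_eq msub mark_tab]
  note child = step_all(2)[of 39 m, unfolded k_folds, simplified all child'_eq madd_k0 msub]
  note pruned = step_all(3)[of 39 m, unfolded k_folds, simplified all pruned'_eq madd_k0 msub mmul
    hit_known or_pruned_tab]
  \<comment> \<open>The starts 3, 6, 9, 12, 15 are three times the representatives modulo 13; the
    other seven are prime to 3.\<close>
  note phases_die = phases_die'_def[of m k3 "(C k1 (C k14 E))"
      "(F1 k1 (PG k4 (PG k7 (PG k6 (PG k8 (PG k12 (PG k11 (PG k9 (PG k5 (PG k3 (PG k15 (PG k2 (PG
        k1 PE)))))))))))))",
      simplified machine initial scan child pruned msub mmul]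
  have "valid m 3"
    unfolding valid_def m_def cfg.sel all_range_numeral
    by (simp add: valid_eval)
  moreover have "stab m k3 (C k1 (C k14 E))"
    unfolding stab_def all_window.simps m_def
    by (simp add: k_defs unit_mod_def)
  ultimately have "inevitable (int (modulus m))"
    using inevitable_3 by (intro inevitable_phases'[OF phases_die]) (simp_all add: k3_def)
  then show ?thesis
    by (simp add: m_def)
qed

lemma inevitable_43: "inevitable 43"
proof -
  define m where "m = M 43 (N 1 0 0 0 0 248 255 255)
    [0,1,22,29,11,26,36,37,27,24,13,4,18,10,40,23,35,38,12,34,28,41,2,15,9,31,5,8,20,3,33,25,39,30,
      19,16,6,7,17,32,14,21,42]"
  have initial: "initial m = (N k1 k0 k0 k0 k0 k248 k255 k255)"
    by (simp add: m_def k_defs)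
  note all = all_range_refl[of 43, simplified all_range'_numeral arith_simps, unfolded k_folds]
  note mpred = mpred_all[OF m_def, simplified, unfolded k_folds]
  note msub = msub_all[OF m_def, unfolded k_folds, simplified all msub'_tab mpred]
  note mmul' = mmul'_all[OF m_def, simplified, unfolded k_folds] mmul'_0[of m, unfolded k_folds]
  note mmul = mmul_all[of 43 m, unfolded k_folds, simplified all mmul' madd_k0 msub]
  note hit_known = hit_known_all[OF m_def, simplified, unfolded k_folds]
  note scan = step_all(1)[of 43 m, unfolded k_folds, simplified all scan'_eq msub mark_tab]
  note child = step_all(2)[of 43 m, unfolded k_folds, simplified all child'_eq madd_k0 msub]
  note pruned = step_all(3)[of 43 m, unfolded k_folds, simplified all pruned'_eq madd_k0 msub mmul
    hit_known or_pruned_tab]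
  note phases_die = phases_die'_def[of m k1 "(C k1 E)"
      "(F1 k3 (P1 k12 (P1 k15 (P1 k18 (P1 k2 (P1 k16 (P1 k1 (P1 k7 (P1 k17 (P1 k8 (P1 k9 (P1 k10
        (P1 k4 (P1 k5 (P1 k6 (P1 k11 (P1 k13 (P1 k14 (P1 k19 (P1 k20 PE))))))))))))))))))))",
      simplified machine initial scan child pruned msub mmul]
  have "valid m 1"
    unfolding valid_def m_def cfg.sel all_range_numeral
    by (simp add: valid_eval)
  moreover have "stab m k1 (C k1 E)"
    unfolding stab_def all_window.simps m_def
    by (simp add: k_defs unit_mod_def)
  ultimately have "inevitable (int (modulus m))"
    using inevitable_1 by (intro inevitable_phases'[OF phases_die]) (simp_all add: k1_def)
  then show ?thesis
    by (simp add: m_def)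
qed

lemma inevitable_41: "inevitable 41"
proof -
  define m where "m = M 41 (N 1 0 0 0 0 254 255 255)
    [0,1,21,14,31,33,7,6,36,32,37,15,24,19,3,11,18,29,16,13,39,2,28,25,12,23,30,38,22,17,26,4,9,5,
      35,34,8,10,27,20,40]"
  have initial: "initial m = (N k1 k0 k0 k0 k0 k254 k255 k255)"
    by (simp add: m_def k_defs)
  note all = all_range_refl[of 41, simplified all_range'_numeral arith_simps, unfolded k_folds]
  note mpred = mpred_all[OF m_def, simplified, unfolded k_folds]
  note msub = msub_all[OF m_def, unfolded k_folds, simplified all msub'_tab mpred]
  note mmul' = mmul'_all[OF m_def, simplified, unfolded k_folds] mmul'_0[of m, unfolded k_folds]
  note mmul = mmul_all[of 41 m, unfolded k_folds, simplified all mmul' madd_k0 msub]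
  note hit_known = hit_known_all[OF m_def, simplified, unfolded k_folds]
  note scan = step_all(1)[of 41 m, unfolded k_folds, simplified all scan'_eq msub mark_tab]
  note child = step_all(2)[of 41 m, unfolded k_folds, simplified all child'_eq madd_k0 msub]
  note pruned = step_all(3)[of 41 m, unfolded k_folds, simplified all pruned'_eq madd_k0 msub mmul
    hit_known or_pruned_tab]
  note phases_die = phases_die'_def[of m k1 "(C k1 E)"
      "(F1 k16 (P1 k11 (P1 k8 (P1 k7 (P1 k17 (P1 k10 (P1 k2 (P1 k12 (P1 k3 (P1 k5 (P1 k1 (P1 k4 (P1
        k6 (P1 k9 (P1 k13 (P1 k14 (P1 k15 (P1 k18 (P1 k19 PE)))))))))))))))))))",
      simplified machine initial scan child pruned msub mmul]
  have "valid m 1"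
    unfolding valid_def m_def cfg.sel all_range_numeral
    by (simp add: valid_eval)
  moreover have "stab m k1 (C k1 E)"
    unfolding stab_def all_window.simps m_def
    by (simp add: k_defs unit_mod_def)
  ultimately have "inevitable (int (modulus m))"
    using inevitable_1 by (intro inevitable_phases'[OF phases_die]) (simp_all add: k1_def)
  then show ?thesis
    by (simp add: m_def)
qed

lemma inevitable_38: "inevitable 38"
proof -
  define m where "m = M 38 (N 1 0 0 0 192 255 255 255)
    [0,0,0,0,0,0,0,0,0,0,0,0,0,0,0,0,0,0,0,65,0,0,0,0,0,0,0,0,0,0,0,0,0,0,0,0,0,0]"
  have initial: "initial m = (N k1 k0 k0 k0 k192 k255 k255 k255)"
    by (simp add: m_def k_defs)
  note all = all_range_refl[of 38, simplified all_range'_numeral arith_simps, unfolded k_folds]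
  note mpred = mpred_all[OF m_def, simplified, unfolded k_folds]
  note msub = msub_all[OF m_def, unfolded k_folds, simplified all msub'_tab mpred]
  note mmul' = mmul'_all[OF m_def, simplified, unfolded k_folds] mmul'_0[of m, unfolded k_folds]
  note mmul = mmul_all[of 38 m, unfolded k_folds, simplified all mmul' madd_k0 msub]
  note hit_known = hit_known_all[OF m_def, simplified, unfolded k_folds]
  note madd = madd_all[of 38 m, unfolded k_folds, simplified all msub]
  note phases_die = phases_die'_def[of m k19 "(C k1 (C k3 (C k5 (C k7 (C k9 (C k11 (C k13 (C k15 (C
    k17 (C k21 (C k23 (C k25 (C k27 (C k29 (C k31 (C k33 (C k35 (C k37 E))))))))))))))))))"
      "(FG k1 PE)",
      simplified machine initial scan_steps(1) child_steps(1) pruned_steps(1) msub madd mmul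
        hit_known]
  have "valid m 19"
    unfolding valid_def m_def cfg.sel all_range_numeral
    by (simp add: valid_eval)
  moreover have "stab m k19 (C k1 (C k3 (C k5 (C k7 (C k9 (C k11 (C k13 (C k15 (C k17 (C k21 (C k23
    (C k25 (C k27 (C k29 (C k31 (C k33 (C k35 (C k37 E))))))))))))))))))"
    unfolding stab_def all_window.simps m_def
    by (simp add: k_defs unit_mod_def)
  ultimately have "inevitable (int (modulus m))"
    using inevitable_19 by (intro inevitable_phases'[OF phases_die]) (simp_all add: k19_def)
  then show ?thesis
    by (simp add: m_def)
qed

lemma inevitable_37: "inevitable 37"
proof -
  define m where "m = M 37 (N 1 0 0 0 224 255 255 255)
    [0,1,19,25,28,15,31,16,14,33,26,27,34,20,8,5,7,24,35,2,13,30,32,29,17,3,10,11,4,23,21,6,22,9,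
      12,18,36]"
  have initial: "initial m = (N k1 k0 k0 k0 k224 k255 k255 k255)"
    by (simp add: m_def k_defs)
  note all = all_range_refl[of 37, simplified all_range'_numeral arith_simps, unfolded k_folds]
  note mpred = mpred_all[OF m_def, simplified, unfolded k_folds]
  note msub = msub_all[OF m_def, unfolded k_folds, simplified all msub'_tab mpred]
  note mmul' = mmul'_all[OF m_def, simplified, unfolded k_folds] mmul'_0[of m, unfolded k_folds]
  note mmul = mmul_all[of 37 m, unfolded k_folds, simplified all mmul' madd_k0 msub]
  note hit_known = hit_known_all[OF m_def, simplified, unfolded k_folds]
  note madd = madd_all[of 37 m, unfolded k_folds, simplified all msub]
  note phases_die = phases_die'_def[of m k1 "(C k1 E)"
      "(F1 k14 (P1 k15 (P1 k6 (P1 k2 (P1 k13 (P1 k12 (P1 k7 (P1 k5 (P1 k3 (P1 k4 (P1 k8 (P1 k1 (P1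
        k9 (P1 k10 (P1 k11 (P1 k16 (P1 k17 PE)))))))))))))))))",
      simplified machine initial scan_steps(1) child_steps(1) pruned_steps(1) msub madd mmul
        hit_known]
  have "valid m 1"
    unfolding valid_def m_def cfg.sel all_range_numeral
    by (simp add: valid_eval)
  moreover have "stab m k1 (C k1 E)"
    unfolding stab_def all_window.simps m_def
    by (simp add: k_defs unit_mod_def)
  ultimately have "inevitable (int (modulus m))"
    using inevitable_1 by (intro inevitable_phases'[OF phases_die]) (simp_all add: k1_def)
  then show ?thesis
    by (simp add: m_def)
qed

lemma inevitable_33: "inevitable 33"
proof -
  define m where "m = M 33 (N 1 0 0 0 254 255 255 255)
    [0,1,17,0,25,20,0,19,29,0,10,65,0,28,26,0,31,2,0,7,5,0,66,23,0,4,14,0,13,8,0,16,32]"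
  have initial: "initial m = (N k1 k0 k0 k0 k254 k255 k255 k255)"
    by (simp add: m_def k_defs)
  note all = all_range_refl[of 33, simplified all_range'_numeral arith_simps, unfolded k_folds]
  note mpred = mpred_all[OF m_def, simplified, unfolded k_folds]
  note msub = msub_all[OF m_def, unfolded k_folds, simplified all msub'_tab mpred]
  note mmul' = mmul'_all[OF m_def, simplified, unfolded k_folds] mmul'_0[of m, unfolded k_folds]
  note mmul = mmul_all[of 33 m, unfolded k_folds, simplified all mmul' madd_k0 msub]
  note hit_known = hit_known_all[OF m_def, simplified, unfolded k_folds]
  note madd = madd_all[of 33 m, unfolded k_folds, simplified all msub]
  note phases_die = phases_die'_def[of m k11 "(C k1 (C k4 (C k7 (C k10 (C k13 (C k16 (C k19 (C k25
    (C k28 (C k31 E))))))))))"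
      "(F1 k7 (P1 k12 (P1 k13 (P1 k14 (P1 k5 (P1 k1 (P1 k8 (P1 k2 (PG k1 (PG k3 PE))))))))))",
      simplified machine initial scan_steps(1) child_steps(1) pruned_steps(1) msub madd mmul
        hit_known]
  have "valid m 11"
    unfolding valid_def m_def cfg.sel all_range_numeral
    by (simp add: valid_eval)
  moreover have "stab m k11 (C k1 (C k4 (C k7 (C k10 (C k13 (C k16 (C k19 (C k25 (C k28 (C k31
    E))))))))))"
    unfolding stab_def all_window.simps m_def
    by (simp add: k_defs unit_mod_def)
  ultimately have "inevitable (int (modulus m))"
    using inevitable_11 by (intro inevitable_phases'[OF phases_die]) (simp_all add: k11_def)
  then show ?thesis
    by (simp add: m_def)
qed

lemma inevitable_35: "inevitable 35"
proof -
  define m where "m = M 35 (N 1 0 0 0 248 255 255 255)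
    [0,1,18,12,9,65,6,0,22,4,68,16,3,27,0,76,11,33,2,24,66,0,8,32,19,67,31,13,0,29,70,26,23,17,34]"
  have initial: "initial m = (N k1 k0 k0 k0 k248 k255 k255 k255)"
    by (simp add: m_def k_defs)
  note all = all_range_refl[of 35, simplified all_range'_numeral arith_simps, unfolded k_folds]
  note mpred = mpred_all[OF m_def, simplified, unfolded k_folds]
  note msub = msub_all[OF m_def, unfolded k_folds, simplified all msub'_tab mpred]
  note mmul' = mmul'_all[OF m_def, simplified, unfolded k_folds] mmul'_0[of m, unfolded k_folds]
  note mmul = mmul_all[of 35 m, unfolded k_folds, simplified all mmul' madd_k0 msub]
  note hit_known = hit_known_all[OF m_def, simplified, unfolded k_folds]
  note madd = madd_all[of 35 m, unfolded k_folds, simplified all msub]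
  \<comment> \<open>Starts prime to 5 matter modulo 7, where reflection sends \<open>c\<close> to
    \<open>6 - c\<close>: 1, 2, 3, 6 remain. The starts 5 and 10 repeat the classes of the modulus
    7.\<close>
  note phases_die = phases_die'_def[of m k5 "(C k1 (C k8 (C k22 (C k29 E))))"
      "(F1 k1 (P1 k11 (P1 k2 (P1 k7 (P1 k13 (P1 k6 (P1 k9 (P1 k10 (PG k1 (PG k3 (PG k6 (PG k5 (PG
        k2 (PG k10 PE))))))))))))))",
      simplified machine initial scan_steps(1) child_steps(1) pruned_steps(1) msub madd mmul
        hit_known]
  have "valid m 5"
    unfolding valid_def m_def cfg.sel all_range_numeral
    by (simp add: valid_eval)
  moreover have "stab m k5 (C k1 (C k8 (C k22 (C k29 E))))"
    unfolding stab_def all_window.simps m_def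
    by (simp add: k_defs unit_mod_def)
  ultimately have "inevitable (int (modulus m))"
    using inevitable_5 by (intro inevitable_phases'[OF phases_die]) (simp_all add: k5_def)
  then show ?thesis
    by (simp add: m_def)
qed

lemma inevitable_34: "inevitable 34"
proof -
  define m where "m = M 34 (N 1 0 0 0 252 255 255 255)
    [0,0,0,0,0,0,0,0,0,0,0,0,0,0,0,0,0,65,0,0,0,0,0,0,0,0,0,0,0,0,0,0,0,0]"
  have initial: "initial m = (N k1 k0 k0 k0 k252 k255 k255 k255)"
    by (simp add: m_def k_defs)
  note all = all_range_refl[of 34, simplified all_range'_numeral arith_simps, unfolded k_folds]
  note mpred = mpred_all[OF m_def, simplified, unfolded k_folds]
  note msub = msub_all[OF m_def, unfolded k_folds, simplified all msub'_tab mpred]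
  note mmul' = mmul'_all[OF m_def, simplified, unfolded k_folds] mmul'_0[of m, unfolded k_folds]
  note mmul = mmul_all[of 34 m, unfolded k_folds, simplified all mmul' madd_k0 msub]
  note hit_known = hit_known_all[OF m_def, simplified, unfolded k_folds]
  note madd = madd_all[of 34 m, unfolded k_folds, simplified all msub]
  note phases_die = phases_die'_def[of m k17 "(C k1 (C k3 (C k5 (C k7 (C k9 (C k11 (C k13 (C k15 (C
    k19 (C k21 (C k23 (C k25 (C k27 (C k29 (C k31 (C k33 E))))))))))))))))"
      "(FG k1 PE)",
      simplified machine initial scan_steps(1) child_steps(1) pruned_steps(1) msub madd mmul
        hit_known]
  have "valid m 17"
    unfolding valid_def m_def cfg.sel all_range_numeral
    by (simp add: valid_eval)
  moreover have "stab m k17 (C k1 (C k3 (C k5 (C k7 (C k9 (C k11 (C k13 (C k15 (C k19 (C k21 (C k23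
    (C k25 (C k27 (C k29 (C k31 (C k33 E))))))))))))))))"
    unfolding stab_def all_window.simps m_def
    by (simp add: k_defs unit_mod_def)
  ultimately have "inevitable (int (modulus m))"
    using inevitable_17 by (intro inevitable_phases'[OF phases_die]) (simp_all add: k17_def)
  then show ?thesis
    by (simp add: m_def)
qed

section \<open>Reduction to maximal moduli\<close>

theorem theorem6:
  fixes K :: "nat \<Rightarrow> nat" and b :: "nat \<Rightarrow> int" and h :: int
  assumes "index_seq K"
    and "has_deg K 3"
    and "associated K b"
    and "2 \<le> h" and "h \<le> 62"
    and "h \<notin> {36, 42, 45, 48, 54, 56, 60}"
  shows "\<exists>\<^sub>\<infinity>n. h dvd b n"
proof -
  \<comment> \<open>The admissible moduli that are maximal under divisibility; every other one
    inherits the property through \<open>inevitable_dvd\<close>.\<close>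
  define H :: "int list" where
    "H = [18, 21, 24, 27, 28, 30, 32, 33, 34, 35, 37, 38, 39, 40, 41, 43, 44, 46, 47, 49, 50, 51,
      52, 53, 55, 57, 58, 59, 61, 62]"
  have "\<forall>h\<in>set [2..62]. h \<in> {36, 42, 45, 48, 54, 56, 60} \<or> list_ex (\<lambda>k. h dvd k) H"
    by (simp add: H_def)
  moreover have "h \<in> set [2..62]"
    unfolding set_upto using assms by simp
  ultimately obtain k where "k \<in> set H" "h dvd k"
    using assms unfolding list_ex_iff by blast
  moreover have "\<forall>k\<in>set H. inevitable k"
    by (simp add: H_def inevitable_18 inevitable_21 inevitable_24 inevitable_27 inevitable_28
      inevitable_30 inevitable_32 inevitable_33 inevitable_34 inevitable_35
      inevitable_37 inevitable_38 inevitable_39 inevitable_40 inevitable_41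
      inevitable_43 inevitable_44 inevitable_46 inevitable_47 inevitable_49
      inevitable_50 inevitable_51 inevitable_52 inevitable_53 inevitable_55
      inevitable_57 inevitable_58 inevitable_59 inevitable_61 inevitable_62)
  ultimately have "inevitable h"
    using inevitable_dvd by blast
  then show ?thesis
    using assms inevitable_INFM by blast
qed

end
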